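(* A finite simple undirected graph $G$ can be explained by a labeled level-1 network if and only if $G\in\mathrm{PolarCat}^{\mathrm{prime}}$, i.e. if and only if for every prime module $M$ of $G$ with $|M|\ge 2$ the quotient graph $G[M]/\mathbb{M}_{\max}(G[M])$ is a polar-cat.
   Context: All graphs are finite, simple and undirected. For a graph $G=(V,E)$ and $W\subseteq V$, $G[W]$ is the induced subgraph, $G-v=G[V\setminus\{v\}]$, and $\overline{G}$ is the complement. The join of two vertex-disjoint graphs is their disjoint union together with all edges between them. A cograph is a graph without induced path on four vertices ($P_4$). Networks: a network on a finite set $X$ is a directed acyclic graph $N=(V,E)$ such that either $V=X=\{x\}$ and $E=\emptyset$, or (N1) there is a unique root $\rho_N$ with indegree $0$ and outdegree $\ge 2$; (N2) $x\in X$ iff $x$ has outdegree $0$ and indegree $1$ (leaves); (N3) every vertex $v\notin X\cup\{\rho_N\}$ has either indegree 1 and outdegree $\ge2$ (tree-vertex) or indegree 2 and outdegree $\ge1$ (hybrid-vertex). Vertices in $V\setminus X$ are inner vertices. $u$ is an ancestor of $v$ ($v\preceq_N u$) if there is a directed path from $u$ to $v$. A network is level-1 if every biconnected component of its underlying undirected graph contains at most one hybrid-vertex. In a level-1 network, for $x,y\in X$ the lowest common ancestor $\mathrm{lca}_N(x,y)$ (the $\preceq_N$-minimal common ancestor of $x,y$) is unique. A labeled network $(N,t)$ is a network with a map $t:V\to\{0,1,\odot\}$ with $t(v)=\odot$ iff $v\in X$. $\mathscr{G}(N,t)$ is the graph on $X$ in which distinct $x,y$ are adjacent iff $t(\mathrm{lca}_N(x,y))=1$;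 $(N,t)$ explains $G$ if $G\cong\mathscr{G}(N,t)$. Pseudo-cographs: $G$ is a pseudo-cograph if $|V(G)|\le2$ or there are induced subgraphs $G_1,G_2$ of $G$ and $v\in V(G)$ with (F1) $V(G)=V(G_1)\cup V(G_2)$, $V(G_1)\cap V(G_2)=\{v\}$, $|V(G_1)|,|V(G_2)|>1$; (F2) $G_1,G_2$ are cographs; (F3) $G-v$ is the join or the disjoint union of $G_1-v$ and $G_2-v$. Then $G$ is a $(v,G_1,G_2)$-pseudo-cograph. Caterpillars: a caterpillar is a rooted tree in which every inner vertex has exactly two children and the inner vertices induce a path with the root at one end; two leaves with a common parent form a cherry. Every cograph $H$ is explained by a unique (up to isomorphism) discriminating labeled tree (its cotree), i.e. one in which adjacent inner vertices have different labels; $H$ is caterpillar-explainable if this tree is a caterpillar. Polar-cats: let $G$ be a $(v,G_1,G_2)$-pseudo-cograph with $|V(G)|\ge3$. $G$ is polarizing if either $G_1,G_2$ are both connected and $G-v$ is the disjoint union of $G_1-v$ and $G_2-v$, or $G_1,G_2$ are both disconnected and $G-v$ is the join of $G_1-v$ and $G_2-v$. $G$ is cat if $|V(G)|\ge4$ and $G_1,G_2$ are caterpillar-explainable such that $v$ is part of a cherry in both caterpillars explaining $G_1$ and $G_2$. If both hold, $G$ is a $(v,G_1,G_2)$-polar-cat; $G$ is a polar-cat if it is a $(v,G_1,G_2)$-polar-cat for some $v,G_1,G_2$. Modules: a module of $G=(V,E)$ is $M\subseteq V$ with $N_G(x)\setminus M=N_G(y)\setminus M$ for all $x,y\in M$.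 It is strong if it does not overlap any other module (for every module $M'$, $M\cap M'\in\{M,M',\emptyset\}$). A strong module $M$ is prime if both $G[M]$ and $\overline{G[M]}$ are connected. $\mathbb{M}_{\max}(G)$ is the set of inclusion-maximal strong modules of $G$ different from $V$ (a partition of $V$ when $|V|>1$). The quotient $G/\mathbb{M}_{\max}(G)$ has vertex set $\mathbb{M}_{\max}(G)$, two modules being adjacent iff every vertex of one is adjacent to every vertex of the other. $\mathrm{PolarCat}^{\mathrm{prime}}$ is the class of graphs $G$ such that $G[M]/\mathbb{M}_{\max}(G[M])$ is a polar-cat for every prime module $M$ of $G$ with $|M|\ge2$. *)

theory Defs
  imports Main
begin

section \<open>Simple graphs\<close>

text \<open>A graph is a pair (V, E) with V a finite vertex set and E a symmetric,
  irreflexive edge relation on V.\<close>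

definition simple_graph :: "'a set \<Rightarrow> ('a \<times> 'a) set \<Rightarrow> bool" where
  "simple_graph V E \<longleftrightarrow> finite V \<and> E \<subseteq> V \<times> V \<and> sym E \<and> (\<forall>x. (x, x) \<notin> E)"

definition induced :: "('a \<times> 'a) set \<Rightarrow> 'a set \<Rightarrow> ('a \<times> 'a) set" where
  "induced E W = E \<inter> (W \<times> W)"

definition complement :: "'a set \<Rightarrow> ('a \<times> 'a) set \<Rightarrow> ('a \<times> 'a) set" where
  "complement V E = {(x, y). x \<in> V \<and> y \<in> V \<and> x \<noteq> y \<and> (x, y) \<notin> E}"

definition connected_on :: "'a set \<Rightarrow> ('a \<times> 'a) set \<Rightarrow> bool" where
  "connected_on S R \<longleftrightarrow> (\<forall>u\<in>S. \<forall>v\<in>S. (u, v) \<in> (R \<inter> (S \<times> S))\<^sup>*)"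

definition connected_graph :: "'a set \<Rightarrow> ('a \<times> 'a) set \<Rightarrow> bool" where
  "connected_graph V E \<longleftrightarrow> V \<noteq> {} \<and> connected_on V E"

definition graph_iso :: "('a \<Rightarrow> 'b) \<Rightarrow> 'a set \<Rightarrow> ('a \<times> 'a) set \<Rightarrow> 'b set \<Rightarrow> ('b \<times> 'b) set \<Rightarrow> bool" where
  "graph_iso f V E V' E' \<longleftrightarrow> bij_betw f V V' \<and> (\<forall>u\<in>V. \<forall>v\<in>V. (u, v) \<in> E \<longleftrightarrow> (f u, f v) \<in> E')"

text \<open>(V,E) is the join / disjoint union of (V1,E1) and (V2,E2).\<close>
definition is_join :: "'a set \<Rightarrow> ('a \<times> 'a) set \<Rightarrow> 'a set \<Rightarrow> ('a \<times> 'a) set \<Rightarrow> 'a set \<Rightarrow> ('a \<times> 'a) set \<Rightarrow> bool" where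
  "is_join V E V1 E1 V2 E2 \<longleftrightarrow> V1 \<inter> V2 = {} \<and> V = V1 \<union> V2 \<and>
     E = E1 \<union> E2 \<union> (V1 \<times> V2) \<union> (V2 \<times> V1)"

definition is_disjoint_union :: "'a set \<Rightarrow> ('a \<times> 'a) set \<Rightarrow> 'a set \<Rightarrow> ('a \<times> 'a) set \<Rightarrow> 'a set \<Rightarrow> ('a \<times> 'a) set \<Rightarrow> bool" where
  "is_disjoint_union V E V1 E1 V2 E2 \<longleftrightarrow> V1 \<inter> V2 = {} \<and> V = V1 \<union> V2 \<and> E = E1 \<union> E2"

text \<open>Cographs: no induced path on four vertices.\<close>
definition cograph :: "'a set \<Rightarrow> ('a \<times> 'a) set \<Rightarrow> bool" where
  "cograph V E \<longleftrightarrow> \<not> (\<exists>a b c d. a \<in> V \<and> b \<in> V \<and> c \<in> V \<and> d \<in> V \<and> distinct [a, b, c, d] \<and>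
      (a, b) \<in> E \<and> (b, c) \<in> E \<and> (c, d) \<in> E \<and>
      (a, c) \<notin> E \<and> (b, d) \<notin> E \<and> (a, d) \<notin> E)"

section \<open>Networks\<close>

definition indeg :: "('v \<times> 'v) set \<Rightarrow> 'v \<Rightarrow> nat" where
  "indeg A v = card {u. (u, v) \<in> A}"

definition outdeg :: "('v \<times> 'v) set \<Rightarrow> 'v \<Rightarrow> nat" where
  "outdeg A v = card {w. (v, w) \<in> A}"

text \<open>(VN, A) is a network on X (A is the arc set).\<close>
definition is_network :: "'v set \<Rightarrow> ('v \<times> 'v) set \<Rightarrow> 'v set \<Rightarrow> bool" where
  "is_network VN A X \<longleftrightarrow> finite VN \<and> A \<subseteq> VN \<times> VN \<and> acyclic A \<and> X \<subseteq> VN \<and>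
    ((\<exists>x. VN = {x} \<and> X = {x} \<and> A = {}) \<or>
     (\<exists>\<rho>\<in>VN. indeg A \<rho> = 0 \<and> outdeg A \<rho> \<ge> 2 \<and> (\<forall>u\<in>VN. indeg A u = 0 \<longrightarrow> u = \<rho>) \<and>
        (\<forall>v\<in>VN. v \<in> X \<longleftrightarrow> outdeg A v = 0 \<and> indeg A v = 1) \<and>
        (\<forall>v\<in>VN - (X \<union> {\<rho>}). (indeg A v = 1 \<and> outdeg A v \<ge> 2) \<or> (indeg A v = 2 \<and> outdeg A v \<ge> 1))))"

definition hybrid_vertex :: "'v set \<Rightarrow> ('v \<times> 'v) set \<Rightarrow> 'v set \<Rightarrow> 'v \<Rightarrow> bool" where
  "hybrid_vertex VN A X v \<longleftrightarrow> v \<in> VN \<and> v \<notin> X \<and> indeg A v = 2"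

definition undirected :: "('v \<times> 'v) set \<Rightarrow> ('v \<times> 'v) set" where
  "undirected A = A \<union> A\<inverse>"

text \<open>Vertex sets of biconnected subgraphs of the underlying undirected graph
  (at least two vertices, connected, and connected after removing any single vertex)
  and of biconnected components (inclusion-maximal ones).\<close>
definition biconnected_set :: "'v set \<Rightarrow> ('v \<times> 'v) set \<Rightarrow> 'v set \<Rightarrow> bool" where
  "biconnected_set VN A W \<longleftrightarrow> W \<subseteq> VN \<and> finite W \<and> card W \<ge> 2 \<and> connected_on W (undirected A) \<and>
     (\<forall>w\<in>W. connected_on (W - {w}) (undirected A))"

definition biconnected_component :: "'v set \<Rightarrow> ('v \<times> 'v) set \<Rightarrow> 'v set \<Rightarrow> bool" where
  "biconnected_component VN A W \<longleftrightarrow> biconnected_set VN A W \<and>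
     \<not> (\<exists>W'. W \<subset> W' \<and> biconnected_set VN A W')"

definition level1 :: "'v set \<Rightarrow> ('v \<times> 'v) set \<Rightarrow> 'v set \<Rightarrow> bool" where
  "level1 VN A X \<longleftrightarrow> (\<forall>W. biconnected_component VN A W \<longrightarrow> card {h \<in> W. hybrid_vertex VN A X h} \<le> 1)"

text \<open>w is a lowest common ancestor of x and y (v below u iff (u,v) in the reflexive-transitive closure of A).\<close>
definition is_lca :: "'v set \<Rightarrow> ('v \<times> 'v) set \<Rightarrow> 'v \<Rightarrow> 'v \<Rightarrow> 'v \<Rightarrow> bool" where
  "is_lca VN A x y w \<longleftrightarrow> w \<in> VN \<and> (w, x) \<in> A\<^sup>* \<and> (w, y) \<in> A\<^sup>* \<and>
     (\<forall>w'\<in>VN. (w', x) \<in> A\<^sup>* \<and> (w', y) \<in> A\<^sup>* \<and> (w, w') \<in> A\<^sup>* \<longrightarrow> w' = w)"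

definition lca :: "'v set \<Rightarrow> ('v \<times> 'v) set \<Rightarrow> 'v \<Rightarrow> 'v \<Rightarrow> 'v" where
  "lca VN A x y = (THE w. is_lca VN A x y w)"

datatype label = L0 | L1 | LOdot

definition labeling :: "'v set \<Rightarrow> 'v set \<Rightarrow> ('v \<Rightarrow> label) \<Rightarrow> bool" where
  "labeling VN X t \<longleftrightarrow> (\<forall>v\<in>VN. t v = LOdot \<longleftrightarrow> v \<in> X)"

text \<open>Edge set of the graph \<open>\<G>(N,t)\<close> on X.\<close>
definition net_graph_edges :: "'v set \<Rightarrow> ('v \<times> 'v) set \<Rightarrow> 'v set \<Rightarrow> ('v \<Rightarrow> label) \<Rightarrow> ('v \<times> 'v) set" where
  "net_graph_edges VN A X t = {(x, y). x \<in> X \<and> y \<in> X \<and> x \<noteq> y \<and> t (lca VN A x y) = L1}"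

text \<open>G is explained by a labeled level-1 network (networks with vertices in nat;
  every finite network is isomorphic to one of these).\<close>
definition explainable_level1 :: "'a set \<Rightarrow> ('a \<times> 'a) set \<Rightarrow> bool" where
  "explainable_level1 V E \<longleftrightarrow> (\<exists>(VN :: nat set) A X t f. is_network VN A X \<and> level1 VN A X \<and>
      labeling VN X t \<and> graph_iso f V E X (net_graph_edges VN A X t))"

section \<open>Caterpillars and cotrees\<close>

definition is_tree :: "'v set \<Rightarrow> ('v \<times> 'v) set \<Rightarrow> 'v set \<Rightarrow> bool" where
  "is_tree VN A X \<longleftrightarrow> is_network VN A X \<and> (\<forall>v. \<not> hybrid_vertex VN A X v)"

definition caterpillar :: "'v set \<Rightarrow> ('v \<times> 'v) set \<Rightarrow> 'v set \<Rightarrow> bool" where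
  "caterpillar VN A X \<longleftrightarrow> is_tree VN A X \<and> (\<forall>v\<in>VN - X. outdeg A v = 2) \<and>
     (\<exists>us. us \<noteq> [] \<and> distinct us \<and> set us = VN - X \<and> indeg A (hd us) = 0 \<and>
        (\<forall>a\<in>VN - X. \<forall>b\<in>VN - X. ((a, b) \<in> A \<or> (b, a) \<in> A) \<longleftrightarrow>
            (\<exists>i. Suc i < length us \<and> {a, b} = {us ! i, us ! Suc i})))"

definition discriminating :: "('v \<times> 'v) set \<Rightarrow> 'v set \<Rightarrow> ('v \<Rightarrow> label) \<Rightarrow> bool" where
  "discriminating A X t \<longleftrightarrow> (\<forall>(u, w)\<in>A. u \<notin> X \<and> w \<notin> X \<longrightarrow> t u \<noteq> t w)"

definition in_cherry :: "('v \<times> 'v) set \<Rightarrow> 'v set \<Rightarrow> 'v \<Rightarrow> bool" where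
  "in_cherry A X x \<longleftrightarrow> x \<in> X \<and> (\<exists>p y. y \<in> X \<and> y \<noteq> x \<and> (p, x) \<in> A \<and> (p, y) \<in> A)"

text \<open>H is caterpillar-explainable (its discriminating labeled tree, i.e. cotree,
  is a caterpillar) and v is part of the cherry of that caterpillar.\<close>
definition caterpillar_explainable_cherry :: "'a set \<Rightarrow> ('a \<times> 'a) set \<Rightarrow> 'a \<Rightarrow> bool" where
  "caterpillar_explainable_cherry V E v \<longleftrightarrow> (\<exists>(VN :: nat set) A X t f. caterpillar VN A X \<and>
      labeling VN X t \<and> discriminating A X t \<and> graph_iso f V E X (net_graph_edges VN A X t) \<and>
      in_cherry A X (f v))"

section \<open>Pseudo-cographs and polar-cats\<close>

definition pseudo_cograph_at :: "'a set \<Rightarrow> ('a \<times> 'a) set \<Rightarrow> 'a \<Rightarrow> 'a set \<Rightarrow> 'a set \<Rightarrow> bool" where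
  "pseudo_cograph_at V E v V1 V2 \<longleftrightarrow> V1 \<subseteq> V \<and> V2 \<subseteq> V \<and>
     V1 \<union> V2 = V \<and> V1 \<inter> V2 = {v} \<and> card V1 > 1 \<and> card V2 > 1 \<and>
     cograph V1 (induced E V1) \<and> cograph V2 (induced E V2) \<and>
     (is_join (V - {v}) (induced E (V - {v})) (V1 - {v}) (induced E (V1 - {v})) (V2 - {v}) (induced E (V2 - {v})) \<or>
      is_disjoint_union (V - {v}) (induced E (V - {v})) (V1 - {v}) (induced E (V1 - {v})) (V2 - {v}) (induced E (V2 - {v})))"

definition pseudo_cograph :: "'a set \<Rightarrow> ('a \<times> 'a) set \<Rightarrow> bool" where
  "pseudo_cograph V E \<longleftrightarrow> card V \<le> 2 \<or> (\<exists>v V1 V2. pseudo_cograph_at V E v V1 V2)"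

definition polarizing_at :: "'a set \<Rightarrow> ('a \<times> 'a) set \<Rightarrow> 'a \<Rightarrow> 'a set \<Rightarrow> 'a set \<Rightarrow> bool" where
  "polarizing_at V E v V1 V2 \<longleftrightarrow> pseudo_cograph_at V E v V1 V2 \<and> card V \<ge> 3 \<and>
     ((connected_graph V1 (induced E V1) \<and> connected_graph V2 (induced E V2) \<and>
       is_disjoint_union (V - {v}) (induced E (V - {v})) (V1 - {v}) (induced E (V1 - {v})) (V2 - {v}) (induced E (V2 - {v}))) \<or>
      (\<not> connected_graph V1 (induced E V1) \<and> \<not> connected_graph V2 (induced E V2) \<and>
       is_join (V - {v}) (induced E (V - {v})) (V1 - {v}) (induced E (V1 - {v})) (V2 - {v}) (induced E (V2 - {v}))))"

definition cat_at :: "'a set \<Rightarrow> ('a \<times> 'a) set \<Rightarrow> 'a \<Rightarrow> 'a set \<Rightarrow> 'a set \<Rightarrow> bool" where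
  "cat_at V E v V1 V2 \<longleftrightarrow> pseudo_cograph_at V E v V1 V2 \<and> card V \<ge> 4 \<and>
     caterpillar_explainable_cherry V1 (induced E V1) v \<and>
     caterpillar_explainable_cherry V2 (induced E V2) v"

definition polar_cat :: "'a set \<Rightarrow> ('a \<times> 'a) set \<Rightarrow> bool" where
  "polar_cat V E \<longleftrightarrow> (\<exists>v V1 V2. polarizing_at V E v V1 V2 \<and> cat_at V E v V1 V2)"

section \<open>Modules\<close>

definition nbh :: "('a \<times> 'a) set \<Rightarrow> 'a \<Rightarrow> 'a set" where
  "nbh E x = {y. (x, y) \<in> E}"

definition is_module :: "'a set \<Rightarrow> ('a \<times> 'a) set \<Rightarrow> 'a set \<Rightarrow> bool" where
  "is_module V E M \<longleftrightarrow> M \<subseteq> V \<and> (\<forall>x\<in>M. \<forall>y\<in>M. nbh E x - M = nbh E y - M)"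

definition strong_module :: "'a set \<Rightarrow> ('a \<times> 'a) set \<Rightarrow> 'a set \<Rightarrow> bool" where
  "strong_module V E M \<longleftrightarrow> is_module V E M \<and>
     (\<forall>M'. is_module V E M' \<longrightarrow> M \<inter> M' = M \<or> M \<inter> M' = M' \<or> M \<inter> M' = {})"

definition prime_module :: "'a set \<Rightarrow> ('a \<times> 'a) set \<Rightarrow> 'a set \<Rightarrow> bool" where
  "prime_module V E M \<longleftrightarrow> strong_module V E M \<and> connected_graph M (induced E M) \<and>
     connected_graph M (complement M (induced E M))"

definition max_strong_modules :: "'a set \<Rightarrow> ('a \<times> 'a) set \<Rightarrow> 'a set set" where
  "max_strong_modules V E = {M. strong_module V E M \<and> M \<noteq> V \<and>
     (\<forall>M'. strong_module V E M' \<and> M' \<noteq> V \<and> M \<subseteq> M' \<longrightarrow> M' = M)}"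

definition quotient_edges :: "('a \<times> 'a) set \<Rightarrow> 'a set set \<Rightarrow> ('a set \<times> 'a set) set" where
  "quotient_edges E P = {(M1, M2). M1 \<in> P \<and> M2 \<in> P \<and> M1 \<noteq> M2 \<and> (\<forall>a\<in>M1. \<forall>b\<in>M2. (a, b) \<in> E)}"

definition polarcat_prime :: "'a set \<Rightarrow> ('a \<times> 'a) set \<Rightarrow> bool" where
  "polarcat_prime V E \<longleftrightarrow> (\<forall>M. prime_module V E M \<and> card M \<ge> 2 \<longrightarrow>
     polar_cat (max_strong_modules M (induced E M))
               (quotient_edges (induced E M) (max_strong_modules M (induced E M))))"

end

(* A network explaining G induces on any prime set S of representatives a single cycle: below a
   minimal vertex u that reaches all of S, two children of u overlap, and everything they share lies
   below one hybrid h, because two cycles with a common edge lie in one biconnected set. Reading the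
   sets that branch off along the two paths from u to h yields two sequences in which each set is
   uniformly joined to everything after it. Primality collapses the sets to single vertices and makes
   the labels alternate, which is a polar-cat.

   Conversely, G is assembled along its modular decomposition by identifying a leaf of one network
   with the root of another. This keeps biconnected sets apart and realises the substitution of a
   module for a vertex, so only polar-cats and graphs on at most two vertices need an explicit network. *)
theory Submission
  imports Defs
begin

section \<open>Biconnected sets and directed paths\<close>

text \<open>\<open>lca\<close> is a definite description, so labels say nothing before level-1
  networks are known to have unique lowest common ancestors; this already requires a cycle argument.
  Every use of level-1 rests on one principle: biconnected sets with two common vertices unite, a
  biconnected set has at most one hybrid, and a hybrid has two parents. A configuration is excluded
  by a second hybrid or by a third parent. Connectedness of a graph and of its complement is handled
  as \<open>split_free\<close>: no nontrivial bipartition is a join or a disjoint union. One Boolean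
  flag then serves as label of a vertex, as kind of a split and as adjacency of a block to its
  successors, so the two polarities are treated together. A caterpillar with \<open>v\<close> in its
  cherry becomes a \<open>chain\<close> ending in \<open>v\<close>: the leaves from the root
  downwards, each with the label of its parent. A polar-cat is a pair of chains with a common end,
  which is what a single cycle with one leaf below its hybrid displays. In the converse, a graph
  that splits uniformly is obtained by substituting its two parts into a two-vertex graph.\<close>

lemma connected_on_Un:
  assumes "connected_on S R" "connected_on T R" "S \<inter> T \<noteq> {}"
  shows "connected_on (S \<union> T) R"
proof -
  let ?Q = "R \<inter> ((S \<union> T) \<times> (S \<union> T))"
  obtain z where z: "z \<in> S" "z \<in> T" using assms(3) by auto
  have S: "(R \<inter> (S \<times> S))\<^sup>* \<subseteq> ?Q\<^sup>*" and T: "(R \<inter> (T \<times> T))\<^sup>* \<subseteq> ?Q\<^sup>*"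
    by (rule rtrancl_mono, blast)+
  have "(u, z) \<in> ?Q\<^sup>* \<and> (z, u) \<in> ?Q\<^sup>*" if "u \<in> S \<union> T" for u
    using that S T z assms(1,2) unfolding connected_on_def by blast
  then show ?thesis unfolding connected_on_def by (meson rtrancl_trans)
qed

lemma connected_on_path:
  assumes "sym R" "successively (\<lambda>a b. (a, b) \<in> R) xs"
  shows "connected_on (set xs) R"
  using assms(2)
proof (induction xs rule: induct_list012)
  case 1
  then show ?case by (simp add: connected_on_def)
next
  case (2 x)
  then show ?case by (simp add: connected_on_def)
next
  case (3 x y zs)
  have xy: "(x, y) \<in> R" "(y, x) \<in> R" using 3(3) assms(1) by (auto dest: symD)
  have "connected_on {x, y} R" unfolding connected_on_def
    using xy by (auto intro!: r_into_rtrancl)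
  moreover have "connected_on (set (y # zs)) R" using 3 by auto
  ultimately have "connected_on ({x, y} \<union> set (y # zs)) R"
    by (rule connected_on_Un) auto
  moreover have "{x, y} \<union> set (y # zs) = set (x # y # zs)" by auto
  ultimately show ?case by simp
qed

text \<open>Deleting an end leaves two paths that still share the other end. Deleting an inner
  vertex of \<open>U1\<close> cuts it into two pieces, one containing \<open>a\<close> and one
  containing \<open>b\<close>, and the untouched \<open>U2\<close> joins them.\<close>

lemma connected_on_theta_minus:
  assumes R: "sym R" and s1: "successively (\<lambda>x y. (x, y) \<in> R) U1"
    and s2: "successively (\<lambda>x y. (x, y) \<in> R) U2"
    and ne: "U1 \<noteq> []" "U2 \<noteq> []" and h: "hd U1 = a" "hd U2 = a"
    and l: "last U1 = b" "last U2 = b" and ab: "a \<noteq> b"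
    and d: "distinct U1" "distinct U2" and I: "set U1 \<inter> set U2 = {a, b}"
    and w: "w \<in> set U1"
  shows "connected_on (set U1 \<union> set U2 - {w}) R"
proof -
  obtain T1 where T1: "U1 = a # T1" using ne(1) h(1) by (cases U1) auto
  obtain T2 where T2: "U2 = a # T2" using ne(2) h(2) by (cases U2) auto
  have T1b: "b \<in> set T1" using T1 l(1) ab by (auto split: if_splits)
  have T2b: "b \<in> set T2" using T2 l(2) ab by (auto split: if_splits)
  let ?P = "\<lambda>x y. (x, y) \<in> R"
  have su: "successively ?P xs \<and> successively ?P ys" if "successively ?P (xs @ ys)" for xs ys
    using that by (auto simp: successively_append_iff)
  consider "w = a" | "w \<noteq> a" "w = b" | "w \<noteq> a" "w \<noteq> b" by blast
  then show ?thesis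
  proof cases
    case 1
    have "connected_on (set T1 \<union> set T2) R"
    proof (rule connected_on_Un)
      show "connected_on (set T1) R" using su[of "[a]" T1] s1 T1 by (auto intro!: connected_on_path[OF R])
      show "connected_on (set T2) R" using su[of "[a]" T2] s2 T2 by (auto intro!: connected_on_path[OF R])
    qed (use T1b T2b in auto)
    moreover have "set U1 \<union> set U2 - {w} = set T1 \<union> set T2" using 1 T1 T2 d by auto
    ultimately show ?thesis by simp
  next
    case 2
    obtain Y1 where Y1: "U1 = Y1 @ [b]" using ne(1) l(1) by (metis append_butlast_last_id)
    obtain Y2 where Y2: "U2 = Y2 @ [b]" using ne(2) l(2) by (metis append_butlast_last_id)
    have "a \<in> set Y1" "a \<in> set Y2" using Y1 Y2 T1 T2 ab by (auto simp: Cons_eq_append_conv)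
    moreover have "successively ?P Y1" "successively ?P Y2"
      using su[of Y1 "[b]"] su[of Y2 "[b]"] s1 s2 Y1 Y2 by auto
    ultimately have "connected_on (set Y1 \<union> set Y2) R" by (intro connected_on_Un connected_on_path[OF R]) auto
    moreover have "set U1 \<union> set U2 - {w} = set Y1 \<union> set Y2" using 2 Y1 Y2 d by auto
    ultimately show ?thesis by simp
  next
    case 3
    obtain ys zs where yz: "U1 = ys @ w # zs" using w by (meson split_list)
    have a: "a \<in> set ys" using yz T1 3 by (auto simp: Cons_eq_append_conv)
    have b: "b \<in> set zs" using yz l(1) 3 by (auto split: if_splits)
    have "w \<notin> set U2" using 3 I w by blast
    then have e: "set U1 \<union> set U2 - {w} = (set ys \<union> set U2) \<union> set zs" using yz d by auto
    have ab2: "a \<in> set U2" "b \<in> set U2" using T2 T2b by auto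
    have "successively (\<lambda>x y. (x, y) \<in> R) ys" "successively (\<lambda>x y. (x, y) \<in> R) (w # zs)"
      using su[of ys "w # zs"] s1 yz by auto
    then have "successively (\<lambda>x y. (x, y) \<in> R) ys" "successively (\<lambda>x y. (x, y) \<in> R) zs"
      using su[of "[w]" zs] by auto
    then have "connected_on ((set ys \<union> set U2) \<union> set zs) R"
      using s2 a b ab2 by (intro connected_on_Un connected_on_path[OF R]) auto
    then show ?thesis using e by simp
  qed
qed

lemma sym_undirected: "sym (undirected A)"
  by (auto simp: undirected_def sym_def)

text \<open>A cycle is presented as two paths with common ends and nothing else in common, because
  the cycles below arise from pairs of directed paths. Both paths play the same role, so the
  previous lemma covers the deletion of any vertex.\<close>

lemma biconnected_theta:
  assumes V: "set U1 \<union> set U2 \<subseteq> VN"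
    and s1: "successively (\<lambda>x y. (x, y) \<in> undirected A) U1"
    and s2: "successively (\<lambda>x y. (x, y) \<in> undirected A) U2"
    and ne: "U1 \<noteq> []" "U2 \<noteq> []" and h: "hd U1 = a" "hd U2 = a"
    and l: "last U1 = b" "last U2 = b" and ab: "a \<noteq> b"
    and d: "distinct U1" "distinct U2" and I: "set U1 \<inter> set U2 = {a, b}"
  shows "biconnected_set VN A (set U1 \<union> set U2)"
proof -
  have "card {a, b} \<le> card (set U1 \<union> set U2)"
    using I by (intro card_mono) auto
  then have "card (set U1 \<union> set U2) \<ge> 2" using ab by simp
  moreover have "connected_on (set U1 \<union> set U2) (undirected A)"
    using I s1 s2 by (intro connected_on_Un connected_on_path sym_undirected) auto
  moreover have "connected_on (set U1 \<union> set U2 - {w}) (undirected A)" if "w \<in> set U1 \<union> set U2" for w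
  proof (cases "w \<in> set U1")
    case True
    then show ?thesis using assms
      by (intro connected_on_theta_minus[OF sym_undirected s1 s2]) auto
  next
    case False
    then have "w \<in> set U2" using that by auto
    then have "connected_on (set U2 \<union> set U1 - {w}) (undirected A)" using assms
      by (intro connected_on_theta_minus[OF sym_undirected s2 s1]) auto
    then show ?thesis by (simp add: Un_commute)
  qed
  ultimately show ?thesis using V by (auto simp: biconnected_set_def)
qed

text \<open>After the deletion of any vertex one of \<open>a\<close> and \<open>b\<close> survives,
  so the two remainders still overlap.\<close>

lemma biconnected_Un:
  assumes "biconnected_set VN A S" "biconnected_set VN A T" "a \<in> S \<inter> T" "b \<in> S \<inter> T" "a \<noteq> b"
  shows "biconnected_set VN A (S \<union> T)"
proof -
  have fin: "finite S" "finite T" using assms by (auto simp: biconnected_set_def)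
  have "card S \<le> card (S \<union> T)" using fin by (intro card_mono) auto
  then have "card (S \<union> T) \<ge> 2" using assms(1) by (auto simp: biconnected_set_def)
  moreover have "connected_on (S \<union> T) (undirected A)"
    using assms by (intro connected_on_Un) (auto simp: biconnected_set_def)
  moreover have "connected_on (S \<union> T - {w}) (undirected A)" for w
  proof -
    have "connected_on (S - {w}) (undirected A)" "connected_on (T - {w}) (undirected A)"
      using assms(1,2) by (cases "w \<in> S"; cases "w \<in> T"; auto simp: biconnected_set_def)+
    then have "connected_on ((S - {w}) \<union> (T - {w})) (undirected A)"
      using assms(3-5) by (intro connected_on_Un) auto
    then show ?thesis by (simp add: Un_Diff)
  qed
  ultimately show ?thesis using assms(1,2) by (auto simp: biconnected_set_def)
qed

text \<open>\<open>level1\<close> speaks of maximal biconnected sets only. There are finitely many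
  biconnected sets, so \<open>W\<close> extends to a maximal one, which contains both
  hybrids.\<close>

lemma biconnected_one_hybrid:
  assumes "level1 VN A X" "finite VN" "biconnected_set VN A W"
    and "h1 \<in> W" "h2 \<in> W" "hybrid_vertex VN A X h1" "hybrid_vertex VN A X h2"
  shows "h1 = h2"
proof -
  let ?F = "{W. biconnected_set VN A W}"
  have "finite ?F" by (rule finite_subset[of _ "Pow VN"]) (use assms(2) in \<open>auto simp: biconnected_set_def\<close>)
  then obtain B where B: "B \<in> ?F" "W \<subseteq> B" "\<And>W'. W' \<in> ?F \<Longrightarrow> B \<subseteq> W' \<Longrightarrow> W' = B"
    using finite_has_maximal2[of ?F W] assms(3) by auto
  then have "biconnected_component VN A B" unfolding biconnected_component_def by blast
  then have c: "card {h \<in> B. hybrid_vertex VN A X h} \<le> Suc 0" using assms(1) by (simp add: level1_def)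
  have "finite {h \<in> B. hybrid_vertex VN A X h}" using B by (auto simp: biconnected_set_def)
  then show ?thesis using c assms B by (auto simp: card_le_Suc0_iff_eq)
qed

section \<open>Directed paths as vertex lists\<close>

definition dpath :: "('v \<times> 'v) set \<Rightarrow> 'v list \<Rightarrow> 'v \<Rightarrow> 'v \<Rightarrow> bool" where
  "dpath A xs a b \<longleftrightarrow> xs \<noteq> [] \<and> hd xs = a \<and> last xs = b \<and> successively (\<lambda>x y. (x, y) \<in> A) xs"

lemma dpath_Cons:
  assumes "(a, b) \<in> A" "dpath A xs b c"
  shows "dpath A (a # xs) a c"
  using assms by (cases xs) (auto simp: dpath_def)

lemma dpath_mem:
  assumes "dpath A xs a b" "x \<in> set xs"
  shows "(a, x) \<in> A\<^sup>* \<and> (x, b) \<in> A\<^sup>*"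
  using assms
proof (induction xs arbitrary: a x)
  case Nil
  then show ?case by simp
next
  case (Cons y ys)
  show ?case
  proof (cases ys)
    case Nil
    then show ?thesis using Cons by (auto simp: dpath_def)
  next
    case (Cons z zs)
    then have p: "dpath A ys z b" "(y, z) \<in> A" "a = y" using Cons.prems by (auto simp: dpath_def)
    have "(z, b) \<in> A\<^sup>*" using Cons.IH[OF p(1), of z] Cons by auto
    moreover have "(z, x) \<in> A\<^sup>* \<and> (x, b) \<in> A\<^sup>*" if "x \<in> set ys" using Cons.IH[OF p(1) that] .
    ultimately show ?thesis using p Cons.prems(2) by (auto intro: converse_rtrancl_into_rtrancl)
  qed
qed

lemma dpath_distinct:
  assumes "acyclic A" "dpath A xs a b"
  shows "distinct xs"
  using assms(2)
proof (induction xs arbitrary: a)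
  case Nil
  then show ?case by simp
next
  case (Cons y ys)
  show ?case
  proof (cases ys)
    case Nil
    then show ?thesis by simp
  next
    case (Cons z zs)
    then have p: "dpath A ys z b" "(y, z) \<in> A" using Cons.prems by (auto simp: dpath_def)
    have "y \<notin> set ys"
    proof
      assume "y \<in> set ys"
      then have "(z, y) \<in> A\<^sup>*" using dpath_mem[OF p(1)] by blast
      then have "(y, y) \<in> A\<^sup>+" using p(2) by (meson rtrancl_into_trancl2)
      then show False using assms(1) by (simp add: acyclic_def)
    qed
    then show ?thesis using Cons.IH[OF p(1)] by simp
  qed
qed

text \<open>Applied with \<open>P\<close> saying that a second vertex reaches the point as well. The
  path then ends where two routes merge, and its earlier vertices cannot lie on the second route;
  this yields two different parents of the meeting point.\<close>

lemma dpath_first_hit: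
  assumes "(a, z) \<in> A\<^sup>*" "P z"
  shows "\<exists>h xs. dpath A xs a h \<and> (h, z) \<in> A\<^sup>* \<and> P h \<and> (\<forall>x \<in> set (butlast xs). \<not> P x)"
  using assms
proof (induction rule: converse_rtrancl_induct)
  case base
  then show ?case by (intro exI[of _ z] exI[of _ "[z]"]) (simp add: dpath_def)
next
  case (step y y')
  show ?case
  proof (cases "P y")
    case True
    then show ?thesis using step(1,2) by (intro exI[of _ y] exI[of _ "[y]"]) (simp add: dpath_def)
  next
    case False
    obtain h xs where "dpath A xs y' h \<and> (h, z) \<in> A\<^sup>* \<and> P h \<and> (\<forall>x \<in> set (butlast xs). \<not> P x)"
      using step by blast
    then show ?thesis using False dpath_Cons[OF step(1)]
      by (intro exI[of _ h] exI[of _ "y # xs"]) (auto split: if_splits)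
  qed
qed

lemma dpath_exists: "(a, b) \<in> A\<^sup>* \<Longrightarrow> \<exists>xs. dpath A xs a b"
  using dpath_first_hit[of a b A "\<lambda>x. x = b"] by blast

lemma dpath_last_step:
  assumes "dpath A xs a b" "a \<noteq> b"
  shows "\<exists>g \<in> set (butlast xs). (g, b) \<in> A"
proof -
  define ys where "ys = butlast xs"
  have x: "xs = ys @ [b]" using assms by (auto simp: dpath_def ys_def)
  have "ys \<noteq> []" using x assms by (auto simp: dpath_def)
  then have "(last ys, b) \<in> A" using assms(1) x by (auto simp: dpath_def successively_append_iff)
  then show ?thesis using \<open>ys \<noteq> []\<close> ys_def by (intro bexI[of _ "last ys"]) auto
qed

lemma dpath_set_butlast: "dpath A xs a b \<Longrightarrow> set xs = insert b (set (butlast xs))"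
proof -
  assume "dpath A xs a b"
  then have "xs = butlast xs @ [b]" by (auto simp: dpath_def)
  then show ?thesis by (metis Un_insert_right list.simps(15) set_append sup_bot_right empty_set)
qed

lemma dpath_undirected: "dpath A xs a b \<Longrightarrow> successively (\<lambda>x y. (x, y) \<in> undirected A) xs"
  unfolding dpath_def by (auto elim: successively_mono simp: undirected_def)

lemma dpath_append:
  assumes "dpath A xs a b" "(b, c) \<in> A" "dpath A ys c d"
  shows "dpath A (xs @ ys) a d"
  using assms by (auto simp: dpath_def successively_append_iff)

lemma dpath_subset:
  assumes "dpath A xs a b" "A \<subseteq> VN \<times> VN" "a \<in> VN"
  shows "set xs \<subseteq> VN"
proof
  fix x assume "x \<in> set xs"
  then have "(a, x) \<in> A\<^sup>*" using dpath_mem assms(1) by metis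
  then show "x \<in> VN" using assms(2,3) by (induction) auto
qed

section \<open>Structure of level-1 networks\<close>

locale level1_network =
  fixes VN :: "'v set" and A :: "('v \<times> 'v) set" and X :: "'v set"
  assumes network: "is_network VN A X" and level1: "level1 VN A X"
begin

lemma finite_VN: "finite VN" and arcs: "A \<subseteq> VN \<times> VN" and acyclic: "acyclic A" and leaves_subset: "X \<subseteq> VN"
  using network by (auto simp: is_network_def)

lemma finite_A: "finite A"
  using finite_VN arcs by (meson finite_SigmaI finite_subset)

lemma no_cycle: "(a, b) \<in> A \<Longrightarrow> (b, a) \<notin> A\<^sup>*"
  using acyclic unfolding acyclic_def by (meson rtrancl_into_trancl2)

lemma antisym_reach: "(a, b) \<in> A\<^sup>* \<Longrightarrow> (b, a) \<in> A\<^sup>* \<Longrightarrow> a = b"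
  by (metis converse_rtranclE no_cycle rtrancl_trans)

lemma no_loop: "(a, a) \<notin> A" using no_cycle by blast

lemma reach_VN: "(a, b) \<in> A\<^sup>* \<Longrightarrow> a \<in> VN \<Longrightarrow> b \<in> VN"
  by (induction rule: rtrancl_induct) (use arcs in auto)

lemma finite_preds: "finite {u. (u, v) \<in> A}"
  by (rule finite_subset[OF _ finite_VN]) (use arcs in auto)

lemma finite_succs: "finite {u. (v, u) \<in> A}"
  by (rule finite_subset[OF _ finite_VN]) (use arcs in auto)

lemma indeg_le_2: "indeg A v \<le> 2"
proof (cases "v \<in> VN")
  case True
  then have "A = {} \<or> indeg A v = 0 \<or> indeg A v = 1 \<or> indeg A v = 2"
    using network unfolding is_network_def by blast
  then show ?thesis by (auto simp: indeg_def)
next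
  case False
  then have "{u. (u, v) \<in> A} = {}" using arcs by auto
  then show ?thesis by (simp add: indeg_def)
qed

lemma leaf_no_succ: "x \<in> X \<Longrightarrow> (x, y) \<notin> A"
proof
  assume x: "x \<in> X" and xy: "(x, y) \<in> A"
  then have "A \<noteq> {}" by auto
  then have "outdeg A x = 0" using network x leaves_subset unfolding is_network_def by blast
  then show False using xy finite_succs[of x] by (auto simp: outdeg_def)
qed

text \<open>An inequality, because the leaf of the one-vertex network has indegree 0.\<close>

lemma leaf_indeg: "x \<in> X \<Longrightarrow> indeg A x \<le> 1"
proof (cases "A = {}")
  case False
  assume "x \<in> X"
  then have "indeg A x = 1" using network leaves_subset False unfolding is_network_def by blast
  then show ?thesis by simp
qed (simp add: indeg_def)

lemma leaf_unique_parent: "x \<in> X \<Longrightarrow> (p, x) \<in> A \<Longrightarrow> (q, x) \<in> A \<Longrightarrow> p = q"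
  using leaf_indeg[of x] finite_preds[of x] by (auto simp: indeg_def card_le_Suc0_iff_eq)

lemma leaf_reach: "x \<in> X \<Longrightarrow> (x, y) \<in> A\<^sup>* \<Longrightarrow> y = x"
  using leaf_no_succ by (blast elim: converse_rtranclE)

lemma hybrid_if_two_parents:
  assumes "(g1, h) \<in> A" "(g2, h) \<in> A" "g1 \<noteq> g2"
  shows "hybrid_vertex VN A X h"
proof -
  have "card {g1, g2} \<le> indeg A h" unfolding indeg_def
    using assms finite_preds by (intro card_mono) auto
  then have "indeg A h = 2" using assms(3) indeg_le_2[of h] by auto
  moreover have "h \<notin> X" using leaf_unique_parent assms by blast
  ultimately show ?thesis using assms arcs by (auto simp: hybrid_vertex_def)
qed

lemma no_three_parents:
  assumes "(g1, h) \<in> A" "(g2, h) \<in> A" "(g3, h) \<in> A" "g1 \<noteq> g2" "g1 \<noteq> g3" "g2 \<noteq> g3"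
  shows False
proof -
  have "card {g1, g2, g3} \<le> indeg A h" unfolding indeg_def
    using assms finite_preds by (intro card_mono) auto
  then show False using assms indeg_le_2[of h] by auto
qed

lemma one_hybrid:
  assumes "biconnected_set VN A W" "h1 \<in> W" "h2 \<in> W" "hybrid_vertex VN A X h1" "hybrid_vertex VN A X h2"
  shows "h1 = h2"
  using biconnected_one_hybrid[OF level1 finite_VN] assms by blast

text \<open>Climbing from parent to parent ends by finiteness and acyclicity, and only the root has
  no parent.\<close>

lemma root_reaches:
  "\<exists>\<rho>\<in>VN. (\<forall>v\<in>VN. (\<rho>, v) \<in> A\<^sup>*)"
proof -
  obtain \<rho> where \<rho>: "\<rho> \<in> VN" "\<And>v. v \<in> VN \<Longrightarrow> indeg A v = 0 \<Longrightarrow> v = \<rho>"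
    using network unfolding is_network_def by blast
  have "wf A" using acyclic finite_A by (simp add: finite_acyclic_wf)
  then have "v \<in> VN \<longrightarrow> (\<rho>, v) \<in> A\<^sup>*" for v
  proof (induction v rule: wf_induct_rule)
    case (less v)
    show ?case
    proof
      assume v: "v \<in> VN"
      show "(\<rho>, v) \<in> A\<^sup>*"
      proof (cases "indeg A v = 0")
        case True
        then show ?thesis using \<rho>(2) v by blast
      next
        case False
        then obtain u where u: "(u, v) \<in> A" unfolding indeg_def
          by (cases "{u. (u, v) \<in> A} = {}") auto
        then have "u \<in> VN" using arcs by blast
        then show ?thesis using less.IH[OF u] u by (blast intro: rtrancl_into_rtrancl)
      qed
    qed
  qed
  then show ?thesis using \<rho> by blast
qed

section \<open>Lowest common ancestors and their uniqueness\<close>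

lemma is_lcaI:
  assumes "w \<in> VN" "(w, x) \<in> A\<^sup>*" "(w, y) \<in> A\<^sup>*"
    and "\<And>c. (w, c) \<in> A \<Longrightarrow> (c, x) \<in> A\<^sup>* \<Longrightarrow> (c, y) \<in> A\<^sup>* \<Longrightarrow> False"
  shows "is_lca VN A x y w"
  \<comment> \<open>A common ancestor strictly below \<open>w\<close> is reached through a child of
    \<open>w\<close>, and that child is a common ancestor too.\<close>
  using assms unfolding is_lca_def by (metis converse_rtranclE rtrancl_trans)

lemma is_lcaD:
  assumes "is_lca VN A x y w"
  shows "w \<in> VN" "(w, x) \<in> A\<^sup>*" "(w, y) \<in> A\<^sup>*"
    "\<And>z. (z, x) \<in> A\<^sup>* \<Longrightarrow> (z, y) \<in> A\<^sup>* \<Longrightarrow> (w, z) \<in> A\<^sup>* \<Longrightarrow> z = w"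
proof -
  show w: "w \<in> VN" "(w, x) \<in> A\<^sup>*" "(w, y) \<in> A\<^sup>*" using assms by (simp_all add: is_lca_def)
  fix z assume z: "(z, x) \<in> A\<^sup>*" "(z, y) \<in> A\<^sup>*" "(w, z) \<in> A\<^sup>*"
  have "z \<in> VN" using reach_VN z(3) w(1) by metis
  then show "z = w" using assms z unfolding is_lca_def by metis
qed

text \<open>Distinct candidates \<open>w\<close> and \<open>w'\<close> are incomparable. Descend
  from \<open>w\<close> towards \<open>x\<close> to the first vertex \<open>p\<close> below
  \<open>w'\<close>, and towards \<open>y\<close> to the first vertex \<open>q\<close> below
  \<open>w'\<close>. The routes from \<open>w\<close> over \<open>p\<close> and over
  \<open>q\<close> to \<open>w'\<close> close a cycle on which \<open>p\<close> and \<open>q\<close>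
  are both hybrids. Level-1 forces \<open>p = q\<close>, a common ancestor of \<open>x\<close> and
  \<open>y\<close> strictly below \<open>w\<close>.\<close>

lemma is_lca_unique:
  assumes w: "is_lca VN A x y w" and w': "is_lca VN A x y w'"
  shows "w = w'"
proof (rule ccontr)
  assume ne: "w \<noteq> w'"
  note W = is_lcaD[OF w] and W' = is_lcaD[OF w']
  have inc: "(w, w') \<notin> A\<^sup>*" "(w', w) \<notin> A\<^sup>*" using W(4)[of w'] W'(4)[of w] W W' ne by metis+
  obtain p P where P: "dpath A P w p" "(p, x) \<in> A\<^sup>*" "(w', p) \<in> A\<^sup>*" "\<forall>z\<in>set (butlast P). (w', z) \<notin> A\<^sup>*"
    using dpath_first_hit[OF W(2), of "\<lambda>z. (w', z) \<in> A\<^sup>*"] W' by blast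
  obtain q Q where Q: "dpath A Q w q" "(q, y) \<in> A\<^sup>*" "(w', q) \<in> A\<^sup>*" "\<forall>z\<in>set (butlast Q). (w', z) \<notin> A\<^sup>*"
    using dpath_first_hit[OF W(3), of "\<lambda>z. (w', z) \<in> A\<^sup>*"] W' by blast
  obtain P' where P': "dpath A P' w' p" using dpath_exists[OF P(3)] by blast
  obtain Q' where Q': "dpath A Q' w' q" using dpath_exists[OF Q(3)] by blast
  have wp: "(w, p) \<in> A\<^sup>*" "(w, q) \<in> A\<^sup>*" using P Q dpath_mem by (metis dpath_def last_in_set)+
  have pn: "p \<noteq> w" "p \<noteq> w'" "q \<noteq> w" "q \<noteq> w'" using inc wp P(3) Q(3) by blast+
  have mP: "(w, z) \<in> A\<^sup>*" "(z, p) \<in> A\<^sup>*" "(z, x) \<in> A\<^sup>*" "(w', z) \<in> A\<^sup>* \<Longrightarrow> z = p" if "z \<in> set P" for z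
    using dpath_mem[OF P(1) that] P that dpath_set_butlast[OF P(1)] by (auto intro: rtrancl_trans)
  have mQ: "(w, z) \<in> A\<^sup>*" "(z, q) \<in> A\<^sup>*" "(z, y) \<in> A\<^sup>*" "(w', z) \<in> A\<^sup>* \<Longrightarrow> z = q" if "z \<in> set Q" for z
    using dpath_mem[OF Q(1) that] Q that dpath_set_butlast[OF Q(1)] by (auto intro: rtrancl_trans)
  have mP': "(w', z) \<in> A\<^sup>*" "(z, p) \<in> A\<^sup>*" "(z, x) \<in> A\<^sup>*" if "z \<in> set P'" for z
    using dpath_mem[OF P' that] P by (auto intro: rtrancl_trans)
  have mQ': "(w', z) \<in> A\<^sup>*" "(z, q) \<in> A\<^sup>*" "(z, y) \<in> A\<^sup>*" if "z \<in> set Q'" for z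
    using dpath_mem[OF Q' that] Q by (auto intro: rtrancl_trans)
  \<comment> \<open>Otherwise \<open>p\<close> or \<open>q\<close> would be a common ancestor
    strictly below \<open>w\<close>.\<close>
  have pq: "(p, y) \<notin> A\<^sup>*" "(q, x) \<notin> A\<^sup>*" using W(4) P(2) Q(2) wp pn by blast+
  \<comment> \<open>\<open>P\<close> runs down to \<open>p\<close> and the reversed
    \<open>P'\<close> climbs back to \<open>w'\<close>; \<open>tl\<close> drops the point
    \<open>p\<close> at which \<open>P\<close> has already ended. The second path does the same over
    \<open>q\<close>.\<close>
  let ?U1 = "P @ tl (rev P')" and ?U2 = "Q @ tl (rev Q')"
  have bP: "P' = butlast P' @ [p]" "Q' = butlast Q' @ [q]" using P' Q' by (auto simp: dpath_def)
  have ts: "tl (rev P') = rev (butlast P')" "tl (rev Q') = rev (butlast Q')"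
    by (subst bP, simp)+
  have sP': "set P' = insert p (set (butlast P'))" "set Q' = insert q (set (butlast Q'))"
    using dpath_set_butlast P' Q' by metis+
  have dst: "distinct P" "distinct Q" "distinct P'" "distinct Q'"
    using dpath_distinct[OF acyclic] P Q P' Q' by blast+
  have nb: "p \<notin> set (butlast P')" "q \<notin> set (butlast Q')"
    using dst(3,4) bP by (metis distinct_append distinct.simps(2) disjoint_iff list.set_intros(1))+
  have ne': "butlast P' \<noteq> []" "butlast Q' \<noteq> []"
    using P' Q' pn bP unfolding dpath_def by (metis append_Nil list.sel(1))+
  have hd': "hd (butlast P') = w'" "hd (butlast Q') = w'"
    using P' Q' ne' bP unfolding dpath_def by (metis hd_append2)+
  have PP': "set P \<inter> set P' = {p}"
  proof -
    have "p \<in> set P" using P(1) by (metis dpath_def last_in_set)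
    then show ?thesis using mP(4) mP'(1) sP' by blast
  qed
  have QQ': "set Q \<inter> set Q' = {q}"
  proof -
    have "q \<in> set Q" using Q(1) by (metis dpath_def last_in_set)
    then show ?thesis using mQ(4) mQ'(1) sP' by blast
  qed
  have PQ: "set P \<inter> set Q = {w}"
  proof -
    have "w \<in> set P" "w \<in> set Q" using P(1) Q(1) by (metis dpath_def hd_in_set)+
    then show ?thesis using mP mQ W(4) by blast
  qed
  have PQ': "set P \<inter> set Q' = {}"
    using mP(4) mQ' pq(1) by (metis disjoint_iff)
  have P'Q: "set P' \<inter> set Q = {}"
    using mQ(4) mP' pq(2) by (metis disjoint_iff)
  have P'Q': "set P' \<inter> set Q' = {w'}"
  proof -
    have "w' \<in> set P'" "w' \<in> set Q'" using P' Q' by (metis dpath_def hd_in_set)+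
    then show ?thesis using mP' mQ' W'(4) by blast
  qed
  have sets: "set ?U1 = set P \<union> set P'" "set ?U2 = set Q \<union> set Q'"
    using ts sP' PP' QQ' by auto
  have suc: "successively (\<lambda>x y. (x, y) \<in> undirected A) (P1 @ tl (rev P2))"
    if "dpath A P1 a b" "dpath A P2 c b" for P1 P2 a b c
  proof -
    have P2: "P2 = butlast P2 @ [b]" using that(2) by (auto simp: dpath_def)
    have r: "rev P2 = b # rev (butlast P2)" by (subst P2) simp
    have "successively (\<lambda>x y. (y, x) \<in> A) (rev P2)" using that(2) by (simp add: dpath_def)
    then have "successively (\<lambda>x y. (x, y) \<in> undirected A) (rev P2)"
      by (rule successively_mono) (auto simp: undirected_def)
    then show ?thesis using dpath_undirected[OF that(1)] that(1) r
      by (cases "rev (butlast P2)") (auto simp: successively_append_iff dpath_def)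
  qed
  have "biconnected_set VN A (set ?U1 \<union> set ?U2)"
  proof (rule biconnected_theta[where a = w and b = w'])
    show "set ?U1 \<union> set ?U2 \<subseteq> VN" unfolding sets
      using mP(1) mQ(1) mP'(1) mQ'(1) reach_VN W(1) W'(1) by blast
    show "successively (\<lambda>x y. (x, y) \<in> undirected A) ?U1" using suc P P' by blast
    show "successively (\<lambda>x y. (x, y) \<in> undirected A) ?U2" using suc Q Q' by blast
    show "?U1 \<noteq> []" "?U2 \<noteq> []" "hd ?U1 = w" "hd ?U2 = w" using P Q by (auto simp: dpath_def)
    show "last ?U1 = w'" "last ?U2 = w'" using ts ne' hd' by (auto simp: last_rev)
    show "w \<noteq> w'" by fact
    show "distinct ?U1" using ts dst PP' nb(1) sP'(1) by (auto simp: distinct_butlast)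
    show "distinct ?U2" using ts dst QQ' nb(2) sP'(2) by (auto simp: distinct_butlast)
    show "set ?U1 \<inter> set ?U2 = {w, w'}" unfolding sets
      using PQ PQ' P'Q P'Q' by blast
  qed
  moreover have "p \<in> set ?U1 \<union> set ?U2" "q \<in> set ?U1 \<union> set ?U2" using PP' QQ' by auto
  \<comment> \<open>Stated once for \<open>p\<close> and for \<open>q\<close>. The two predecessors
    of \<open>r\<close> differ because the one on \<open>D'\<close> lies below \<open>w'\<close> and
    the one on \<open>D\<close> does not.\<close>
  moreover have "hybrid_vertex VN A X r"
    if D: "dpath A D w r" "dpath A D' w' r" "r \<noteq> w" "r \<noteq> w'" "\<forall>z\<in>set (butlast D). (w', z) \<notin> A\<^sup>*" for D D' r
  proof -
    obtain g1 where g1: "g1 \<in> set (butlast D)" "(g1, r) \<in> A" using dpath_last_step[OF D(1)] D(3) by blast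
    obtain g2 where g2: "g2 \<in> set (butlast D')" "(g2, r) \<in> A" using dpath_last_step[OF D(2)] D(4) by blast
    have "g1 \<noteq> g2" using g1 g2 D(5) dpath_mem[OF D(2), of g2] in_set_butlastD by metis
    then show ?thesis using hybrid_if_two_parents g1 g2 by blast
  qed
  then have "hybrid_vertex VN A X p" "hybrid_vertex VN A X q"
    using P Q P' Q' pn by blast+
  ultimately have "p = q" using one_hybrid by blast
  then show False using pq P Q by blast
qed

lemma lca_eqI:
  assumes "is_lca VN A x y w"
  shows "lca VN A x y = w"
  unfolding lca_def by (rule the_equality, rule assms, rule is_lca_unique[OF _ assms])

section \<open>Cycles below a vertex with overlapping children\<close>

lemma meet:
  assumes u: "u \<in> VN" "(u, c1) \<in> A" "(u, c2) \<in> A" "c1 \<noteq> c2" and z: "(c1, z) \<in> A\<^sup>*" "(c2, z) \<in> A\<^sup>*"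
  obtains h B where "hybrid_vertex VN A X h" "biconnected_set VN A B" "u \<in> B" "c1 \<in> B" "c2 \<in> B" "h \<in> B"
    "(c1, h) \<in> A\<^sup>*" "(c2, h) \<in> A\<^sup>*" "(h, z) \<in> A\<^sup>*"
proof -
  \<comment> \<open>The path from \<open>c1\<close> towards \<open>z\<close> stops at the first
    vertex that \<open>c2\<close> reaches too. Together with a path from \<open>c2\<close> to that
    vertex it closes a cycle through \<open>u\<close> whose sides meet only in \<open>u\<close> and
    \<open>h\<close>.\<close>
  obtain h P where P: "dpath A P c1 h" "(h, z) \<in> A\<^sup>*" "(c2, h) \<in> A\<^sup>*" "\<forall>z\<in>set (butlast P). (c2, z) \<notin> A\<^sup>*"
    using dpath_first_hit[OF z(1), of "\<lambda>z. (c2, z) \<in> A\<^sup>*"] z(2) by blast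
  obtain Q where Q: "dpath A Q c2 h" using dpath_exists[OF P(3)] by blast
  have uP: "dpath A (u # P) u h" and uQ: "dpath A (u # Q) u h" using dpath_Cons u P(1) Q by metis+
  have hP: "h \<in> set P" "h \<in> set Q" "c1 \<in> set P" "c2 \<in> set Q"
    using P Q by (metis dpath_def hd_in_set last_in_set)+
  have c1h: "(c1, h) \<in> A\<^sup>*" using dpath_mem[OF P(1)] hP by blast
  have uh: "u \<noteq> h" using c1h no_cycle u by blast
  have I: "set P \<inter> set Q = {h}"
    using dpath_mem[OF Q] P(4) dpath_set_butlast[OF P(1)] hP by auto
  have un: "u \<notin> set P" "u \<notin> set Q" using dpath_mem[OF P(1)] dpath_mem[OF Q] no_cycle u by blast+
  let ?B = "set (u # P) \<union> set (u # Q)"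
  have "biconnected_set VN A ?B"
  proof (rule biconnected_theta[where a = u and b = h])
    show "?B \<subseteq> VN" using dpath_subset[OF uP arcs] dpath_subset[OF uQ arcs] u by blast
    show "set (u # P) \<inter> set (u # Q) = {u, h}" using I un by auto
  qed (use uP uQ uh dpath_undirected[OF uP] dpath_undirected[OF uQ] dpath_distinct[OF acyclic uP]
      dpath_distinct[OF acyclic uQ] in \<open>auto simp: dpath_def\<close>)
  moreover have "hybrid_vertex VN A X h"
  proof -
    \<comment> \<open>If \<open>c1 = h\<close>, the parent on this side is \<open>u\<close> itself;
      since the children differ, this cannot happen on both sides.\<close>
    obtain g1 where g1: "(g1, h) \<in> A" "g1 = u \<and> c1 = h \<or> g1 \<in> set (butlast P)"
      using dpath_last_step[OF P(1)] u(2) by blast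
    obtain g2 where g2: "(g2, h) \<in> A" "g2 = u \<and> c2 = h \<or> g2 \<in> set (butlast Q)"
      using dpath_last_step[OF Q] u(3) by blast
    have "g1 \<noteq> g2"
      using g1(2) g2(2) un u(4) P(4) dpath_mem[OF Q, of g2] in_set_butlastD by metis
    then show ?thesis using hybrid_if_two_parents g1 g2 by blast
  qed
  ultimately show ?thesis using that[of h ?B] hP P c1h by auto
qed

lemma last_arc:
  assumes "(u, c) \<in> A" "(c, h) \<in> A\<^sup>*"
  obtains g where "(g, h) \<in> A" "g = u \<and> c = h \<or> (c, g) \<in> A\<^sup>*"
proof -
  show thesis using assms(2) by (cases rule: rtranclE) (use assms that in auto)
qed

text \<open>If paths from \<open>u\<close> through two different children ended in the same arc, its
  source \<open>g\<close> would be a common descendant of these children. Then \<open>g\<close> lies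
  below a hybrid whose cycle shares \<open>u\<close> and \<open>c1\<close> with \<open>B\<close>.
  That hybrid is \<open>h\<close>, and the arc from \<open>g\<close> to \<open>h\<close> closes a
  directed cycle.\<close>

lemma last_arcs_distinct:
  assumes uc: "(u, c1) \<in> A" "(u, c2) \<in> A" "c1 \<noteq> c2"
    and B: "biconnected_set VN A B" "u \<in> B" "c1 \<in> B" "h \<in> B" "hybrid_vertex VN A X h"
    and g1: "(g, h) \<in> A" "g = u \<and> c1 = h \<or> (c1, g) \<in> A\<^sup>*"
    and g2: "g = u \<and> c2 = h \<or> (c2, g) \<in> A\<^sup>*"
  shows False
proof -
  have "(c1, u) \<notin> A\<^sup>*" "(c2, u) \<notin> A\<^sup>*" using uc no_cycle by auto
  then have g: "(c1, g) \<in> A\<^sup>*" "(c2, g) \<in> A\<^sup>*" using g1 g2 uc by auto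
  have u: "u \<in> VN" using uc arcs by auto
  obtain h' B' where h': "hybrid_vertex VN A X h'" "biconnected_set VN A B'" "u \<in> B'" "c1 \<in> B'" "h' \<in> B'" "(h', g) \<in> A\<^sup>*"
    using meet[OF u uc g] by metis
  have "u \<noteq> c1" using uc no_loop by auto
  then have "biconnected_set VN A (B \<union> B')"
    using biconnected_Un[OF B(1) h'(2), of u c1] B h' by auto
  then have "h' = h" using one_hybrid B h' by blast
  then show False using h' g1(1) no_cycle by auto
qed

text \<open>\<open>meet\<close> yields some hybrid above \<open>z\<close>. Its biconnected set
  shares \<open>u\<close> and \<open>c1\<close> with \<open>B\<close>, so the union has room for
  \<open>h\<close> only.\<close>

lemma hybrid_above_common:
  assumes uc: "(u, c1) \<in> A" "(u, c2) \<in> A" "c1 \<noteq> c2"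
    and B: "biconnected_set VN A B" "u \<in> B" "c1 \<in> B" "h \<in> B" "hybrid_vertex VN A X h"
    and z: "(c1, z) \<in> A\<^sup>*" "(c2, z) \<in> A\<^sup>*"
  shows "(h, z) \<in> A\<^sup>*"
proof -
  have u: "u \<in> VN" using uc arcs by auto
  obtain h' B' where h': "hybrid_vertex VN A X h'" "biconnected_set VN A B'" "u \<in> B'" "c1 \<in> B'" "h' \<in> B'" "(h', z) \<in> A\<^sup>*"
    using meet[OF u uc z] by metis
  have "u \<noteq> c1" using uc no_loop by auto
  then have "biconnected_set VN A (B \<union> B')"
    using biconnected_Un[OF B(1) h'(2), of u c1] B h' by auto
  then have "h' = h" using one_hybrid B h' by blast
  then show ?thesis using h' by simp
qed

text \<open>The cycles for \<open>c1\<close>, \<open>c2\<close> and for \<open>c1\<close>,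
  \<open>c3\<close> share \<open>u\<close> and \<open>c1\<close> and hence have the same hybrid.
  Paths to it through the three children end in three different arcs, one parent too many. No
  overlap between \<open>c2\<close> and \<open>c3\<close> is assumed.\<close>

lemma no_three_overlapping_children:
  assumes uc: "(u, c1) \<in> A" "(u, c2) \<in> A" "(u, c3) \<in> A" "c1 \<noteq> c2" "c1 \<noteq> c3" "c2 \<noteq> c3"
    and z: "(c1, z) \<in> A\<^sup>*" "(c2, z) \<in> A\<^sup>*" and y: "(c1, y) \<in> A\<^sup>*" "(c3, y) \<in> A\<^sup>*"
  shows False
proof -
  have u: "u \<in> VN" using uc arcs by auto
  obtain h B where h: "hybrid_vertex VN A X h" "biconnected_set VN A B" "u \<in> B" "c1 \<in> B" "c2 \<in> B" "h \<in> B"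
    "(c1, h) \<in> A\<^sup>*" "(c2, h) \<in> A\<^sup>*"
    using meet[OF u uc(1,2,4) z] by metis
  obtain h' B' where h': "hybrid_vertex VN A X h'" "biconnected_set VN A B'" "u \<in> B'" "c1 \<in> B'" "c3 \<in> B'" "h' \<in> B'"
    "(c1, h') \<in> A\<^sup>*" "(c3, h') \<in> A\<^sup>*"
    using meet[OF u uc(1,3,5) y] by metis
  have "u \<noteq> c1" using uc no_loop by auto
  then have BB: "biconnected_set VN A (B \<union> B')"
    using biconnected_Un[OF h(2) h'(2), of u c1] h h' by auto
  then have hh: "h' = h" using one_hybrid h h' by blast
  obtain g1 where g1: "(g1, h) \<in> A" "g1 = u \<and> c1 = h \<or> (c1, g1) \<in> A\<^sup>*"
    using last_arc[OF uc(1) h(7)] by blast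
  obtain g2 where g2: "(g2, h) \<in> A" "g2 = u \<and> c2 = h \<or> (c2, g2) \<in> A\<^sup>*"
    using last_arc[OF uc(2) h(8)] by blast
  obtain g3 where g3: "(g3, h) \<in> A" "g3 = u \<and> c3 = h \<or> (c3, g3) \<in> A\<^sup>*"
    using last_arc[OF uc(3) h'(8)] hh by blast
  have m: "u \<in> B \<union> B'" "c1 \<in> B \<union> B'" "c2 \<in> B \<union> B'" "h \<in> B \<union> B'" using h h' by auto
  have "g1 \<noteq> g2" using last_arcs_distinct[OF uc(1,2,4) BB m(1,2,4) h(1) g1] g2 by blast
  moreover have "g1 \<noteq> g3" using last_arcs_distinct[OF uc(1,3,5) BB m(1,2,4) h(1) g1] g3 by blast
  moreover have "g2 \<noteq> g3" using last_arcs_distinct[OF uc(2,3,6) BB m(1,3,4) h(1) g2] g3 by blast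
  ultimately show False using no_three_parents g1 g2 g3 by blast
qed

text \<open>An overlap of \<open>a0\<close> and \<open>a\<close> gives a cycle through
  \<open>w\<close> and \<open>a0\<close>, which are consecutive on the large cycle through
  \<open>u\<close> and \<open>h\<close>. Its hybrid is therefore \<open>h\<close> again, and
  \<open>h\<close> gets a third parent: two arcs arrive through \<open>a0\<close> and
  \<open>a\<close>, one through \<open>c2\<close>.\<close>

lemma spine_children_disjoint:
  assumes uc: "(u, c1) \<in> A" "(u, c2) \<in> A" "c1 \<noteq> c2"
    and B: "biconnected_set VN A B" "u \<in> B" "c1 \<in> B" "h \<in> B" "hybrid_vertex VN A X h"
    and ch: "(c2, h) \<in> A\<^sup>*"
    and w: "(c1, w) \<in> A\<^sup>*" "(w, a0) \<in> A" "(a0, h) \<in> A\<^sup>*"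
    and a: "(w, a) \<in> A" "a \<noteq> a0" and z: "(a, z) \<in> A\<^sup>*" "(a0, z) \<in> A\<^sup>*"
  shows False
proof -
  obtain P1 where P1: "dpath A P1 c1 w" using dpath_exists[OF w(1)] by blast
  obtain P2 where P2: "dpath A P2 a0 h" using dpath_exists[OF w(3)] by blast
  obtain Q where Q: "dpath A Q c2 h" using dpath_exists[OF ch] by blast
  have P: "dpath A (P1 @ P2) c1 h" using dpath_append[OF P1 w(2) P2] .
  have uP: "dpath A (u # P1 @ P2) u h" and uQ: "dpath A (u # Q) u h"
    using dpath_Cons[OF uc(1) P] dpath_Cons[OF uc(2) Q] by auto
  have wP: "w \<in> set P1" "a0 \<in> set P2" "h \<in> set P2" "h \<in> set Q"
    using P1 P2 Q by (metis dpath_def hd_in_set last_in_set)+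
  have u: "u \<in> VN" "w \<in> VN" using uc w arcs by auto
  have uh: "u \<noteq> h" using uc(2) ch no_cycle by auto
  have un: "u \<notin> set (P1 @ P2)" "u \<notin> set Q"
    using dpath_mem[OF P] dpath_mem[OF Q] no_cycle uc by blast+
  \<comment> \<open>A vertex on both sides lies below \<open>c1\<close> and \<open>c2\<close>, hence
    below \<open>h\<close>; being on a path to \<open>h\<close>, it also lies above
    \<open>h\<close>.\<close>
  have I: "set (P1 @ P2) \<inter> set Q = {h}"
  proof -
    have "x = h" if "x \<in> set (P1 @ P2)" "x \<in> set Q" for x
      using hybrid_above_common[OF uc B] dpath_mem[OF P that(1)] dpath_mem[OF Q that(2)] antisym_reach by blast
    then show ?thesis using wP by auto
  qed
  let ?B = "set (u # P1 @ P2) \<union> set (u # Q)"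
  have bi: "biconnected_set VN A ?B"
  proof (rule biconnected_theta[where a = u and b = h])
    show "?B \<subseteq> VN" using dpath_subset[OF uP arcs] dpath_subset[OF uQ arcs] u by blast
    show "set (u # P1 @ P2) \<inter> set (u # Q) = {u, h}" using I un by auto
    show "last (u # P1 @ P2) = h" "last (u # Q) = h" using uP uQ by (simp_all add: dpath_def)
  qed (use uh dpath_undirected[OF uP] dpath_undirected[OF uQ] dpath_distinct[OF acyclic uP]
      dpath_distinct[OF acyclic uQ] in simp_all)
  obtain h' B' where h': "hybrid_vertex VN A X h'" "biconnected_set VN A B'" "w \<in> B'" "a0 \<in> B'" "a \<in> B'" "h' \<in> B'"
    "(a0, h') \<in> A\<^sup>*" "(a, h') \<in> A\<^sup>*"
    using meet[OF u(2) w(2) a(1) _ z(2) z(1)] a(2) by metis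
  have "w \<noteq> a0" using w no_loop by auto
  then have BB: "biconnected_set VN A (?B \<union> B')"
    using biconnected_Un[OF bi h'(2), of w a0] wP h' by auto
  have hm: "h \<in> ?B \<union> B'" "w \<in> ?B \<union> B'" "a0 \<in> ?B \<union> B'" using wP by auto
  then have hh: "h' = h" using one_hybrid[OF BB _ _ h'(1) B(5)] h' by blast
  obtain g1 where g1: "(g1, h) \<in> A" "g1 = w \<and> a0 = h \<or> (a0, g1) \<in> A\<^sup>*"
    using last_arc[OF w(2,3)] by blast
  obtain g2 where g2: "(g2, h) \<in> A" "g2 = w \<and> a = h \<or> (a, g2) \<in> A\<^sup>*"
    using last_arc[OF a(1) h'(8)] hh by blast
  obtain g3 where g3: "(g3, h) \<in> A" "g3 = u \<and> c2 = h \<or> (c2, g3) \<in> A\<^sup>*"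
    using last_arc[OF uc(2) ch] by blast
  have "a0 \<noteq> a" using a by auto
  then have "g1 \<noteq> g2" using last_arcs_distinct[OF w(2) a(1) _ BB hm(2,3,1) B(5) g1] g2 by blast
  moreover have "(c1, g1) \<in> A\<^sup>*" "(c1, g2) \<in> A\<^sup>*"
    using g1 g2 w a by (meson rtrancl_trans r_into_rtrancl)+
  \<comment> \<open>A parent of \<open>h\<close> reached from both \<open>c1\<close> and
    \<open>c2\<close> would lie below \<open>h\<close>.\<close>
  moreover have "g3 \<noteq> g" if "(c1, g) \<in> A\<^sup>*" for g
  proof
    assume e: "g3 = g"
    have "(c1, u) \<notin> A\<^sup>*" using uc no_cycle by auto
    then have "(c2, g) \<in> A\<^sup>*" using g3 e that by auto
    then have "(h, g) \<in> A\<^sup>*" using hybrid_above_common[OF uc B] that by auto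
    then show False using g3(1) e no_cycle by auto
  qed
  ultimately show False using no_three_parents[of g1 h g2 g3] g1 g2 g3 by metis
qed

end

section \<open>Chains of uniformly joined blocks\<close>

text \<open>The flag makes join and disjoint union two instances of one notion. In a network it is
  the truth value of a label being 1.\<close>

definition uniform :: "('a \<times> 'a) set \<Rightarrow> 'a set \<Rightarrow> 'a set \<Rightarrow> bool \<Rightarrow> bool" where
  "uniform E P Q b \<longleftrightarrow> (\<forall>x\<in>P. \<forall>y\<in>Q. ((x, y) \<in> E) = b)"

definition split_free :: "'a set \<Rightarrow> ('a \<times> 'a) set \<Rightarrow> bool" where
  "split_free V E \<longleftrightarrow> (\<forall>P Q b. P \<union> Q = V \<and> P \<inter> Q = {} \<and> uniform E P Q b \<longrightarrow> P = {} \<or> Q = {})"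

fun blocks :: "('a set \<times> bool) list \<Rightarrow> 'a set" where
  "blocks [] = {}"
| "blocks ((D, b) # xs) = D \<union> blocks xs"

text \<open>\<open>D\<close> stands for what branches off at a vertex of a path to the hybrid,
  \<open>b\<close> for the label of this vertex, \<open>M\<close> for what lies below the hybrid.
  Blocks may be empty, since nothing of the chosen leaf set need branch off at a given
  vertex.\<close>

fun block_chain :: "('a \<times> 'a) set \<Rightarrow> 'a set \<Rightarrow> ('a set \<times> bool) list \<Rightarrow> bool" where
  "block_chain E M [] = True"
| "block_chain E M ((D, b) # xs) \<longleftrightarrow>
     D \<inter> (M \<union> blocks xs) = {} \<and> uniform E D (M \<union> blocks xs) b \<and> block_chain E M xs"

lemma block_chain_disjoint: "block_chain E M xs \<Longrightarrow> blocks xs \<inter> M = {}"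
  by (induction E M xs rule: block_chain.induct) auto

text \<open>Singleton blocks with core \<open>v\<close>. Such a list is a labeled caterpillar with
  \<open>v\<close> in its cherry: the other leaves from the root downwards, each with the label of
  its parent.\<close>

fun chain :: "('a \<times> 'a) set \<Rightarrow> 'a \<Rightarrow> ('a \<times> bool) list \<Rightarrow> bool" where
  "chain E v [] = True"
| "chain E v ((x, b) # xs) \<longleftrightarrow>
     x \<notin> insert v (fst ` set xs) \<and> uniform E {x} (insert v (fst ` set xs)) b \<and> chain E v xs"

context level1_network
begin

text \<open>Induction up the path. The new block at \<open>w\<close> is what lies below
  \<open>w\<close> but not below the next path vertex \<open>a0\<close>. No other child of
  \<open>w\<close> shares a descendant with \<open>a0\<close>, so \<open>w\<close> is the lca of
  every pair between the block and the rest, and its label is the flag.\<close>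

lemma spine_block_chain:
  fixes f :: "'a \<Rightarrow> 'v" and S :: "'a set"
  defines "Cl \<equiv> \<lambda>w. {s \<in> S. (w, f s) \<in> A\<^sup>*}"
  assumes E: "\<And>x y. x \<in> S \<Longrightarrow> y \<in> S \<Longrightarrow> x \<noteq> y \<Longrightarrow> (x, y) \<in> E \<longleftrightarrow> t (lca VN A (f x) (f y)) = L1"
    and uc: "(u, c1) \<in> A" "(u, c2) \<in> A" "c1 \<noteq> c2"
    and B: "biconnected_set VN A B" "u \<in> B" "c1 \<in> B" "h \<in> B" "hybrid_vertex VN A X h"
    and ch: "(c2, h) \<in> A\<^sup>*"
    and w: "(w, h) \<in> A\<^sup>*" "(c1, w) \<in> A\<^sup>*"
  shows "\<exists>xs. block_chain E (Cl h) xs \<and> Cl w = Cl h \<union> blocks xs"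
  using w
proof (induction rule: converse_rtrancl_induct)
  case base
  then show ?case by (intro exI[of _ "[]"]) simp
next
  case (step w a0)
  have "(c1, a0) \<in> A\<^sup>*" using step by (blast intro: rtrancl_into_rtrancl)
  then obtain xs where xs: "block_chain E (Cl h) xs" "Cl a0 = Cl h \<union> blocks xs" using step.IH by blast
  have wV: "w \<in> VN" using step(1) arcs by auto
  have sub: "Cl a0 \<subseteq> Cl w" using step(1) by (auto simp: Cl_def intro: converse_rtrancl_into_rtrancl)
  have "((x, y) \<in> E) = (t w = L1)" if x: "x \<in> Cl w - Cl a0" and y: "y \<in> Cl a0" for x y
  proof -
    have "is_lca VN A (f x) (f y) w"
    proof (rule is_lcaI[OF wV])
      show "(w, f x) \<in> A\<^sup>*" "(w, f y) \<in> A\<^sup>*" using x y sub by (auto simp: Cl_def)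
      fix c assume c: "(w, c) \<in> A" "(c, f x) \<in> A\<^sup>*" "(c, f y) \<in> A\<^sup>*"
      have "c \<noteq> a0" using c x by (auto simp: Cl_def)
      moreover have "(a0, f y) \<in> A\<^sup>*" using y by (auto simp: Cl_def)
      ultimately show False
        using spine_children_disjoint[OF uc B ch step.prems step(1,2) c(1) _ c(3)] by blast
    qed
    moreover have "x \<in> S" "y \<in> S" "x \<noteq> y" using x y by (auto simp: Cl_def)
    ultimately show ?thesis using E lca_eqI by simp
  qed
  then have "uniform E (Cl w - Cl a0) (Cl a0) (t w = L1)" by (simp add: uniform_def)
  then show ?case using xs sub by (intro exI[of _ "(Cl w - Cl a0, t w = L1) # xs"]) auto
qed

text \<open>\<open>S\<close> is merely embedded into the leaves. The result therefore applies to
  representatives of modules without pruning the network down to them.\<close>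

theorem split_free_cycle_structure:
  fixes f :: "'a \<Rightarrow> 'v" and S :: "'a set"
  assumes fX: "f ` S \<subseteq> X" and inj: "inj_on f S" and card: "card S \<ge> 2"
    and E: "\<And>x y. x \<in> S \<Longrightarrow> y \<in> S \<Longrightarrow> x \<noteq> y \<Longrightarrow> (x, y) \<in> E \<longleftrightarrow> t (lca VN A (f x) (f y)) = L1"
    and free: "split_free S E"
  shows "\<exists>M xs ys b. block_chain E M xs \<and> block_chain E M ys \<and> S = M \<union> blocks xs \<union> blocks ys \<and>
    blocks xs \<inter> blocks ys = {} \<and> uniform E (blocks xs) (blocks ys) b \<and> blocks xs \<noteq> {} \<and> blocks ys \<noteq> {}"
proof -
  define Cl where "Cl = (\<lambda>w. {s \<in> S. (w, f s) \<in> A\<^sup>*})"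
  obtain \<rho> where \<rho>: "\<rho> \<in> VN" "\<forall>v\<in>VN. (\<rho>, v) \<in> A\<^sup>*" using root_reaches by blast
  have \<rho>S: "Cl \<rho> = S" using \<rho> fX leaves_subset by (auto simp: Cl_def)
  \<comment> \<open>Minimal for the converse of \<open>A\<close> means lowest: no child of
    \<open>u\<close> still reaches all of \<open>S\<close>.\<close>
  have "wf (A\<inverse>)" using finite_A acyclic by (rule finite_acyclic_wf_converse)
  moreover have "\<rho> \<in> {u \<in> VN. Cl u = S}" using \<rho> \<rho>S by simp
  ultimately obtain u where u': "u \<in> {u \<in> VN. Cl u = S}" "\<And>c. (c, u) \<in> A\<inverse> \<Longrightarrow> c \<notin> {u \<in> VN. Cl u = S}"
    by (rule wfE_min) blast
  have u: "Cl u = S" "u \<in> VN" using u' by auto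
  have u3: "Cl c \<noteq> S" if "(u, c) \<in> A" for c using u'(2)[of c] that arcs by auto
  have "finite S" using card by (intro card_ge_0_finite) simp
  then obtain s0 s1 where s01: "s0 \<in> S" "s1 \<in> S" "s0 \<noteq> s1"
    using card card_le_Suc0_iff_eq[of S] by fastforce
  have fs0: "f s0 \<noteq> u"
  proof
    assume e: "f s0 = u"
    have "(u, f s1) \<in> A\<^sup>*" using u(1) s01 by (auto simp: Cl_def)
    moreover have "u \<in> X" using e fX s01 by auto
    ultimately have "f s1 = f s0" using leaf_reach e by auto
    then show False using inj s01 by (auto dest: inj_onD)
  qed
  have "(u, f s0) \<in> A\<^sup>*" using u(1) s01 by (auto simp: Cl_def)
  then obtain c1 where c1: "(u, c1) \<in> A" "(c1, f s0) \<in> A\<^sup>*"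
    by (cases rule: converse_rtranclE) (use fs0 in auto)
  \<comment> \<open>\<open>T\<close> collects the children of \<open>u\<close> that overlap
    \<open>c1\<close>, including \<open>c1\<close>. The elements of \<open>S\<close> below them are
    uniform to the remaining ones, so \<open>split_free\<close> leaves no remaining ones.\<close>
  define T where "T = {c. (u, c) \<in> A \<and> (\<exists>z. (c, z) \<in> A\<^sup>* \<and> (c1, z) \<in> A\<^sup>*)}"
  define P where "P = (\<Union>c\<in>T. Cl c)"
  have c1T: "c1 \<in> T" using c1 by (auto simp: T_def)
  have edge_u: "((x, y) \<in> E) = (t u = L1)"
    if "x \<in> S" "y \<in> S" "x \<noteq> y" "\<And>c. (u, c) \<in> A \<Longrightarrow> x \<in> Cl c \<Longrightarrow> y \<in> Cl c \<Longrightarrow> False" for x y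
  proof -
    have "(u, f x) \<in> A\<^sup>*" "(u, f y) \<in> A\<^sup>*" using that u(1) by (auto simp: Cl_def)
    then have "is_lca VN A (f x) (f y) u"
      using that(1,2,4) by (intro is_lcaI[OF u(2)]) (auto simp: Cl_def)
    then show ?thesis using lca_eqI E that by simp
  qed
  \<comment> \<open>A child \<open>c\<close> above both \<open>x\<close> and \<open>y\<close> is
    outside \<open>T\<close>, yet overlaps a member \<open>c'\<close> of \<open>T\<close> in
    \<open>x\<close>. Then \<open>c'\<close> overlaps both \<open>c1\<close> and \<open>c\<close>,
    which is one overlapping child too many. Hence \<open>u\<close> is the lca.\<close>
  have "uniform E P (S - P) (t u = L1)" unfolding uniform_def
  proof (intro ballI)
    fix x y assume x: "x \<in> P" and y: "y \<in> S - P"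
    obtain c' where c': "c' \<in> T" "x \<in> Cl c'" using x by (auto simp: P_def)
    then obtain z where z: "(c', z) \<in> A\<^sup>*" "(c1, z) \<in> A\<^sup>*" "(u, c') \<in> A" by (auto simp: T_def)
    show "((x, y) \<in> E) = (t u = L1)"
    proof (rule edge_u)
      show "x \<in> S" "y \<in> S" "x \<noteq> y" using x y c' by (auto simp: Cl_def)
      fix c assume c: "(u, c) \<in> A" "x \<in> Cl c" "y \<in> Cl c"
      have cT: "c \<notin> T" using c y by (auto simp: P_def)
      have s: "(c, f x) \<in> A\<^sup>*" "(c', f x) \<in> A\<^sup>*" using c c' by (auto simp: Cl_def)
      have ne: "c \<noteq> c'" "c \<noteq> c1" using cT c' c1T by auto
      have "c' \<noteq> c1" using cT s c(1) by (auto simp: T_def)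
      then show False using no_three_overlapping_children[OF z(3) c1(1) c(1) _ _ _ z(1,2) s(2,1)] ne by blast
    qed
  qed
  moreover have "P \<subseteq> S" by (auto simp: P_def Cl_def)
  moreover have "s0 \<in> P" using c1 c1T s01 by (auto simp: P_def Cl_def)
  ultimately have "S - P = {}" using free unfolding split_free_def
    by (metis Diff_disjoint Diff_partition empty_iff)
  then have SP: "S = P" using \<open>P \<subseteq> S\<close> by auto
  \<comment> \<open>By the choice of \<open>u\<close> the child \<open>c1\<close> misses some
    \<open>r\<close>; a child in \<open>T\<close> above \<open>r\<close> opens the second side of
    the cycle.\<close>
  obtain r where r: "r \<in> S" "r \<notin> Cl c1" using u3[OF c1(1)] by (auto simp: Cl_def)
  then obtain c2 where c2: "c2 \<in> T" "r \<in> Cl c2" using SP by (auto simp: P_def)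
  then obtain z where z: "(c2, z) \<in> A\<^sup>*" "(c1, z) \<in> A\<^sup>*" "(u, c2) \<in> A" by (auto simp: T_def)
  have c12: "c1 \<noteq> c2" using c2 r by auto
  have "c = c1 \<or> c = c2" if cT: "c \<in> T" for c
  proof (rule ccontr)
    assume n: "\<not> (c = c1 \<or> c = c2)"
    obtain z' where z': "(c, z') \<in> A\<^sup>*" "(c1, z') \<in> A\<^sup>*" "(u, c) \<in> A" using cT by (auto simp: T_def)
    show False using no_three_overlapping_children[OF c1(1) z(3) z'(3) c12 _ _ z(2,1) z'(2,1)] n by blast
  qed
  then have SU: "S = Cl c1 \<union> Cl c2" using SP c1T c2(1) by (auto simp: P_def)
  obtain h B where h: "hybrid_vertex VN A X h" "biconnected_set VN A B" "u \<in> B" "c1 \<in> B" "c2 \<in> B" "h \<in> B"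
    "(c1, h) \<in> A\<^sup>*" "(c2, h) \<in> A\<^sup>*"
    using meet[OF u(2) c1(1) z(3) c12 z(2,1)] by metis
  obtain xs where xs: "block_chain E (Cl h) xs" "Cl c1 = Cl h \<union> blocks xs"
    using spine_block_chain[OF E c1(1) z(3) c12 h(2,3,4,6,1,8) h(7)] unfolding Cl_def by blast
  obtain ys where ys: "block_chain E (Cl h) ys" "Cl c2 = Cl h \<union> blocks ys"
    using spine_block_chain[OF E z(3) c1(1) c12[symmetric] h(2,3,5,6,1,7) h(8)] unfolding Cl_def by blast
  have I: "Cl c1 \<inter> Cl c2 \<subseteq> Cl h"
    using hybrid_above_common[OF c1(1) z(3) c12 h(2,3,4,6,1)] by (auto simp: Cl_def)
  have dj: "blocks xs \<inter> Cl h = {}" "blocks ys \<inter> Cl h = {}" using block_chain_disjoint xs ys by metis+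
  have xy: "blocks xs \<inter> blocks ys = {}" using I dj xs ys by blast
  have "uniform E (blocks xs) (blocks ys) (t u = L1)" unfolding uniform_def
  proof (intro ballI)
    fix x y assume x: "x \<in> blocks xs" and y: "y \<in> blocks ys"
    have m: "x \<in> Cl c1" "y \<in> Cl c2" "x \<notin> Cl c2" "y \<notin> Cl c1" using x y xs ys dj xy by auto
    show "((x, y) \<in> E) = (t u = L1)"
    proof (rule edge_u)
      show "x \<in> S" "y \<in> S" "x \<noteq> y" using m SU by auto
      fix c assume c: "(u, c) \<in> A" "x \<in> Cl c" "y \<in> Cl c"
      then have n: "c \<noteq> c1" "c \<noteq> c2" using m by auto
      have "(c, f x) \<in> A\<^sup>*" "(c1, f x) \<in> A\<^sup>*" using c m by (auto simp: Cl_def)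
      then show False
        using no_three_overlapping_children[OF c1(1) z(3) c(1) c12 _ _ z(2,1), of "f x"] n by blast
    qed
  qed
  \<comment> \<open>The element \<open>r\<close> is not below \<open>c1\<close>, hence not below
    \<open>h\<close>. On the other side, an empty \<open>blocks xs\<close> would let
    \<open>c2\<close> alone reach all of \<open>S\<close>.\<close>
  moreover have "blocks ys \<noteq> {}" using r c2 xs ys SU by auto
  moreover have "blocks xs \<noteq> {}"
  proof
    assume "blocks xs = {}"
    then have "S = Cl c2" using SU xs ys by auto
    then show False using u3[OF z(3)] by simp
  qed
  moreover have "S = Cl h \<union> blocks xs \<union> blocks ys" using SU xs ys by auto
  ultimately show ?thesis using xs(1) ys(1) xy by blast
qed

end

section \<open>Prime graphs with a cycle structure are polar-cats\<close>

lemma reach_crossing: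
  assumes "(u, v) \<in> R\<^sup>*" "u \<in> P" "v \<notin> P"
  shows "\<exists>a b. (a, b) \<in> R \<and> a \<in> P \<and> b \<notin> P"
  using assms by (induction rule: rtrancl_induct) blast+

lemma connected_no_split:
  assumes "connected_on V R" "P \<union> Q = V" "P \<noteq> {}" "Q \<noteq> {}" "P \<inter> Q = {}"
  shows "\<exists>x\<in>P. \<exists>y\<in>Q. (x, y) \<in> R"
proof -
  obtain u v where uv: "u \<in> P" "v \<in> Q" using assms by blast
  then have "(u, v) \<in> (R \<inter> (V \<times> V))\<^sup>*" using assms by (auto simp: connected_on_def)
  then obtain a b where "(a, b) \<in> R \<inter> (V \<times> V)" "a \<in> P" "b \<notin> P"
    using reach_crossing[of u v _ P] uv assms by blast
  then show ?thesis using assms by blast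
qed

lemma split_free_iff_connected:
  assumes "simple_graph V E" "V \<noteq> {}"
  shows "split_free V E \<longleftrightarrow> connected_graph V E \<and> connected_graph V (complement V E)"
proof
  assume f: "split_free V E"
  \<comment> \<open>One argument for \<open>E\<close> and for its complement: no arc of
    \<open>R\<close> leaves the component \<open>P\<close> of \<open>u\<close>, and for both choices
    of \<open>R\<close> this is a uniform split.\<close>
  have c: "connected_on V R"
    if R: "sym R" "\<And>P. P \<subseteq> V \<Longrightarrow> (\<And>x y. x \<in> P \<Longrightarrow> y \<in> V - P \<Longrightarrow> (x, y) \<notin> R) \<Longrightarrow> \<exists>b. uniform E P (V - P) b" for R
    unfolding connected_on_def
  proof (intro ballI)
    fix u v assume uv: "u \<in> V" "v \<in> V"
    define P where "P = {w \<in> V. (u, w) \<in> (R \<inter> (V \<times> V))\<^sup>*}"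
    have "(x, y) \<notin> R" if "x \<in> P" "y \<in> V - P" for x y
      using that by (auto simp: P_def intro: rtrancl_into_rtrancl)
    then obtain b where "uniform E P (V - P) b" using R(2)[of P] by (auto simp: P_def)
    moreover have "u \<in> P" "P \<subseteq> V" using uv by (auto simp: P_def)
    ultimately have "V - P = {}" using f unfolding split_free_def
      by (metis Diff_disjoint Diff_partition empty_iff)
    then show "(u, v) \<in> (R \<inter> (V \<times> V))\<^sup>*" using uv by (auto simp: P_def)
  qed
  have "connected_on V E"
  proof (rule c)
    show "sym E" using assms by (simp add: simple_graph_def)
    show "\<exists>b. uniform E P (V - P) b" if "\<And>x y. x \<in> P \<Longrightarrow> y \<in> V - P \<Longrightarrow> (x, y) \<notin> E" for P
      using that by (intro exI[of _ False]) (auto simp: uniform_def)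
  qed
  moreover have "connected_on V (complement V E)"
  proof (rule c)
    show "sym (complement V E)" using assms by (auto simp: simple_graph_def complement_def sym_def)
    show "\<exists>b. uniform E P (V - P) b"
      if "P \<subseteq> V" "\<And>x y. x \<in> P \<Longrightarrow> y \<in> V - P \<Longrightarrow> (x, y) \<notin> complement V E" for P
      using that by (intro exI[of _ True]) (auto simp: uniform_def complement_def)
  qed
  ultimately show "connected_graph V E \<and> connected_graph V (complement V E)"
    using assms by (simp add: connected_graph_def)
next
  assume c: "connected_graph V E \<and> connected_graph V (complement V E)"
  show "split_free V E" unfolding split_free_def
  proof (intro allI impI)
    fix P Q b assume a: "P \<union> Q = V \<and> P \<inter> Q = {} \<and> uniform E P Q b"
    show "P = {} \<or> Q = {}"
    proof (rule ccontr)
      assume n: "\<not> (P = {} \<or> Q = {})"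
      obtain x y where "x \<in> P" "y \<in> Q" "(x, y) \<in> E"
        using connected_no_split[of V E P Q] c a n by (auto simp: connected_graph_def)
      moreover obtain x' y' where "x' \<in> P" "y' \<in> Q" "(x', y') \<in> complement V E"
        using connected_no_split[of V "complement V E" P Q] c a n by (auto simp: connected_graph_def)
      ultimately show False using a by (auto simp: uniform_def complement_def)
    qed
  qed
qed

lemma is_moduleI:
  assumes "E \<subseteq> V \<times> V" "M \<subseteq> V" "\<And>z. z \<in> V - M \<Longrightarrow> \<exists>b. \<forall>x\<in>M. ((x, z) \<in> E) = b"
  shows "is_module V E M"
  unfolding is_module_def
proof (intro conjI ballI)
  show "M \<subseteq> V" by fact
  fix x y assume xy: "x \<in> M" "y \<in> M"
  have "((x, z) \<in> E) = ((y, z) \<in> E)" if "z \<notin> M" for z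
    using assms(1) assms(3)[of z] that xy by (cases "z \<in> V") auto
  then show "nbh E x - M = nbh E y - M" by (auto simp: nbh_def)
qed

text \<open>Every vertex of an induced path on four vertices has a neighbour and a non-neighbour on
  it. A vertex that is uniform to the rest lies on no such path.\<close>

lemma cograph_insert:
  assumes "sym E" "uniform E {x} W b" "cograph W (induced E W)"
  shows "cograph (insert x W) (induced E (insert x W))"
  unfolding cograph_def
proof (rule notI, elim exE conjE)
  fix p q r s
  assume m: "p \<in> insert x W" "q \<in> insert x W" "r \<in> insert x W" "s \<in> insert x W"
    and d: "distinct [p, q, r, s]"
    and e: "(p, q) \<in> induced E (insert x W)" "(q, r) \<in> induced E (insert x W)" "(r, s) \<in> induced E (insert x W)"
      "(p, r) \<notin> induced E (insert x W)" "(q, s) \<notin> induced E (insert x W)" "(p, s) \<notin> induced E (insert x W)"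
  have e': "(p, q) \<in> E" "(q, r) \<in> E" "(r, s) \<in> E" "(p, r) \<notin> E" "(q, s) \<notin> E" "(p, s) \<notin> E"
    using e m by (auto simp: induced_def)
  have s: "(q, p) \<in> E" "(r, q) \<in> E" "(s, r) \<in> E" "(r, p) \<notin> E" "(s, q) \<notin> E" "(s, p) \<notin> E"
    using e' assms(1) by (auto dest: symD)
  have u: "((x, y) \<in> E) = b" if "y \<in> insert x W" "y \<noteq> x" for y
    using that assms(2) by (auto simp: uniform_def)
  have dd: "p \<noteq> q" "p \<noteq> r" "p \<noteq> s" "q \<noteq> r" "q \<noteq> s" "r \<noteq> s" using d by auto
  have "x \<noteq> p" using u[OF m(2)] u[OF m(3)] e' dd by metis
  moreover have "x \<noteq> q" using u[OF m(3)] u[OF m(4)] e' dd by metis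
  moreover have "x \<noteq> r" using u[OF m(1)] u[OF m(2)] s dd by metis
  moreover have "x \<noteq> s" using u[OF m(3)] u[OF m(1)] s dd by metis
  ultimately have W: "p \<in> W" "q \<in> W" "r \<in> W" "s \<in> W" using m by auto
  then have i: "(p, q) \<in> induced E W" "(q, r) \<in> induced E W" "(r, s) \<in> induced E W"
      "(p, r) \<notin> induced E W" "(q, s) \<notin> induced E W" "(p, s) \<notin> induced E W"
    using e' by (auto simp: induced_def)
  show False using assms(3) W d i unfolding cograph_def by blast
qed

lemma chain_cograph:
  assumes "sym E" "chain E v xs"
  shows "cograph (insert v (fst ` set xs)) (induced E (insert v (fst ` set xs)))"
  using assms
proof (induction E v xs rule: chain.induct)
  case (1 E v)
  then show ?case by (auto simp: cograph_def)
next
  case (2 E v x b xs)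
  have "cograph (insert x (insert v (fst ` set xs))) (induced E (insert x (insert v (fst ` set xs))))"
    by (rule cograph_insert[where b = b]) (use 2 in simp_all)
  then show ?case by (simp add: insert_commute)
qed

text \<open>The head is adjacent to all other vertices or isolated, and \<open>v\<close> ensures
  that another vertex exists.\<close>

lemma chain_head_connected:
  assumes "sym E" "chain E v ((x, b) # xs)"
  defines "W \<equiv> insert v (fst ` set ((x, b) # xs))"
  shows "connected_graph W (induced E W) \<longleftrightarrow> b"
proof -
  have u: "uniform E {x} (W - {x}) b" using assms(2) by (auto simp: W_def uniform_def)
  have W: "x \<in> W" "v \<in> W" "x \<noteq> v" using assms(2) by (auto simp: W_def)
  show ?thesis
  proof
    assume "connected_graph W (induced E W)"
    then obtain y where "y \<in> W - {x}" "(x, y) \<in> induced E W"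
      using connected_no_split[of W _ "{x}" "W - {x}"] W by (auto simp: connected_graph_def)
    then show b using u by (auto simp: uniform_def induced_def)
  next
    assume b
    let ?R = "(induced E W \<inter> (W \<times> W))\<^sup>*"
    have "(x, y) \<in> ?R \<and> (y, x) \<in> ?R" if "y \<in> W" for y
    proof (cases "y = x")
      case False
      then have "(x, y) \<in> E" using u that \<open>b\<close> by (auto simp: uniform_def)
      then have "(x, y) \<in> induced E W \<inter> (W \<times> W)" "(y, x) \<in> induced E W \<inter> (W \<times> W)"
        using assms(1) that W by (auto simp: induced_def dest: symD)
      then show ?thesis by blast
    qed simp
    then have "connected_on W (induced E W)" unfolding connected_on_def by (meson rtrancl_trans)
    then show "connected_graph W (induced E W)" using W by (auto simp: connected_graph_def)
  qed
qed

lemma chain_distinct: "chain E v xs \<Longrightarrow> distinct (map fst xs) \<and> v \<notin> fst ` set xs"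
  by (induction E v xs rule: chain.induct) auto

lemma chain_nth:
  assumes "chain E v xs" "i < length xs"
  shows "((fst (xs ! i), v) \<in> E) = snd (xs ! i)"
    and "i < j \<Longrightarrow> j < length xs \<Longrightarrow> ((fst (xs ! i), fst (xs ! j)) \<in> E) = snd (xs ! i)"
proof -
  have "((fst (xs ! i), v) \<in> E) = snd (xs ! i) \<and>
    (\<forall>j. i < j \<and> j < length xs \<longrightarrow> ((fst (xs ! i), fst (xs ! j)) \<in> E) = snd (xs ! i))"
    using assms
  proof (induction E v xs arbitrary: i rule: chain.induct)
    case (1 E v)
    then show ?case by simp
  next
    case (2 E v x b xs)
    show ?case
    proof (cases i)
      case 0
      have "((x, fst (xs ! k)) \<in> E) = b" if "k < length xs" for k
        using 2(2) that by (auto simp: uniform_def)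
      then show ?thesis using 2(2) 0 by (auto simp: uniform_def nth_Cons')
    next
      case (Suc k)
      have k: "chain E v xs" "k < length xs" using 2(2,3) Suc by auto
      have "((fst (xs ! k), fst (((x, b) # xs) ! j)) \<in> E) = snd (xs ! k)"
        if j: "i < j" "j < length ((x, b) # xs)" for j
        using 2(1)[OF k] j Suc by (cases j) auto
      then show ?thesis using 2(1)[OF k] Suc by simp
    qed
  qed
  then show "((fst (xs ! i), v) \<in> E) = snd (xs ! i)"
    and "i < j \<Longrightarrow> j < length xs \<Longrightarrow> ((fst (xs ! i), fst (xs ! j)) \<in> E) = snd (xs ! i)"
    by auto
qed

section \<open>Explicit caterpillars for chains\<close>

definition cat_arcs :: "nat \<Rightarrow> (nat \<times> nat) set" where
  "cat_arcs n = {(a, b). even a \<and> a < 2 * n \<and> (b = a + 1 \<or> b = a + 2)}"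

text \<open>The even numbers below \<open>2 * n\<close> form the spine; \<open>2 * i\<close> has the
  leaf \<open>2 * i + 1\<close> and the successor \<open>2 * i + 2\<close>. The last successor
  \<open>2 * n\<close> is itself a leaf, the cherry partner of \<open>2 * n - 1\<close>.\<close>

definition cat_leaves :: "nat \<Rightarrow> nat set" where
  "cat_leaves n = {j. j \<le> 2 * n \<and> (odd j \<or> j = 2 * n)}"

lemma cat_arcs_less: "(a, b) \<in> cat_arcs n \<Longrightarrow> a < b \<and> b \<le> 2 * n"
  by (auto simp: cat_arcs_def elim!: evenE)

lemma cat_reach_le: "(a, b) \<in> (cat_arcs n)\<^sup>* \<Longrightarrow> a \<le> b"
  by (induction rule: rtrancl_induct) (auto dest: cat_arcs_less)

lemma cat_parents:
  assumes "0 < v" "v \<le> 2 * n"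
  shows "{u. (u, v) \<in> cat_arcs n} = {if odd v then v - 1 else v - 2}"
  using assms by (auto simp: cat_arcs_def elim!: evenE oddE) presburger+

lemma cat_children:
  "{w. (v, w) \<in> cat_arcs n} = (if even v \<and> v < 2 * n then {v + 1, v + 2} else {})"
  by (auto simp: cat_arcs_def)

lemma cat_reach: "i \<le> n \<Longrightarrow> j \<le> i \<Longrightarrow> (2 * j, 2 * i) \<in> (cat_arcs n)\<^sup>*"
proof (induction i)
  case (Suc i)
  show ?case
  proof (cases "j = Suc i")
    case False
    then have "(2 * j, 2 * i) \<in> (cat_arcs n)\<^sup>*" using Suc by simp
    moreover have "(2 * i, 2 * Suc i) \<in> cat_arcs n" using Suc by (auto simp: cat_arcs_def)
    ultimately show ?thesis by (rule rtrancl_into_rtrancl)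
  qed simp
qed simp

lemma cat_network:
  assumes "0 < n"
  shows "is_network {0..2 * n} (cat_arcs n) (cat_leaves n)"
  unfolding is_network_def
proof (intro conjI disjI2)
  show "cat_arcs n \<subseteq> {0..2 * n} \<times> {0..2 * n}" by (auto dest: cat_arcs_less)
  have "(a, b) \<in> (cat_arcs n)\<^sup>+ \<Longrightarrow> a < b" for a b
    by (induction rule: trancl_induct) (auto dest: cat_arcs_less)
  then show "acyclic (cat_arcs n)" by (auto simp: acyclic_def)
  show "cat_leaves n \<subseteq> {0..2 * n}" by (auto simp: cat_leaves_def)
  have in0: "indeg (cat_arcs n) 0 = 0" by (simp add: indeg_def cat_arcs_def)
  have in1: "indeg (cat_arcs n) v = 1" if "v \<in> {0..2 * n}" "v \<noteq> 0" for v
    unfolding indeg_def using cat_parents[of v n] that by simp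
  have out: "outdeg (cat_arcs n) v = (if even v \<and> v < 2 * n then 2 else 0)" for v
    unfolding outdeg_def cat_children by simp
  show "\<exists>\<rho>\<in>{0..2 * n}. indeg (cat_arcs n) \<rho> = 0 \<and> 2 \<le> outdeg (cat_arcs n) \<rho> \<and>
       (\<forall>u\<in>{0..2 * n}. indeg (cat_arcs n) u = 0 \<longrightarrow> u = \<rho>) \<and>
       (\<forall>v\<in>{0..2 * n}. (v \<in> cat_leaves n) = (outdeg (cat_arcs n) v = 0 \<and> indeg (cat_arcs n) v = 1)) \<and>
       (\<forall>v\<in>{0..2 * n} - (cat_leaves n \<union> {\<rho>}).
           indeg (cat_arcs n) v = 1 \<and> 2 \<le> outdeg (cat_arcs n) v \<or>
           indeg (cat_arcs n) v = 2 \<and> 1 \<le> outdeg (cat_arcs n) v)"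
  proof (intro bexI[of _ 0] conjI ballI impI)
    fix u assume "u \<in> {0..2 * n}" "indeg (cat_arcs n) u = 0"
    then show "u = 0" using in1[of u] by (cases "u = 0") auto
  next
    fix v assume v: "v \<in> {0..2 * n}"
    then show "(v \<in> cat_leaves n) = (outdeg (cat_arcs n) v = 0 \<and> indeg (cat_arcs n) v = 1)"
      using in1[of v] out[of v] in0 assms by (cases "v = 0") (auto simp: cat_leaves_def)
  next
    fix v assume v: "v \<in> {0..2 * n} - (cat_leaves n \<union> {0})"
    then show "indeg (cat_arcs n) v = 1 \<and> 2 \<le> outdeg (cat_arcs n) v \<or>
           indeg (cat_arcs n) v = 2 \<and> 1 \<le> outdeg (cat_arcs n) v"
      using in1[of v] out[of v] by (auto simp: cat_leaves_def)
  qed (use in0 out assms in auto)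
qed simp

lemma cat_no_hybrid: "\<not> hybrid_vertex {0..2 * n} (cat_arcs n) X v"
proof
  assume h: "hybrid_vertex {0..2 * n} (cat_arcs n) X v"
  then have "indeg (cat_arcs n) v = 2" "v \<le> 2 * n" by (auto simp: hybrid_vertex_def)
  moreover have "indeg (cat_arcs n) 0 = 0" by (simp add: indeg_def cat_arcs_def)
  then have "v \<noteq> 0" using calculation(1) by (intro notI) simp
  ultimately show False using cat_parents[of v n] by (auto simp: indeg_def)
qed

lemma level1_if_no_hybrid: "(\<And>v. \<not> hybrid_vertex VN A X v) \<Longrightarrow> level1 VN A X"
  by (simp add: level1_def)

text \<open>Numbers grow along arcs, so the only child of \<open>2 * i\<close> that reaches
  \<open>2 * i + 1\<close> is this leaf itself, and a leaf reaches nothing else.\<close>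

lemma cat_lca:
  assumes "i < n" "j \<in> cat_leaves n" "2 * i + 1 < j"
  shows "lca {0..2 * n} (cat_arcs n) (2 * i + 1) j = 2 * i"
    and "lca {0..2 * n} (cat_arcs n) j (2 * i + 1) = 2 * i"
proof -
  interpret level1_network "{0..2 * n}" "cat_arcs n" "cat_leaves n"
    by unfold_locales (use assms cat_network[of n] level1_if_no_hybrid[OF cat_no_hybrid] in simp_all)
  have l: "2 * i + 1 \<in> cat_leaves n" using assms by (auto simp: cat_leaves_def)
  have "(2 * i, j) \<in> (cat_arcs n)\<^sup>*"
  proof (cases "even j")
    case True
    then show ?thesis using assms cat_reach[of "j div 2" n i] by (auto simp: cat_leaves_def)
  next
    case False
    then obtain k where k: "j = 2 * k + 1" by (auto elim: oddE)
    then have "(2 * i, 2 * k) \<in> (cat_arcs n)\<^sup>*" "(2 * k, j) \<in> cat_arcs n"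
      using assms cat_reach[of k n i] by (auto simp: cat_leaves_def cat_arcs_def)
    then show ?thesis by (rule rtrancl_into_rtrancl)
  qed
  moreover have "(2 * i, 2 * i + 1) \<in> (cat_arcs n)\<^sup>*" using assms by (auto simp: cat_arcs_def)
  moreover have False if c: "(2 * i, c) \<in> cat_arcs n" "(c, 2 * i + 1) \<in> (cat_arcs n)\<^sup>*" "(c, j) \<in> (cat_arcs n)\<^sup>*" for c
  proof -
    have "c = 2 * i + 1" using c(1) cat_reach_le[OF c(2)] by (auto simp: cat_arcs_def)
    then show False using leaf_reach[OF l] c(3) assms by auto
  qed
  ultimately have "is_lca {0..2 * n} (cat_arcs n) (2 * i + 1) j (2 * i)"
    and "is_lca {0..2 * n} (cat_arcs n) j (2 * i + 1) (2 * i)"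
    using assms by (intro is_lcaI; force)+
  then show "lca {0..2 * n} (cat_arcs n) (2 * i + 1) j = 2 * i"
    and "lca {0..2 * n} (cat_arcs n) j (2 * i + 1) = 2 * i" by (simp_all add: lca_eqI)
qed

lemma cat_caterpillar:
  assumes "0 < n"
  shows "caterpillar {0..2 * n} (cat_arcs n) (cat_leaves n)"
  unfolding caterpillar_def is_tree_def
proof (intro conjI ballI allI)
  show "is_network {0..2 * n} (cat_arcs n) (cat_leaves n)" by (rule cat_network[OF assms])
  show "\<not> hybrid_vertex {0..2 * n} (cat_arcs n) (cat_leaves n) v" for v by (rule cat_no_hybrid)
  show "outdeg (cat_arcs n) v = 2" if "v \<in> {0..2 * n} - cat_leaves n" for v
    using that unfolding outdeg_def cat_children by (auto simp: cat_leaves_def)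
  let ?us = "map (\<lambda>i. 2 * i) [0..<n]"
  show "\<exists>us. us \<noteq> [] \<and> distinct us \<and> set us = {0..2 * n} - cat_leaves n \<and> indeg (cat_arcs n) (hd us) = 0 \<and>
         (\<forall>a\<in>{0..2 * n} - cat_leaves n. \<forall>b\<in>{0..2 * n} - cat_leaves n.
        ((a, b) \<in> cat_arcs n \<or> (b, a) \<in> cat_arcs n) =
        (\<exists>i. Suc i < length us \<and> {a, b} = {us ! i, us ! Suc i}))"
  proof (intro exI[of _ ?us] conjI ballI)
    show "?us \<noteq> []" "distinct ?us" using assms by (auto simp: distinct_map inj_on_def)
    show "set ?us = {0..2 * n} - cat_leaves n"
      by (auto simp: cat_leaves_def elim!: evenE)
    show "indeg (cat_arcs n) (hd ?us) = 0" using assms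
      by (simp add: hd_map indeg_def cat_arcs_def)
    fix a b assume a: "a \<in> {0..2 * n} - cat_leaves n" and b: "b \<in> {0..2 * n} - cat_leaves n"
    then obtain i j where ij: "a = 2 * i" "b = 2 * j" "i < n" "j < n"
      by (auto simp: cat_leaves_def elim!: evenE)
    have "(\<exists>k. Suc k < length ?us \<and> {a, b} = {?us ! k, ?us ! Suc k}) \<longleftrightarrow>
      (\<exists>k. Suc k < n \<and> {a, b} = {2 * k, 2 * Suc k})"
      by (rule ex_cong1, rule conj_cong) auto
    also have "\<dots> \<longleftrightarrow> (\<exists>k. Suc k < n \<and> (i = k \<and> j = Suc k \<or> i = Suc k \<and> j = k))"
      using ij by (auto simp: doubleton_eq_iff)
    also have "\<dots> \<longleftrightarrow> j = Suc i \<or> i = Suc j" using ij by auto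
    also have "\<dots> \<longleftrightarrow> (a, b) \<in> cat_arcs n \<or> (b, a) \<in> cat_arcs n"
      using ij by (auto simp: cat_arcs_def)
    finally show "((a, b) \<in> cat_arcs n \<or> (b, a) \<in> cat_arcs n) =
        (\<exists>i. Suc i < length ?us \<and> {a, b} = {?us ! i, ?us ! Suc i})" by blast
  qed
qed

definition chain_leaf :: "'a \<Rightarrow> ('a \<times> bool) list \<Rightarrow> nat \<Rightarrow> 'a" where
  "chain_leaf v xs j = (if j = 2 * length xs then v else fst (xs ! (j div 2)))"

text \<open>The i-th entry becomes the leaf \<open>2 * i + 1\<close>, its flag the label of the
  spine vertex \<open>2 * i\<close>, and \<open>v\<close> the deepest leaf \<open>2 * n\<close> with
  \<open>n\<close> the length of the list. Alternation of the flags is what makes the labeling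
  discriminating.\<close>

lemma chain_caterpillar_explainable:
  assumes E: "sym E" "\<forall>x. (x, x) \<notin> E" and ch: "chain E v xs" and ne: "xs \<noteq> []"
    and alt: "successively (\<lambda>p q. snd p \<noteq> snd q) xs"
  shows "caterpillar_explainable_cherry (insert v (fst ` set xs)) (induced E (insert v (fst ` set xs))) v"
proof -
  let ?n = "length xs" and ?W = "insert v (fst ` set xs)" and ?g = "chain_leaf v xs"
  define t where "t = (\<lambda>j. if j \<in> cat_leaves ?n then LOdot else if snd (xs ! (j div 2)) then L1 else L0)"
  let ?N = "net_graph_edges {0..2 * ?n} (cat_arcs ?n) (cat_leaves ?n) t"
  have n: "0 < ?n" using ne by simp
  have di: "distinct (map fst xs)" "v \<notin> fst ` set xs" using chain_distinct[OF ch] by auto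
  have g: "?g (2 * ?n) = v" "\<And>i. ?g (2 * i + 1) = fst (xs ! i)"
  proof -
    show "?g (2 * ?n) = v" by (simp add: chain_leaf_def)
    fix i
    have "2 * i + 1 \<noteq> 2 * ?n" by presburger
    then show "?g (2 * i + 1) = fst (xs ! i)" unfolding chain_leaf_def by simp
  qed
  have leaf_cases: "\<exists>i<?n. j = 2 * i + 1" if "j \<in> cat_leaves ?n" "j \<noteq> 2 * ?n" for j
    using that by (auto simp: cat_leaves_def elim!: oddE)
  have inj: "inj_on ?g (cat_leaves ?n)"
  proof (rule inj_onI)
    fix a b assume ab: "a \<in> cat_leaves ?n" "b \<in> cat_leaves ?n" "?g a = ?g b"
    have nv: "fst (xs ! i) \<noteq> v" if "i < ?n" for i using that di(2) by force
    have eq: "i = j" if "fst (xs ! i) = fst (xs ! j)" "i < ?n" "j < ?n" for i j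
      using that di(1) by (metis length_map nth_eq_iff_index_eq nth_map)
    show "a = b"
      using leaf_cases[OF ab(1)] leaf_cases[OF ab(2)] ab(3) nv eq g
      by (cases "a = 2 * ?n"; cases "b = 2 * ?n") metis+
  qed
  have im: "?g ` cat_leaves ?n = ?W"
  proof
    show "?g ` cat_leaves ?n \<subseteq> ?W"
    proof
      fix y assume "y \<in> ?g ` cat_leaves ?n"
      then obtain j where j: "j \<in> cat_leaves ?n" "y = ?g j" by auto
      then show "y \<in> ?W" using leaf_cases[OF j(1)] g by (cases "j = 2 * ?n") auto
    qed
    have "2 * ?n \<in> cat_leaves ?n" "\<And>i. i < ?n \<Longrightarrow> 2 * i + 1 \<in> cat_leaves ?n" by (auto simp: cat_leaves_def)
    moreover have "\<exists>i<?n. y = fst (xs ! i)" if "y \<in> fst ` set xs" for y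
      using that by (auto simp: in_set_conv_nth) (metis fst_conv)
    ultimately show "?W \<subseteq> ?g ` cat_leaves ?n" using g by (metis (no_types, lifting) image_eqI insert_iff subsetI)
  qed
  have bij: "bij_betw ?g (cat_leaves ?n) ?W" using inj im by (simp add: bij_betw_def)
  have e1: "((?g (2 * i + 1), ?g j) \<in> E) = snd (xs ! i)" if "i < ?n" "j \<in> cat_leaves ?n" "2 * i + 1 < j" for i j
    using chain_nth[OF ch that(1)] that leaf_cases[OF that(2)] g by (cases "j = 2 * ?n") auto
  have t: "(t (2 * i) = L1) = snd (xs ! i)" if "i < ?n" for i
    using that by (auto simp: t_def cat_leaves_def)
  have edge: "((?g a, ?g b) \<in> E) = ((a, b) \<in> ?N)" if ab: "a \<in> cat_leaves ?n" "b \<in> cat_leaves ?n" for a b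
  proof -
    consider "a = b" | "a < b" | "b < a" by linarith
    then show ?thesis
    proof cases
      case 1
      then show ?thesis using E(2) by (auto simp: net_graph_edges_def)
    next
      case 2
      then obtain i where i: "i < ?n" "a = 2 * i + 1" using leaf_cases[OF ab(1)] ab by (auto simp: cat_leaves_def)
      then show ?thesis using e1[of i b] cat_lca(1)[of i ?n b] t ab 2 by (auto simp: net_graph_edges_def)
    next
      case 3
      then obtain i where i: "i < ?n" "b = 2 * i + 1" using leaf_cases[OF ab(2)] ab by (auto simp: cat_leaves_def)
      have "((?g a, ?g b) \<in> E) = ((?g b, ?g a) \<in> E)" using E(1) by (auto dest: symD)
      then show ?thesis using i e1[of i a] cat_lca(2)[of i ?n a] t ab 3 by (auto simp: net_graph_edges_def)
    qed
  qed
  define f where "f = the_inv_into (cat_leaves ?n) ?g"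
  have fbij: "bij_betw f ?W (cat_leaves ?n)" unfolding f_def by (rule bij_betw_the_inv_into[OF bij])
  have gf: "?g (f x) = x" if "x \<in> ?W" for x
    unfolding f_def using that im f_the_inv_into_f[OF inj] by metis
  have fl: "f x \<in> cat_leaves ?n" if "x \<in> ?W" for x using fbij that by (meson bij_betwE)
  have "graph_iso f ?W (induced E ?W) (cat_leaves ?n) ?N"
    unfolding graph_iso_def
  proof (intro conjI ballI fbij)
    fix x y assume xy: "x \<in> ?W" "y \<in> ?W"
    have "((x, y) \<in> induced E ?W) = ((?g (f x), ?g (f y)) \<in> E)" using gf xy by (auto simp: induced_def)
    then show "((x, y) \<in> induced E ?W) = ((f x, f y) \<in> ?N)" using edge fl xy by simp
  qed
  moreover have "labeling {0..2 * ?n} (cat_leaves ?n) t"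
    by (auto simp: labeling_def t_def)
  moreover have "discriminating (cat_arcs ?n) (cat_leaves ?n) t"
    unfolding discriminating_def
  proof clarify
    fix a b assume a: "(a, b) \<in> cat_arcs ?n" "a \<notin> cat_leaves ?n" "b \<notin> cat_leaves ?n" "t a = t b"
    have "b \<le> 2 * ?n" using a cat_arcs_less by blast
    then have "even b" "b < 2 * ?n" using a by (auto simp: cat_leaves_def)
    moreover have "even a" using a by (auto simp: cat_arcs_def)
    moreover have "b = a + 1 \<or> b = a + 2" using a by (auto simp: cat_arcs_def)
    ultimately have b: "b = a + 2" "b < 2 * ?n" by auto
    obtain k where "a = 2 * k" using \<open>even a\<close> by (rule evenE)
    then obtain i where i: "a = 2 * i" "b = 2 * Suc i" "Suc i < ?n" using b by simp
    then have "snd (xs ! i) = snd (xs ! Suc i)" using a t[of i] t[of "Suc i"] by auto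
    then show False using alt i(3) by (auto simp: successively_conv_nth)
  qed
  moreover have "in_cherry (cat_arcs ?n) (cat_leaves ?n) (f v)"
  proof -
    have "f v = 2 * ?n" using g(1) inj by (auto simp: f_def cat_leaves_def intro!: the_inv_into_f_eq)
    moreover obtain m where "?n = Suc m" using n gr0_implies_Suc by blast
    ultimately show ?thesis unfolding in_cherry_def
      by (intro conjI exI[of _ "2 * m"] exI[of _ "2 * m + 1"]) (auto simp: cat_leaves_def cat_arcs_def)
  qed
  ultimately show ?thesis unfolding caterpillar_explainable_cherry_def
    using cat_caterpillar[OF n] by blast
qed


text \<open>An earlier entry is uniform to all that follow and does not separate the two. Later
  entries and \<open>v\<close> meet each of the two with its own flag, and these flags
  agree.\<close>

lemma chain_twins:
  assumes E: "sym E" and ch: "chain E v xs" and i: "Suc i < length xs" "snd (xs ! i) = snd (xs ! Suc i)"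
    and z: "z \<in> insert v (fst ` set xs) - {fst (xs ! i), fst (xs ! Suc i)}"
  shows "((fst (xs ! i), z) \<in> E) = ((fst (xs ! Suc i), z) \<in> E)"
proof (cases "z = v")
  case True
  then show ?thesis using chain_nth(1)[OF ch, of i] chain_nth(1)[OF ch, of "Suc i"] i by simp
next
  case False
  then obtain k where k: "k < length xs" "z = fst (xs ! k)"
    using z by (auto simp: in_set_conv_nth)
  have s: "((p, q) \<in> E) = ((q, p) \<in> E)" for p q using E by (auto dest: symD)
  consider "k < i" | "k = i" | "k = Suc i" | "Suc i < k" by linarith
  then show ?thesis
  proof cases
    case 1
    then show ?thesis
      using chain_nth(2)[OF ch, of k i] chain_nth(2)[OF ch, of k "Suc i"] i k s by auto
  next
    case 4
    then show ?thesis
      using chain_nth(2)[OF ch, of i k] chain_nth(2)[OF ch, of "Suc i" k] i k by auto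
  qed (use z k in auto)
qed

lemma join_if_uniform:
  assumes "sym E" "P \<inter> Q = {}" "uniform E P Q True"
  shows "is_join (P \<union> Q) (induced E (P \<union> Q)) P (induced E P) Q (induced E Q)"
  using assms unfolding is_join_def induced_def uniform_def by (auto dest: symD)

lemma disjoint_union_if_uniform:
  assumes "sym E" "P \<inter> Q = {}" "uniform E P Q False"
  shows "is_disjoint_union (P \<union> Q) (induced E (P \<union> Q)) P (induced E P) Q (induced E Q)"
  using assms unfolding is_disjoint_union_def induced_def uniform_def by (auto dest: symD)

text \<open>Each part is connected exactly if its head flag holds. Head flags different from
  \<open>b\<close> thus mean connected parts with a disjoint union, or disconnected parts with a
  join: the polarizing condition. Alternation supplies the discriminating caterpillars.\<close>

lemma polar_cat_if_chains:
  assumes S: "simple_graph S E" and ch: "chain E v xs" "chain E v ys"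
    and SU: "S = insert v (fst ` set xs \<union> fst ` set ys)" and dj: "fst ` set xs \<inter> fst ` set ys = {}"
    and un: "uniform E (fst ` set xs) (fst ` set ys) b"
    and ne: "xs \<noteq> []" "ys \<noteq> []" and hd: "snd (hd xs) \<noteq> b" "snd (hd ys) \<noteq> b"
    and alt: "successively (\<lambda>p q. snd p \<noteq> snd q) xs" "successively (\<lambda>p q. snd p \<noteq> snd q) ys"
    and card: "card S \<ge> 4"
  shows "polar_cat S E"
proof -
  let ?P = "fst ` set xs" and ?Q = "fst ` set ys"
  let ?V1 = "insert v ?P" and ?V2 = "insert v ?Q"
  have E: "sym E" "\<forall>x. (x, x) \<notin> E" "finite S" using S by (auto simp: simple_graph_def)
  have v: "v \<notin> ?P" "v \<notin> ?Q" using chain_distinct[OF ch(1)] chain_distinct[OF ch(2)] by auto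
  have m: "?V1 - {v} = ?P" "?V2 - {v} = ?Q" "S - {v} = ?P \<union> ?Q" using v SU by auto
  have conn: "connected_graph ?V1 (induced E ?V1) \<longleftrightarrow> \<not> b" "connected_graph ?V2 (induced E ?V2) \<longleftrightarrow> \<not> b"
  proof -
    obtain x c xs' where x: "xs = (x, c) # xs'" using ne(1) by (cases xs) auto
    show "connected_graph ?V1 (induced E ?V1) \<longleftrightarrow> \<not> b"
      using chain_head_connected[OF E(1), of v x c xs'] ch(1) hd(1) unfolding x by auto
    obtain y d ys' where y: "ys = (y, d) # ys'" using ne(2) by (cases ys) auto
    show "connected_graph ?V2 (induced E ?V2) \<longleftrightarrow> \<not> b"
      using chain_head_connected[OF E(1), of v y d ys'] ch(2) hd(2) unfolding y by auto
  qed
  have c2: "card (insert v (fst ` set zs)) > 1" if "zs \<noteq> []" "v \<notin> fst ` set zs" for zs :: "('a \<times> bool) list"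
  proof -
    have "card (fst ` set zs) > 0" using that(1) by (simp add: card_gt_0_iff)
    then show ?thesis using that(2) by simp
  qed
  have J: "is_join (S - {v}) (induced E (S - {v})) (?V1 - {v}) (induced E (?V1 - {v})) (?V2 - {v}) (induced E (?V2 - {v}))"
    if b unfolding m by (rule join_if_uniform) (use that E dj un in auto)
  have D: "is_disjoint_union (S - {v}) (induced E (S - {v})) (?V1 - {v}) (induced E (?V1 - {v})) (?V2 - {v}) (induced E (?V2 - {v}))"
    if "\<not> b" unfolding m by (rule disjoint_union_if_uniform) (use that E dj un in auto)
  have pc: "pseudo_cograph_at S E v ?V1 ?V2" unfolding pseudo_cograph_at_def
  proof (intro conjI)
    show "?V1 \<subseteq> S" "?V2 \<subseteq> S" "?V1 \<union> ?V2 = S" "?V1 \<inter> ?V2 = {v}" using SU dj by auto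
    show "1 < card ?V1" "1 < card ?V2" using c2 ne v by auto
    show "cograph ?V1 (induced E ?V1)" "cograph ?V2 (induced E ?V2)" using chain_cograph E ch by metis+
  qed (use J D in blast)
  have "polarizing_at S E v ?V1 ?V2" unfolding polarizing_at_def
    using pc conn J D card by (cases b) auto
  moreover have "cat_at S E v ?V1 ?V2" unfolding cat_at_def
    using pc card chain_caterpillar_explainable[OF E(1,2) ch(1) ne(1) alt(1)]
      chain_caterpillar_explainable[OF E(1,2) ch(2) ne(2) alt(2)] by auto
  ultimately show ?thesis unfolding polar_cat_def by blast
qed

section \<open>Collapsing the blocks of a prime graph to single vertices\<close>

lemma block_subset: "(D, c) \<in> set xs \<Longrightarrow> D \<subseteq> blocks xs"
  by (induction xs rule: blocks.induct) auto

lemma block_chain_core_uniform: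
  assumes "block_chain E M xs" "z \<in> blocks xs"
  shows "\<exists>b. \<forall>x\<in>M. ((z, x) \<in> E) = b"
  using assms by (induction E M xs rule: block_chain.induct) (auto simp: uniform_def)

text \<open>A vertex of an earlier block meets \<open>D\<close> with the flag of that block; a
  vertex of a later block or of the core meets it with the flag of \<open>D\<close>.\<close>

lemma block_chain_block_uniform:
  assumes "sym E" "block_chain E M xs" "(D, c) \<in> set xs" "z \<in> M \<union> blocks xs - D"
  shows "\<exists>b. \<forall>x\<in>D. ((x, z) \<in> E) = b"
  using assms
proof (induction E M xs rule: block_chain.induct)
  case (1 E M)
  then show ?case by simp
next
  case (2 E M D' b xs)
  show ?case
  proof (cases "(D, c) = (D', b)")
    case True
    then show ?thesis using 2 by (intro exI[of _ b]) (auto simp: uniform_def)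
  next
    case False
    then have D: "(D, c) \<in> set xs" using 2 by auto
    show ?thesis
    proof (cases "z \<in> D'")
      case True
      then have "((z, x) \<in> E) = b" if "x \<in> D" for x
        using 2(3) block_subset[OF D] that by (auto simp: uniform_def)
      then show ?thesis using 2(2) by (intro exI[of _ b]) (auto dest: symD)
    next
      case z: False
      then show ?thesis using 2 D by auto
    qed
  qed
qed

lemma block_chain_to_chain:
  assumes "block_chain E {v} xs" "\<And>D c. (D, c) \<in> set xs \<Longrightarrow> D = {} \<or> (\<exists>x. D = {x})"
  shows "\<exists>xs'. chain E v xs' \<and> fst ` set xs' = blocks xs"
  using assms
proof (induction xs)
  case Nil
  then show ?case by (intro exI[of _ "[]"]) simp
next
  case (Cons p xs)
  obtain D b where p: "p = (D, b)" by (cases p)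
  have "block_chain E {v} xs" using Cons.prems(1) p by simp
  moreover have "D = {} \<or> (\<exists>x. D = {x})" if "(D, c) \<in> set xs" for D c
    using Cons.prems(2)[of D c] that by simp
  ultimately obtain xs' where xs': "chain E v xs'" "fst ` set xs' = blocks xs" using Cons.IH by blast
  consider "D = {}" | x where "D = {x}" using Cons.prems(2)[of D b] p by auto
  then show ?case
  proof cases
    case 1
    then show ?thesis using xs' p by (intro exI[of _ xs']) simp
  next
    case 2
    then show ?thesis using xs' p Cons.prems(1) by (intro exI[of _ "(x, b) # xs'"]) auto
  qed
qed

text \<open>Within its own chain \<open>D\<close> is seen uniformly from everywhere; the only other
  vertices lie on the opposite side \<open>Q\<close>, which meets the whole chain with the value
  \<open>b\<close>.\<close>

lemma block_is_module:
  assumes S: "simple_graph S E" and bx: "block_chain E M xs"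
    and SU: "S = M \<union> blocks xs \<union> Q" and un: "\<And>x y. x \<in> blocks xs \<Longrightarrow> y \<in> Q \<Longrightarrow> ((x, y) \<in> E) = b"
    and D: "(D, c) \<in> set xs"
  shows "is_module S E D"
proof (rule is_moduleI)
  have D': "D \<subseteq> blocks xs" using block_subset D by metis
  show "E \<subseteq> S \<times> S" "D \<subseteq> S" using S D' SU by (auto simp: simple_graph_def)
  fix z assume z: "z \<in> S - D"
  show "\<exists>b. \<forall>x\<in>D. ((x, z) \<in> E) = b"
  proof (cases "z \<in> Q")
    case True
    then show ?thesis using un D' by (intro exI[of _ b]) auto
  next
    case False
    then have "z \<in> M \<union> blocks xs - D" using z SU by auto
    moreover have "sym E" using S by (simp add: simple_graph_def)
    ultimately show ?thesis using block_chain_block_uniform[OF _ bx D] by blast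
  qed
qed

text \<open>Equal consecutive flags would create twins, that is a module with two elements. It
  misses \<open>v\<close>, so it is not all of \<open>S\<close>.\<close>

lemma chain_alternates:
  assumes S: "simple_graph S E" and tm: "\<And>M. is_module S E M \<Longrightarrow> M = {} \<or> (\<exists>x. M = {x}) \<or> M = S"
    and ch: "chain E v xs" and SU: "S = insert v (fst ` set xs) \<union> Q"
    and un: "\<And>x y. x \<in> fst ` set xs \<Longrightarrow> y \<in> Q \<Longrightarrow> ((x, y) \<in> E) = b"
  shows "successively (\<lambda>p q. snd p \<noteq> snd q) xs"
proof (rule ccontr)
  assume "\<not> ?thesis"
  then obtain i where i: "Suc i < length xs" "snd (xs ! i) = snd (xs ! Suc i)"
    by (auto simp: successively_conv_nth)
  let ?x = "fst (xs ! i)" and ?y = "fst (xs ! Suc i)"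
  have E: "sym E" using S by (simp add: simple_graph_def)
  have d: "distinct (map fst xs)" "v \<notin> fst ` set xs" using chain_distinct[OF ch] by auto
  have xy: "?x \<in> fst ` set xs" "?y \<in> fst ` set xs" using i by auto
  have "?x \<noteq> ?y"
    using d(1) i by (metis Suc_lessD length_map n_not_Suc_n nth_eq_iff_index_eq nth_map)
  have "is_module S E {?x, ?y}"
  proof (rule is_moduleI)
    show "E \<subseteq> S \<times> S" "{?x, ?y} \<subseteq> S" using S xy SU by (auto simp: simple_graph_def)
    fix z assume z: "z \<in> S - {?x, ?y}"
    have "((?x, z) \<in> E) = ((?y, z) \<in> E)"
    proof (cases "z \<in> Q")
      case True
      then show ?thesis using un xy by simp
    next
      case False
      then show ?thesis using chain_twins[OF E ch i] z SU by blast
    qed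
    then show "\<exists>b. \<forall>x\<in>{?x, ?y}. ((x, z) \<in> E) = b" by auto
  qed
  then have "{?x, ?y} = S" using tm[of "{?x, ?y}"] \<open>?x \<noteq> ?y\<close> by (auto simp: doubleton_eq_iff)
  moreover have "v \<noteq> ?x" "v \<noteq> ?y" using xy d by auto
  ultimately show False using SU by auto
qed

theorem polar_cat_if_cycle_structure:
  assumes S: "simple_graph S E" and tm: "\<And>M. is_module S E M \<Longrightarrow> M = {} \<or> (\<exists>x. M = {x}) \<or> M = S"
    and free: "split_free S E"
    and bx: "block_chain E M xs" and bys: "block_chain E M ys" and SU: "S = M \<union> blocks xs \<union> blocks ys"
    and dj: "blocks xs \<inter> blocks ys = {}" and un: "uniform E (blocks xs) (blocks ys) b"
    and ne: "blocks xs \<noteq> {}" "blocks ys \<noteq> {}"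
  shows "polar_cat S E"
proof -
  have E: "sym E" "E \<subseteq> S \<times> S" "finite S" using S by (auto simp: simple_graph_def)
  have s: "((p, q) \<in> E) = ((q, p) \<in> E)" for p q using E(1) by (auto dest: symD)
  have dM: "blocks xs \<inter> M = {}" "blocks ys \<inter> M = {}" using block_chain_disjoint bx bys by metis+
  have u1: "((x, y) \<in> E) = b" if "x \<in> blocks xs" "y \<in> blocks ys" for x y
    using un that by (simp add: uniform_def)
  have u2: "((y, x) \<in> E) = b" if "x \<in> blocks xs" "y \<in> blocks ys" for x y
    using u1[OF that] s by simp
  \<comment> \<open>Without a core the two sides would be a uniform split of
    \<open>S\<close>.\<close>
  have "M \<noteq> {}"
  proof
    assume "M = {}"
    then have "blocks xs \<union> blocks ys = S" using SU by auto
    then show False using free un dj ne unfolding split_free_def by blast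
  qed
  moreover have "M \<noteq> S" using SU dM ne by auto
  moreover have "is_module S E M"
  proof (rule is_moduleI)
    show "E \<subseteq> S \<times> S" "M \<subseteq> S" using E SU by auto
    fix z assume z: "z \<in> S - M"
    then have "z \<in> blocks xs \<or> z \<in> blocks ys" using SU by auto
    then show "\<exists>b. \<forall>x\<in>M. ((x, z) \<in> E) = b"
      using block_chain_core_uniform[OF bx, of z] block_chain_core_uniform[OF bys, of z] s by auto
  qed
  ultimately obtain v where M: "M = {v}" using tm by blast
  \<comment> \<open>A module inside one side misses the core \<open>v\<close> and so is not
    \<open>S\<close>; being trivial, it has at most one element.\<close>
  have bm: "D = {} \<or> (\<exists>x. D = {x})" if "is_module S E D" "D \<subseteq> blocks xs \<or> D \<subseteq> blocks ys" for D
    using tm[OF that(1)] that(2) SU M dM by blast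
  obtain xs' where xs': "chain E v xs'" "fst ` set xs' = blocks xs"
    using block_chain_to_chain[of E v xs] bx M block_is_module[OF S bx SU u1] block_subset bm by metis
  have SU2: "S = M \<union> blocks ys \<union> blocks xs" using SU by auto
  obtain ys' where ys': "chain E v ys'" "fst ` set ys' = blocks ys"
    using block_chain_to_chain[of E v ys] bys M block_is_module[OF S bys SU2 u2] block_subset bm by metis
  have nx: "xs' \<noteq> []" "ys' \<noteq> []" using xs' ys' ne by auto
  have SX: "S = insert v (fst ` set xs') \<union> blocks ys" "S = insert v (fst ` set ys') \<union> blocks xs"
    using SU M xs' ys' by auto
  have alt: "successively (\<lambda>p q. snd p \<noteq> snd q) xs'" "successively (\<lambda>p q. snd p \<noteq> snd q) ys'"
    using chain_alternates[OF S tm xs'(1) SX(1), of b] chain_alternates[OF S tm ys'(1) SX(2), of b]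
      u1 u2 xs'(2) ys'(2) by auto
  \<comment> \<open>A head with flag \<open>b\<close> would meet its own chain and the opposite side
    alike, and could be split off from \<open>S\<close>.\<close>
  have hdne: "snd (hd zs) \<noteq> b"
    if z: "chain E v zs" "zs \<noteq> []" "S = insert v (fst ` set zs) \<union> Q" "Q \<inter> fst ` set zs = {}"
      "\<And>x y. x \<in> fst ` set zs \<Longrightarrow> y \<in> Q \<Longrightarrow> ((x, y) \<in> E) = b" for zs Q
  proof
    assume hb: "snd (hd zs) = b"
    obtain x zs' where zs: "zs = (x, b) # zs'" using z(2) hb by (cases zs) auto
    have "uniform E {x} (S - {x}) b" using z(1,3,5) zs by (auto simp: uniform_def)
    moreover have "{x} \<union> (S - {x}) = S" using z(3) zs by auto
    moreover have "v \<in> S - {x}" using z(1,3) zs by auto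
    ultimately show False using free unfolding split_free_def
      by (metis Diff_disjoint empty_iff insert_not_empty)
  qed
  have hd: "snd (hd xs') \<noteq> b" "snd (hd ys') \<noteq> b"
    using hdne[OF xs'(1) nx(1) SX(1)] hdne[OF ys'(1) nx(2) SX(2)] dj u1 u2 xs'(2) ys'(2) by auto
  have dist: "distinct (map fst xs')" "distinct (map fst ys')" "v \<notin> fst ` set xs'" "v \<notin> fst ` set ys'"
    using chain_distinct[OF xs'(1)] chain_distinct[OF ys'(1)] by auto
  have "card (blocks xs) = length xs'" "card (blocks ys) = length ys'"
    using distinct_card[OF dist(1)] distinct_card[OF dist(2)] xs' ys' by simp_all
  moreover have "card S = Suc (card (blocks xs) + card (blocks ys))"
  proof -
    have f: "finite (blocks xs)" "finite (blocks ys)" using E(3) SU by auto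
    have "card S = card (insert v (blocks xs \<union> blocks ys))" using SU M by (simp add: insert_commute)
    also have "\<dots> = Suc (card (blocks xs \<union> blocks ys))" using f dM M by (intro card_insert_disjoint) auto
    finally show ?thesis using f dj by (simp add: card_Un_disjoint)
  qed
  \<comment> \<open>This excludes graphs on three vertices: both head flags differ from
    \<open>b\<close>, so they agree, and the two heads form a module.\<close>
  moreover have "\<not> (length xs' = 1 \<and> length ys' = 1)"
  proof
    assume l: "length xs' = 1 \<and> length ys' = 1"
    obtain x c where x: "xs' = [(x, c)]" using l by (cases xs') auto
    obtain y d where y: "ys' = [(y, d)]" using l by (cases ys') auto
    have cd: "c = d" using hd x y by auto
    have S3: "S = {v, x, y}" using SX(1) ys'(2) x y by auto
    have "is_module S E {x, y}"
    proof (rule is_moduleI)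
      show "E \<subseteq> S \<times> S" "{x, y} \<subseteq> S" using E S3 by auto
      fix z assume "z \<in> S - {x, y}"
      then have "z = v" using S3 by auto
      then show "\<exists>b. \<forall>w\<in>{x, y}. ((w, z) \<in> E) = b"
        using xs'(1) ys'(1) x y cd by (auto simp: uniform_def)
    qed
    moreover have "x \<noteq> y" using dj xs'(2) ys'(2) x y by auto
    moreover have "v \<noteq> x" "v \<noteq> y" using dist x y by auto
    ultimately show False using tm[of "{x, y}"] S3 by (auto simp: doubleton_eq_iff)
  qed
  ultimately have "card S \<ge> 4" using nx by (cases xs'; cases ys'; auto simp: Suc_le_eq)
  then show ?thesis
    using polar_cat_if_chains[OF S xs'(1) ys'(1) _ _ _ nx hd alt, of] SU M xs'(2) ys'(2) dj un by auto
qed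

section \<open>Maximal strong modules\<close>

lemma is_module_iff:
  "is_module V E M \<longleftrightarrow> M \<subseteq> V \<and> (\<forall>x\<in>M. \<forall>y\<in>M. \<forall>z. z \<notin> M \<longrightarrow> ((x, z) \<in> E) = ((y, z) \<in> E))"
  unfolding is_module_def nbh_def by blast

lemma is_moduleD:
  assumes "is_module V E M" "x \<in> M" "y \<in> M" "z \<notin> M"
  shows "((x, z) \<in> E) = ((y, z) \<in> E)"
  using assms unfolding is_module_iff by blast

lemma is_module_Un:
  assumes "is_module V E A" "is_module V E B" "A \<inter> B \<noteq> {}"
  shows "is_module V E (A \<union> B)"
proof -
  obtain c where c: "c \<in> A" "c \<in> B" using assms(3) by auto
  have "((x, z) \<in> E) = ((c, z) \<in> E)" if "x \<in> A \<union> B" "z \<notin> A \<union> B" for x z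
    using that is_moduleD[OF assms(1), of x c z] is_moduleD[OF assms(2), of x c z] c by auto
  then have "((x, z) \<in> E) = ((y, z) \<in> E)" if "x \<in> A \<union> B" "y \<in> A \<union> B" "z \<notin> A \<union> B" for x y z
    using that by metis
  moreover have "A \<union> B \<subseteq> V" using assms(1,2) by (simp add: is_module_def)
  ultimately show ?thesis unfolding is_module_iff by (intro conjI ballI allI impI)
qed

lemma induced_simple_graph:
  assumes "simple_graph V E" "M \<subseteq> V"
  shows "simple_graph M (induced E M)"
  using assms by (auto simp: simple_graph_def induced_def sym_def intro: finite_subset)

lemma finite_modules: "simple_graph V E \<Longrightarrow> finite {M. is_module V E M}"
  by (rule finite_subset[of _ "Pow V"]) (auto simp: is_module_def simple_graph_def)

text \<open>\<open>V - A\<close> lies in \<open>B\<close>. For \<open>z\<close> outside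
  \<open>A\<close> and \<open>x\<close> in \<open>A\<close>, the module \<open>A\<close> allows
  replacing \<open>x\<close> by an \<open>a\<close> outside \<open>B\<close>; then the module
  \<open>B\<close> allows replacing \<open>z\<close> by a common element \<open>c\<close>. Every
  such pair behaves like the fixed pair \<open>c\<close>, \<open>a\<close>.\<close>

lemma overlapping_modules_uniform:
  assumes E: "sym E" and A: "is_module V E A" and B: "is_module V E B" and AB: "A \<union> B = V" "A \<inter> B \<noteq> {}" "\<not> A \<subseteq> B"
  shows "\<exists>b. uniform E (V - A) A b"
proof -
  obtain c a where c: "c \<in> A" "c \<in> B" and a: "a \<in> A" "a \<notin> B" using AB by auto
  have s: "((p, q) \<in> E) = ((q, p) \<in> E)" for p q using E by (auto dest: symD)
  have "((z, x) \<in> E) = ((c, a) \<in> E)" if "z \<in> V - A" "x \<in> A" for z x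
  proof -
    have "((z, x) \<in> E) = ((z, a) \<in> E)" using is_moduleD[OF A that(2) a(1), of z] that s by auto
    also have "\<dots> = ((c, a) \<in> E)" using is_moduleD[OF B _ c(2) a(2), of z] that AB by auto
    finally show ?thesis .
  qed
  then show ?thesis by (auto simp: uniform_def)
qed

text \<open>Two overlapping modules would cover the graph and split it uniformly.\<close>
lemma maximal_module_strong:
  assumes S: "simple_graph V E" and free: "split_free V E" and A: "is_module V E A" "A \<noteq> V"
    and max: "\<And>B. is_module V E B \<Longrightarrow> B \<noteq> V \<Longrightarrow> A \<subseteq> B \<Longrightarrow> B = A"
  shows "strong_module V E A"
  unfolding strong_module_def
proof (intro conjI allI impI A(1))
  fix B assume B: "is_module V E B"
  show "A \<inter> B = A \<or> A \<inter> B = B \<or> A \<inter> B = {}"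
  proof (rule ccontr)
    assume n: "\<not> ?thesis"
    then have "is_module V E (A \<union> B)" using is_module_Un[OF A(1) B] by blast
    then have AB: "A \<union> B = V" using max[of "A \<union> B"] n by blast
    moreover have "sym E" using S by (simp add: simple_graph_def)
    ultimately obtain b where "uniform E (V - A) A b"
      using overlapping_modules_uniform[OF _ A(1) B] n by blast
    moreover have "(V - A) \<union> A = V" "(V - A) \<inter> A = {}" using A(1) by (auto simp: is_module_def)
    ultimately have "V - A = {} \<or> A = {}" using free unfolding split_free_def by blast
    then show False using n A AB by blast
  qed
qed

text \<open>With at least two vertices, singletons are proper strong modules; hence the maximal
  proper strong modules partition \<open>V\<close>.\<close>

locale nontrivial_graph =
  fixes V :: "'a set" and E :: "('a \<times> 'a) set"
  assumes simple: "simple_graph V E" and card_V: "card V \<ge> 2"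
begin

abbreviation "PP \<equiv> max_strong_modules V E"
abbreviation "QE \<equiv> quotient_edges E PP"

lemma fin: "finite V" and sym_E: "sym E" and E_subset: "E \<subseteq> V \<times> V" and irrefl_E: "(x, x) \<notin> E"
  using simple by (auto simp: simple_graph_def)

lemma strong_singleton:
  assumes "x \<in> V"
  shows "strong_module V E {x}"
proof -
  have "is_module V E {x}" using assms by (simp add: is_module_def)
  moreover have "{x} \<inter> M = {x} \<or> {x} \<inter> M = {}" for M by auto
  ultimately show ?thesis unfolding strong_module_def by metis
qed

lemma strong_in_max:
  assumes "strong_module V E M" "M \<noteq> V"
  shows "\<exists>P\<in>PP. M \<subseteq> P"
proof -
  let ?F = "{M. strong_module V E M \<and> M \<noteq> V}"
  have "finite ?F"
    by (rule finite_subset[OF _ finite_modules[OF simple]]) (auto simp: strong_module_def)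
  then obtain P where "P \<in> ?F" "M \<subseteq> P" "\<And>M'. M' \<in> ?F \<Longrightarrow> P \<subseteq> M' \<Longrightarrow> M' = P"
    using finite_has_maximal2[of ?F M] assms by auto
  then show ?thesis unfolding max_strong_modules_def by blast
qed

lemma PP_strong: "M \<in> PP \<Longrightarrow> strong_module V E M" and PP_proper: "M \<in> PP \<Longrightarrow> M \<noteq> V"
  by (simp_all add: max_strong_modules_def)

lemma PP_module: "M \<in> PP \<Longrightarrow> is_module V E M"
  using PP_strong by (simp add: strong_module_def)

lemma PP_subset: "M \<in> PP \<Longrightarrow> M \<subseteq> V"
  using PP_module by (simp add: is_module_def)

lemma singleton_proper: "{x} \<noteq> V" using card_V by auto

lemma PP_cover: "\<Union>PP = V"
  using strong_in_max[OF strong_singleton singleton_proper] PP_subset by blast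

text \<open>The empty set lies in a singleton, which is a larger proper strong module, so it is not
  maximal.\<close>

lemma PP_nonempty: "M \<in> PP \<Longrightarrow> M \<noteq> {}"
proof
  assume M: "M \<in> PP" "M = {}"
  have "V \<noteq> {}" using card_V by auto
  then obtain x where "x \<in> V" by blast
  then have "strong_module V E {x}" by (rule strong_singleton)
  then have "{x} = M" using M singleton_proper[of x] unfolding max_strong_modules_def by blast
  then show False using M by auto
qed

lemma PP_maximal: "M \<in> PP \<Longrightarrow> strong_module V E M' \<Longrightarrow> M' \<noteq> V \<Longrightarrow> M \<subseteq> M' \<Longrightarrow> M' = M"
  by (simp add: max_strong_modules_def)

lemma PP_eq: "M1 \<in> PP \<Longrightarrow> M2 \<in> PP \<Longrightarrow> x \<in> M1 \<Longrightarrow> x \<in> M2 \<Longrightarrow> M1 = M2"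
proof -
  assume M: "M1 \<in> PP" "M2 \<in> PP" and x: "x \<in> M1" "x \<in> M2"
  have "M1 \<inter> M2 = M1 \<or> M1 \<inter> M2 = M2"
    using PP_strong[OF M(1)] PP_module[OF M(2)] x unfolding strong_module_def by blast
  then have "M1 \<subseteq> M2 \<or> M2 \<subseteq> M1" by blast
  then show ?thesis
    using PP_maximal[OF M(1) PP_strong[OF M(2)] PP_proper[OF M(2)]]
      PP_maximal[OF M(2) PP_strong[OF M(1)] PP_proper[OF M(1)]] by auto
qed

lemma finite_PP: "finite PP"
  by (rule finite_subset[OF _ finite_modules[OF simple]]) (auto simp: max_strong_modules_def strong_module_def)

text \<open>Moving one end at a time inside its module preserves adjacency, so any pair of
  representatives decides.\<close>

lemma quotient_edge_iff:
  assumes M: "M1 \<in> PP" "M2 \<in> PP" "M1 \<noteq> M2" and ab: "a \<in> M1" "b \<in> M2"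
  shows "(M1, M2) \<in> QE \<longleftrightarrow> (a, b) \<in> E"
proof -
  have s: "((p, q) \<in> E) = ((q, p) \<in> E)" for p q using sym_E by (auto dest: symD)
  have "((c, d) \<in> E) = ((a, b) \<in> E)" if cd: "c \<in> M1" "d \<in> M2" for c d
  proof -
    have n: "d \<notin> M1" "a \<notin> M2" using PP_eq M cd ab by blast+
    have "((c, d) \<in> E) = ((a, d) \<in> E)" using is_moduleD[OF PP_module[OF M(1)] cd(1) ab(1) n(1)] .
    also have "\<dots> = ((a, b) \<in> E)" using is_moduleD[OF PP_module[OF M(2)] cd(2) ab(2) n(2)] s by simp
    finally show ?thesis .
  qed
  moreover have "(M1, M2) \<in> QE \<longleftrightarrow> (\<forall>c\<in>M1. \<forall>d\<in>M2. (c, d) \<in> E)"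
    using M by (simp add: quotient_edges_def)
  ultimately show ?thesis using ab by blast
qed

lemma quotient_simple: "simple_graph PP QE"
proof -
  have "sym QE"
  proof (rule symI)
    fix M1 M2 assume "(M1, M2) \<in> QE"
    then show "(M2, M1) \<in> QE" using sym_E by (auto simp: quotient_edges_def dest: symD)
  qed
  then show ?thesis using finite_PP by (auto simp: simple_graph_def quotient_edges_def)
qed

lemma card_PP: "card PP \<ge> 2"
proof -
  have "V \<noteq> {}" using card_V by auto
  then obtain M where M: "M \<in> PP" using PP_cover by blast
  then obtain x where "x \<in> V" "x \<notin> M" using PP_proper PP_subset by blast
  then obtain M' where M': "M' \<in> PP" "M' \<noteq> M" using PP_cover by blast
  then have "card {M, M'} \<le> card PP" using M finite_PP by (intro card_mono) auto
  then show ?thesis using M' by simp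
qed

lemma quotient_split_free:
  assumes "split_free V E"
  shows "split_free PP QE"
  unfolding split_free_def
proof (intro allI impI)
  fix A B b assume a: "A \<union> B = PP \<and> A \<inter> B = {} \<and> uniform QE A B b"
  have "uniform E (\<Union>A) (\<Union>B) b" unfolding uniform_def
  proof (intro ballI)
    fix x y assume "x \<in> \<Union>A" "y \<in> \<Union>B"
    then obtain M1 M2 where M: "M1 \<in> A" "M2 \<in> B" "x \<in> M1" "y \<in> M2" by blast
    then have "M1 \<in> PP" "M2 \<in> PP" "M1 \<noteq> M2" using a by auto
    then show "((x, y) \<in> E) = b" using quotient_edge_iff[of M1 M2 x y] M a by (auto simp: uniform_def)
  qed
  moreover have "\<Union>A \<union> \<Union>B = V" using a PP_cover by (metis Union_Un_distrib)
  moreover have "\<Union>A \<inter> \<Union>B = {}" using a PP_eq by blast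
  ultimately have "\<Union>A = {} \<or> \<Union>B = {}"
    using assms[unfolded split_free_def, rule_format, of "\<Union>A" "\<Union>B" b] by simp
  moreover have "C = {}" if "\<Union>C = {}" "C \<subseteq> PP" for C
    using that PP_nonempty by (metis Union_empty_conv equals0I subsetD)
  ultimately show "A = {} \<or> B = {}" using a by (metis Un_upper1 Un_upper2)
qed

text \<open>The union of a nontrivial module of the quotient is a proper module of \<open>V\<close>.
  It extends to a maximal proper module, which is strong because \<open>V\<close> is
  \<open>split_free\<close>, and so lies inside a single part. Yet the union contains two different
  parts.\<close>

theorem quotient_modules_trivial:
  assumes free: "split_free V E" and MM: "is_module PP QE MM"
  shows "MM = {} \<or> (\<exists>M. MM = {M}) \<or> MM = PP"
proof (rule ccontr)
  assume n: "\<not> ?thesis"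
  have sub: "MM \<subseteq> PP" using MM by (simp add: is_module_def)
  let ?U = "\<Union>MM"
  obtain M0 where M0: "M0 \<in> PP" "M0 \<notin> MM" using n sub by blast
  obtain M1 where M1: "M1 \<in> MM" using n by blast
  obtain M2 where M2: "M2 \<in> MM" "M2 \<noteq> M1" using n M1 by blast
  have "is_module V E ?U"
  proof (rule is_moduleI[OF E_subset])
    show "?U \<subseteq> V" using sub PP_subset by blast
    fix z assume z: "z \<in> V - ?U"
    then obtain M3 where M3: "M3 \<in> PP" "z \<in> M3" "M3 \<notin> MM" using PP_cover by blast
    have "((x, z) \<in> E) = ((M1, M3) \<in> QE)" if x: "x \<in> ?U" for x
    proof -
      obtain M where M: "M \<in> MM" "x \<in> M" using x by blast
      have "((M, M3) \<in> QE) = ((x, z) \<in> E)"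
        by (rule quotient_edge_iff) (use M M3 sub in auto)
      then show ?thesis using is_moduleD[OF MM M(1) M1 M3(3)] by simp
    qed
    then show "\<exists>b. \<forall>x\<in>?U. ((x, z) \<in> E) = b" by blast
  qed
  moreover have "?U \<noteq> V"
  proof
    assume U: "?U = V"
    obtain x where "x \<in> M0" using PP_nonempty M0 by blast
    moreover then have "x \<in> ?U" using U PP_subset M0 by blast
    ultimately show False using PP_eq M0 sub by blast
  qed
  moreover let ?F = "{A. is_module V E A \<and> A \<noteq> V}"
  have "finite ?F" by (rule finite_subset[OF _ finite_modules[OF simple]]) auto
  ultimately have "\<exists>A\<in>?F. ?U \<subseteq> A \<and> (\<forall>B\<in>?F. A \<subseteq> B \<longrightarrow> A = B)"
    by (intro finite_has_maximal2) simp_all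
  then obtain A where A: "A \<in> ?F" "?U \<subseteq> A" "\<And>B. B \<in> ?F \<Longrightarrow> A \<subseteq> B \<Longrightarrow> A = B"
    by (elim bexE conjE) simp
  have "strong_module V E A"
    by (rule maximal_module_strong[OF simple free]) (use A(1) A(3)[symmetric] in auto)
  then obtain P where P: "P \<in> PP" "A \<subseteq> P" using strong_in_max A(1) by blast
  have "M = P" if "M \<in> MM" for M
  proof -
    have "M \<in> PP" using that sub by auto
    moreover then obtain x where "x \<in> M" using PP_nonempty by blast
    moreover then have "x \<in> P" using that A(2) P(2) by blast
    ultimately show ?thesis using PP_eq P(1) by blast
  qed
  then show False using M1 M2 by metis
qed

end

text \<open>Adjacency of parts equals adjacency of chosen representatives. The quotient is thus read
  off the leaves of the representatives in the given network, to which the cycle structure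
  applies.\<close>

theorem explainable_imp_polarcat_prime:
  assumes S: "simple_graph V E" and ex: "explainable_level1 V E"
  shows "polarcat_prime V E"
  unfolding polarcat_prime_def
proof (intro allI impI, elim conjE)
  fix M assume M: "prime_module V E M" and c: "card M \<ge> 2"
  obtain VN :: "nat set" and A X t f where N: "is_network VN A X" "level1 VN A X"
    and f: "graph_iso f V E X (net_graph_edges VN A X t)"
    using ex unfolding explainable_level1_def by blast
  interpret N: level1_network VN A X using N by unfold_locales
  let ?E = "induced E M"
  have MV: "M \<subseteq> V" using M by (simp add: prime_module_def strong_module_def is_module_def)
  have SM: "simple_graph M ?E" using induced_simple_graph[OF S MV] .
  interpret G: nontrivial_graph M ?E using SM c by unfold_locales
  have free: "split_free M ?E"
    using split_free_iff_connected[OF SM] M unfolding prime_module_def connected_graph_def by blast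
  let ?P = "max_strong_modules M ?E" and ?Q = "quotient_edges ?E (max_strong_modules M ?E)"
  define r where "r = (\<lambda>m :: 'a set. SOME x. x \<in> m)"
  have r: "r m \<in> m" if "m \<in> ?P" for m
    using G.PP_nonempty[OF that] unfolding r_def by (simp add: some_in_eq)
  have rV: "r m \<in> M" "r m \<in> V" if "m \<in> ?P" for m using r[OF that] G.PP_subset[OF that] MV by auto
  have bij: "bij_betw f V X" using f by (simp add: graph_iso_def)
  have inj: "inj_on (f \<circ> r) ?P"
  proof (rule inj_onI)
    fix m1 m2 assume m: "m1 \<in> ?P" "m2 \<in> ?P" "(f \<circ> r) m1 = (f \<circ> r) m2"
    then have "r m1 = r m2" using bij rV by (auto simp: bij_betw_def dest: inj_onD)
    then show "m1 = m2" using r[OF m(1)] r[OF m(2)] G.PP_eq[OF m(1,2)] by simp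
  qed
  have im: "(f \<circ> r) ` ?P \<subseteq> X" using bij rV by (auto simp: bij_betw_def)
  have edge: "(m1, m2) \<in> ?Q \<longleftrightarrow> t (lca VN A ((f \<circ> r) m1) ((f \<circ> r) m2)) = L1"
    if m: "m1 \<in> ?P" "m2 \<in> ?P" "m1 \<noteq> m2" for m1 m2
  proof -
    have ne: "f (r m1) \<noteq> f (r m2)" using inj_onD[OF inj, of m1 m2] m by auto
    have "(m1, m2) \<in> ?Q \<longleftrightarrow> (r m1, r m2) \<in> ?E"
      using G.quotient_edge_iff[OF m r r] m by simp
    also have "\<dots> \<longleftrightarrow> (r m1, r m2) \<in> E" using rV m by (simp add: induced_def)
    also have "\<dots> \<longleftrightarrow> (f (r m1), f (r m2)) \<in> net_graph_edges VN A X t"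
      using f rV m by (simp add: graph_iso_def)
    also have "\<dots> \<longleftrightarrow> t (lca VN A (f (r m1)) (f (r m2))) = L1"
      using im m ne by (auto simp: net_graph_edges_def)
    finally show ?thesis by simp
  qed
  obtain M0 xs ys b where st: "block_chain ?Q M0 xs" "block_chain ?Q M0 ys" "?P = M0 \<union> blocks xs \<union> blocks ys"
    "blocks xs \<inter> blocks ys = {}" "uniform ?Q (blocks xs) (blocks ys) b" "blocks xs \<noteq> {}" "blocks ys \<noteq> {}"
    using N.split_free_cycle_structure[OF im inj G.card_PP edge G.quotient_split_free[OF free]] by blast
  show "polar_cat ?P ?Q"
    by (rule polar_cat_if_cycle_structure[OF G.quotient_simple G.quotient_modules_trivial[OF free]
          G.quotient_split_free[OF free] st])
qed

section \<open>Tools for constructing networks\<close>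

lemma is_lca_minimalI:
  assumes "w \<in> VN" "(w, a) \<in> A\<^sup>*" "(w, b) \<in> A\<^sup>*"
    "\<And>z. (z, a) \<in> A\<^sup>* \<Longrightarrow> (z, b) \<in> A\<^sup>* \<Longrightarrow> (w, z) \<in> A\<^sup>* \<Longrightarrow> z = w"
  shows "is_lca VN A a b w"
  using assms by (simp add: is_lca_def)

lemma level1I:
  assumes "\<And>S h1 h2. biconnected_set VN A S \<Longrightarrow> h1 \<in> S \<Longrightarrow> h2 \<in> S \<Longrightarrow>
    hybrid_vertex VN A X h1 \<Longrightarrow> hybrid_vertex VN A X h2 \<Longrightarrow> h1 = h2"
  shows "level1 VN A X"
  unfolding level1_def
proof (intro allI impI)
  fix S assume "biconnected_component VN A S"
  then have S: "biconnected_set VN A S" by (simp add: biconnected_component_def)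
  then have "finite {h \<in> S. hybrid_vertex VN A X h}" by (simp add: biconnected_set_def)
  then show "card {h \<in> S. hybrid_vertex VN A X h} \<le> 1"
    using assms[OF S] by (auto simp: card_le_Suc0_iff_eq)
qed

lemma (in level1_network) is_lca_exists:
  assumes "a \<in> VN" "b \<in> VN"
  shows "\<exists>w. is_lca VN A a b w"
proof -
  obtain \<rho> where \<rho>: "\<rho> \<in> VN" "\<forall>v\<in>VN. (\<rho>, v) \<in> A\<^sup>*" using root_reaches by blast
  let ?F = "{w \<in> VN. (w, a) \<in> A\<^sup>* \<and> (w, b) \<in> A\<^sup>*}"
  have "wf (A\<inverse>)" using finite_A acyclic by (rule finite_acyclic_wf_converse)
  moreover have "\<rho> \<in> ?F" using \<rho> assms by simp
  ultimately obtain w where w: "w \<in> ?F" "\<And>c. (c, w) \<in> A\<inverse> \<Longrightarrow> c \<notin> ?F"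
    by (rule wfE_min) blast
  have "is_lca VN A a b w"
  proof (rule is_lcaI)
    fix c assume "(w, c) \<in> A" "(c, a) \<in> A\<^sup>*" "(c, b) \<in> A\<^sup>*"
    then show False using w(2)[of c] arcs by auto
  qed (use w in auto)
  then show ?thesis ..
qed

text \<open>The case of \<open>is_network\<close> with arcs, with the root as a parameter: renaming
  and gluing have to say which vertex is the new root.\<close>

definition network_root :: "'v set \<Rightarrow> ('v \<times> 'v) set \<Rightarrow> 'v set \<Rightarrow> 'v \<Rightarrow> bool" where
  "network_root VN A X \<rho> \<longleftrightarrow> \<rho> \<in> VN \<and> indeg A \<rho> = 0 \<and> outdeg A \<rho> \<ge> 2 \<and> (\<forall>u\<in>VN. indeg A u = 0 \<longrightarrow> u = \<rho>) \<and>
    (\<forall>v\<in>VN. v \<in> X \<longleftrightarrow> outdeg A v = 0 \<and> indeg A v = 1) \<and>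
    (\<forall>v\<in>VN - (X \<union> {\<rho>}). (indeg A v = 1 \<and> outdeg A v \<ge> 2) \<or> (indeg A v = 2 \<and> outdeg A v \<ge> 1))"

lemma network_rootD:
  assumes "network_root VN A X \<rho>"
  shows "\<rho> \<in> VN" "indeg A \<rho> = 0" "outdeg A \<rho> \<ge> 2" "\<And>u. u \<in> VN \<Longrightarrow> indeg A u = 0 \<Longrightarrow> u = \<rho>"
    "\<And>v. v \<in> VN \<Longrightarrow> v \<in> X \<longleftrightarrow> outdeg A v = 0 \<and> indeg A v = 1"
    "\<And>v. v \<in> VN \<Longrightarrow> v \<notin> X \<Longrightarrow> v \<noteq> \<rho> \<Longrightarrow> (indeg A v = 1 \<and> outdeg A v \<ge> 2) \<or> (indeg A v = 2 \<and> outdeg A v \<ge> 1)"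
  using assms unfolding network_root_def by blast+

lemma (in level1_network) network_root_exists:
  assumes "A \<noteq> {}"
  shows "\<exists>\<rho>. network_root VN A X \<rho>"
  using network assms unfolding is_network_def network_root_def by blast

lemma (in level1_network) no_arcs:
  assumes "A = {}"
  shows "\<exists>x. VN = {x} \<and> X = {x}"
proof -
  have "\<not> 2 \<le> outdeg {} v" for v :: 'v by (simp add: outdeg_def)
  then show ?thesis using network unfolding is_network_def assms by blast
qed

lemma networkI:
  assumes "finite VN" "A \<subseteq> VN \<times> VN" "acyclic A" "X \<subseteq> VN"
    and "\<rho> \<in> VN" "indeg A \<rho> = 0" "outdeg A \<rho> \<ge> 2" "\<And>u. u \<in> VN \<Longrightarrow> indeg A u = 0 \<Longrightarrow> u = \<rho>"
    "\<And>v. v \<in> VN \<Longrightarrow> v \<in> X \<longleftrightarrow> outdeg A v = 0 \<and> indeg A v = 1"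
    "\<And>v. v \<in> VN \<Longrightarrow> v \<notin> X \<Longrightarrow> v \<noteq> \<rho> \<Longrightarrow> (indeg A v = 1 \<and> outdeg A v \<ge> 2) \<or> (indeg A v = 2 \<and> outdeg A v \<ge> 1)"
  shows "is_network VN A X"
proof -
  have "\<forall>u\<in>VN. indeg A u = 0 \<longrightarrow> u = \<rho>" by (intro ballI impI assms(8))
  moreover have "\<forall>v\<in>VN. v \<in> X \<longleftrightarrow> outdeg A v = 0 \<and> indeg A v = 1" by (intro ballI assms(9))
  moreover have "\<forall>v\<in>VN - (X \<union> {\<rho>}). (indeg A v = 1 \<and> outdeg A v \<ge> 2) \<or> (indeg A v = 2 \<and> outdeg A v \<ge> 1)"
    by (intro ballI assms(10)) auto
  ultimately show ?thesis unfolding is_network_def using assms(1-7) by blast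
qed

lemma acyclicI_step:
  assumes "\<And>a c. (a, c) \<in> A \<Longrightarrow> (c, a) \<in> A\<^sup>* \<Longrightarrow> False"
  shows "acyclic A"
  unfolding acyclic_def using assms by (meson tranclD)

section \<open>Renaming\<close>

lemma rtrancl_image_iff:
  assumes "inj h"
  shows "(h a, v) \<in> (map_prod h h ` R)\<^sup>* \<longleftrightarrow> (\<exists>b. v = h b \<and> (a, b) \<in> R\<^sup>*)"
proof
  show "\<exists>b. v = h b \<and> (a, b) \<in> R\<^sup>*" if "(h a, v) \<in> (map_prod h h ` R)\<^sup>*"
    using that
  proof (induction rule: rtrancl_induct)
    case (step y z)
    then obtain b where b: "y = h b" "(a, b) \<in> R\<^sup>*" by blast
    obtain c d where cd: "(c, d) \<in> R" "y = h c" "z = h d" using step(2) by auto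
    have "b = c" using b cd assms by (auto dest: injD)
    then show ?case using b cd by (blast intro: rtrancl_into_rtrancl)
  qed blast
next
  assume "\<exists>b. v = h b \<and> (a, b) \<in> R\<^sup>*"
  then obtain b where b: "v = h b" "(a, b) \<in> R\<^sup>*" by blast
  have "(h a, h b) \<in> (map_prod h h ` R)\<^sup>*" using b(2)
  proof (induction rule: rtrancl_induct)
    case (step y z)
    have "(h y, h z) \<in> map_prod h h ` R" using step(2) by (metis imageI map_prod_simp)
    then show ?case using step(3) by (meson rtrancl_into_rtrancl)
  qed simp
  then show "(h a, v) \<in> (map_prod h h ` R)\<^sup>*" using b by simp
qed

lemma rtrancl_image_iff':
  "inj h \<Longrightarrow> (h a, h b) \<in> (map_prod h h ` R)\<^sup>* \<longleftrightarrow> (a, b) \<in> R\<^sup>*"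
  using rtrancl_image_iff[of h a "h b" R] by (auto dest: injD)

lemma connected_on_image:
  assumes "inj h"
  shows "connected_on (h ` S) (map_prod h h ` R) \<longleftrightarrow> connected_on S R"
proof -
  have "map_prod h h ` R \<inter> (h ` S \<times> h ` S) = map_prod h h ` (R \<inter> (S \<times> S))"
    by (auto simp: inj_eq[OF assms])
  then show ?thesis by (simp add: connected_on_def rtrancl_image_iff'[OF assms])
qed

text \<open>Serves two purposes: moving networks with symbolic vertices into the natural numbers,
  and making two networks disjoint up to one vertex before they are glued.\<close>

locale renaming = level1_network VN A X for VN :: "'v set" and A X +
  fixes h :: "'v \<Rightarrow> 'w"
  assumes inj: "inj h"
begin

abbreviation "Ah \<equiv> map_prod h h ` A"

lemma indeg_h: "indeg Ah (h v) = indeg A v"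
proof -
  have "{u. (u, h v) \<in> Ah} = h ` {u. (u, v) \<in> A}" by (auto simp: inj_eq[OF inj])
  then show ?thesis unfolding indeg_def by (simp add: card_image[OF inj_on_subset[OF inj subset_UNIV]])
qed

lemma outdeg_h: "outdeg Ah (h v) = outdeg A v"
proof -
  have "{u. (h v, u) \<in> Ah} = h ` {u. (v, u) \<in> A}" by (auto simp: inj_eq[OF inj])
  then show ?thesis unfolding outdeg_def by (simp add: card_image[OF inj_on_subset[OF inj subset_UNIV]])
qed

lemma h_mem: "h v \<in> h ` S \<longleftrightarrow> v \<in> S" by (auto simp: inj_eq[OF inj])

lemma renamed_network: "is_network (h ` VN) Ah (h ` X)"
proof (cases "A = {}")
  case True
  obtain x where "VN = {x}" "X = {x}" using no_arcs[OF True] by blast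
  then show ?thesis using True by (simp add: is_network_def acyclic_def)
next
  case False
  obtain \<rho> where r: "network_root VN A X \<rho>" using network_root_exists[OF False] by blast
  note \<rho> = network_rootD[OF r]
  show ?thesis
  proof (rule networkI)
    show "finite (h ` VN)" using finite_VN by simp
    show "Ah \<subseteq> h ` VN \<times> h ` VN" using arcs by auto
    show "acyclic Ah"
    proof (rule acyclicI_step)
      fix a c assume ac: "(a, c) \<in> Ah" "(c, a) \<in> Ah\<^sup>*"
      then obtain a' c' where a': "a = h a'" "c = h c'" "(a', c') \<in> A" by auto
      then have "(c', a') \<in> A\<^sup>*" using ac(2) rtrancl_image_iff'[OF inj] by metis
      then show False using no_cycle a'(3) by blast
    qed
    show "h ` X \<subseteq> h ` VN" using leaves_subset by auto
    show "h \<rho> \<in> h ` VN" "indeg Ah (h \<rho>) = 0" "2 \<le> outdeg Ah (h \<rho>)"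
      using \<rho>(1-3) by (simp_all add: indeg_h outdeg_h)
    show "u = h \<rho>" if "u \<in> h ` VN" "indeg Ah u = 0" for u
    proof -
      obtain w where "u = h w" "w \<in> VN" using \<open>u \<in> h ` VN\<close> by auto
      then show ?thesis using \<open>indeg Ah u = 0\<close> \<rho>(4)[of w] by (simp add: indeg_h)
    qed
    show "(v \<in> h ` X) = (outdeg Ah v = 0 \<and> indeg Ah v = 1)" if "v \<in> h ` VN" for v
    proof -
      obtain w where "v = h w" "w \<in> VN" using \<open>v \<in> h ` VN\<close> by auto
      then show ?thesis using \<rho>(5)[of w] by (simp add: indeg_h outdeg_h h_mem)
    qed
    show "indeg Ah v = 1 \<and> 2 \<le> outdeg Ah v \<or> indeg Ah v = 2 \<and> 1 \<le> outdeg Ah v"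
      if v: "v \<in> h ` VN" "v \<notin> h ` X" "v \<noteq> h \<rho>" for v
    proof -
      obtain u where u: "u \<in> VN" "v = h u" using v by auto
      then have "u \<notin> X" "u \<noteq> \<rho>" using v by auto
      then show ?thesis using \<rho>(6)[OF u(1)] u(2) by (simp add: indeg_h outdeg_h)
    qed
  qed
qed

lemma renamed_level1: "level1 (h ` VN) Ah (h ` X)"
proof (rule level1I)
  fix S' h1 h2 assume S': "biconnected_set (h ` VN) Ah S'" and m: "h1 \<in> S'" "h2 \<in> S'"
    and hy: "hybrid_vertex (h ` VN) Ah (h ` X) h1" "hybrid_vertex (h ` VN) Ah (h ` X) h2"
  obtain S where S: "S' = h ` S" "S \<subseteq> VN" using S' by (auto simp: biconnected_set_def subset_image_iff)
  have und: "undirected Ah = map_prod h h ` undirected A" by (auto simp: undirected_def)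
  have "h ` S - {h w} = h ` (S - {w})" for w by (auto simp: inj_eq[OF inj])
  moreover have "card (h ` S) = card S" by (rule card_image[OF inj_on_subset[OF inj subset_UNIV]])
  ultimately have "biconnected_set VN A S" using S' S finite_subset[OF S(2) finite_VN]
    unfolding biconnected_set_def und by (simp add: connected_on_image[OF inj])
  moreover obtain a b where ab: "a \<in> S" "b \<in> S" "h1 = h a" "h2 = h b" using m S by auto
  moreover have "hybrid_vertex VN A X a" "hybrid_vertex VN A X b"
    using hy ab by (auto simp: hybrid_vertex_def indeg_h h_mem)
  ultimately show "h1 = h2" using one_hybrid by blast
qed

sublocale renamed: level1_network "h ` VN" Ah "h ` X"
  using renamed_network renamed_level1 by unfold_locales

lemma renamed_lca:
  assumes "a \<in> VN" "b \<in> VN"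
  shows "lca (h ` VN) Ah (h a) (h b) = h (lca VN A a b)"
proof -
  obtain w where w: "is_lca VN A a b w" using is_lca_exists assms by blast
  then have "is_lca (h ` VN) Ah (h a) (h b) (h w)"
    unfolding is_lca_def by (auto simp: rtrancl_image_iff'[OF inj])
  then show ?thesis using w lca_eqI renamed.lca_eqI by metis
qed

end

text \<open>\<open>explainable_level1\<close> fixes natural numbers as vertices. An injection
  transports the network there, and labels are read back through its inverse.\<close>

lemma explainable_if_network:
  fixes VN :: "'v set" and h :: "'v \<Rightarrow> nat"
  assumes N: "is_network VN A X" "level1 VN A X" and t: "labeling VN X t" and h: "inj h"
    and f: "bij_betw f V X"
    and e: "\<And>x y. x \<in> V \<Longrightarrow> y \<in> V \<Longrightarrow> x \<noteq> y \<Longrightarrow> (x, y) \<in> E \<longleftrightarrow> t (lca VN A (f x) (f y)) = L1"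
    and irr: "\<And>x. (x, x) \<notin> E"
  shows "explainable_level1 V E"
proof -
  interpret renaming VN A X h using N h by unfold_locales
  let ?t = "\<lambda>v. t (inv h v)"
  have inv: "inv h (h v) = v" for v using h by simp
  have "bij_betw h X (h ` X)" by (rule inj_on_imp_bij_betw[OF inj_on_subset[OF h subset_UNIV]])
  then have hf: "bij_betw (h \<circ> f) V (h ` X)" using f by (rule bij_betw_trans[rotated])
  have fX: "f x \<in> X" if "x \<in> V" for x using f that by (meson bij_betwE)
  have "graph_iso (h \<circ> f) V E (h ` X) (net_graph_edges (h ` VN) Ah (h ` X) ?t)"
    unfolding graph_iso_def
  proof (intro conjI hf ballI)
    fix x y assume xy: "x \<in> V" "y \<in> V"
    have m: "f x \<in> VN" "f y \<in> VN" using fX xy leaves_subset by auto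
    have ne: "h (f x) = h (f y) \<longleftrightarrow> x = y"
      using inj_onD[OF bij_betw_imp_inj_on[OF hf], of x y] xy by auto
    show "((x, y) \<in> E) = (((h \<circ> f) x, (h \<circ> f) y) \<in> net_graph_edges (h ` VN) Ah (h ` X) ?t)"
      using e[OF xy] irr fX[OF xy(1)] fX[OF xy(2)] renamed_lca[OF m] inv ne
      by (auto simp: net_graph_edges_def)
  qed
  moreover have "labeling (h ` VN) (h ` X) ?t" using t inv h_mem by (auto simp: labeling_def)
  ultimately show ?thesis unfolding explainable_level1_def using renamed_network renamed_level1 by blast
qed

section \<open>Gluing\<close>

text \<open>That \<open>x\<close> is the root of the second network is expressed by reachability,
  the form in which ancestors are compared; by acyclicity \<open>x\<close> then has no parent
  there.\<close>

locale gluing = N: level1_network VN A X + N': level1_network VN' A' X'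
  for VN :: "'v set" and A X VN' A' X' +
  fixes x :: 'v
  assumes x: "x \<in> X" and meet_x: "VN \<inter> VN' = {x}" and ne: "A \<noteq> {}" "A' \<noteq> {}"
    and x_root: "\<And>v. v \<in> VN' \<Longrightarrow> (x, v) \<in> A'\<^sup>*"
begin

abbreviation "W \<equiv> VN \<union> VN'"
abbreviation "B \<equiv> A \<union> A'"
abbreviation "Y \<equiv> X - {x} \<union> X'"

lemma x_mem: "x \<in> VN" "x \<in> VN'" and x_only: "v \<in> VN \<Longrightarrow> v \<in> VN' \<Longrightarrow> v = x"
  using meet_x by auto

lemma x_no_in: "(p, x) \<notin> A'"
proof
  assume p: "(p, x) \<in> A'"
  then have "p \<in> VN'" using N'.arcs by auto
  then show False using x_root N'.no_cycle p by blast
qed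

text \<open>The vertex \<open>x\<close> has no arc leaving it in \<open>A\<close> and no arc
  entering it in \<open>A'\<close>. Hence one end of an arc of \<open>B\<close> suffices to tell
  which network it comes from; this lemma and the next three are the four cases.\<close>

lemma arc_A': "(a, c) \<in> B \<Longrightarrow> a \<in> VN' \<Longrightarrow> (a, c) \<in> A'"
  using N.arcs x_only N.leaf_no_succ[OF x] by blast

lemma arc_A: "(a, c) \<in> B \<Longrightarrow> c \<in> VN \<Longrightarrow> (a, c) \<in> A"
  using N'.arcs x_only x_no_in by blast

lemma arc_A_out: "(a, c) \<in> B \<Longrightarrow> a \<notin> VN' \<Longrightarrow> (a, c) \<in> A"
  using N'.arcs by blast

lemma arc_A'_in: "(a, c) \<in> B \<Longrightarrow> c \<notin> VN \<Longrightarrow> (a, c) \<in> A'"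
  using N.arcs by blast

lemma reach_up: "(a, b) \<in> B\<^sup>* \<Longrightarrow> b \<in> VN \<Longrightarrow> b \<noteq> x \<Longrightarrow> (a, b) \<in> A\<^sup>* \<and> a \<in> VN \<and> a \<noteq> x"
proof (induction rule: converse_rtrancl_induct)
  case (step a c)
  then have c: "(c, b) \<in> A\<^sup>*" "c \<in> VN" "c \<noteq> x" by auto
  have ac: "(a, c) \<in> A" using arc_A[OF step(1) c(2)] .
  moreover have "a \<noteq> x" using ac N.leaf_no_succ[OF x] by auto
  ultimately show ?case using c N.arcs by (auto intro: converse_rtrancl_into_rtrancl)
qed simp

lemma reach_down: "(a, b) \<in> B\<^sup>* \<Longrightarrow> a \<in> VN' \<Longrightarrow> (a, b) \<in> A'\<^sup>* \<and> b \<in> VN'"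
proof (induction rule: rtrancl_induct)
  case (step b c)
  then have "(b, c) \<in> A'" using arc_A' by blast
  then show ?case using step N'.arcs by (auto intro: rtrancl_into_rtrancl)
qed simp

lemma reach_across: "(a, b) \<in> B\<^sup>* \<Longrightarrow> b \<in> VN' \<Longrightarrow> a \<in> VN \<Longrightarrow> (a, x) \<in> A\<^sup>*"
proof (induction rule: converse_rtrancl_induct)
  case base
  then show ?case using x_only by blast
next
  case (step a c)
  show ?case
  proof (cases "a = x")
    case False
    then have "a \<notin> VN'" using step.prems x_only by blast
    then have "(a, c) \<in> A" using arc_A_out step(1) by blast
    then show ?thesis using step N.arcs by (auto intro: converse_rtrancl_into_rtrancl)
  qed simp
qed

lemma reach_A: "(a, b) \<in> A\<^sup>* \<Longrightarrow> (a, b) \<in> B\<^sup>*" and reach_A': "(a, b) \<in> A'\<^sup>* \<Longrightarrow> (a, b) \<in> B\<^sup>*"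
  by (erule rtrancl_mono[THEN subsetD, rotated], blast)+

lemma indeg_A: "v \<in> VN \<Longrightarrow> indeg B v = indeg A v"
  unfolding indeg_def by (rule arg_cong[of _ _ card]) (use arc_A in blast)

lemma indeg_A': "v \<notin> VN \<Longrightarrow> indeg B v = indeg A' v"
  unfolding indeg_def by (rule arg_cong[of _ _ card]) (use arc_A'_in in blast)

lemma outdeg_A: "v \<notin> VN' \<Longrightarrow> outdeg B v = outdeg A v"
  unfolding outdeg_def by (rule arg_cong[of _ _ card]) (use arc_A_out in blast)

lemma outdeg_A': "v \<in> VN' \<Longrightarrow> outdeg B v = outdeg A' v"
  unfolding outdeg_def by (rule arg_cong[of _ _ card]) (use arc_A' in blast)

text \<open>Only \<open>x\<close> changes its kind: with one parent above and at least two children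
  below it becomes a tree-vertex. All other degrees stay, and the upper root is the new
  root.\<close>

lemma glued_network: "is_network W B Y"
proof -
  obtain \<rho> where r: "network_root VN A X \<rho>" using N.network_root_exists[OF ne(1)] by blast
  note \<rho> = network_rootD[OF r]
  obtain \<rho>' where r': "network_root VN' A' X' \<rho>'" using N'.network_root_exists[OF ne(2)] by blast
  note \<rho>' = network_rootD[OF r']
  have "indeg A' x = 0" using x_no_in by (simp add: indeg_def)
  then have xr: "\<rho>' = x" using \<rho>'(4) x_mem by metis
  have xl: "outdeg A x = 0" "indeg A x = 1" using \<rho>(5)[OF x_mem(1)] x by auto
  have xX': "x \<notin> X'" using \<rho>'(3,5) xr x_mem by fastforce
  have \<rho>x: "\<rho> \<noteq> x" using xl \<rho>(3) by auto
  show ?thesis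
  proof (rule networkI[where \<rho> = \<rho>])
    show "finite W" using N.finite_VN N'.finite_VN by simp
    show "B \<subseteq> W \<times> W" using N.arcs N'.arcs by auto
    show "acyclic B"
    proof (rule acyclicI_step)
      fix a c assume ac: "(a, c) \<in> B" "(c, a) \<in> B\<^sup>*"
      show False
      proof (cases "a \<in> VN'")
        case True
        then have "(a, c) \<in> A'" using arc_A' ac by blast
        moreover then have "(c, a) \<in> A'\<^sup>*" using reach_down[OF ac(2)] N'.arcs by auto
        ultimately show False using N'.no_cycle by blast
      next
        case False
        then have a: "(a, c) \<in> A" using arc_A_out ac by blast
        then have "a \<in> VN" "a \<noteq> x" using N.arcs False x_mem by auto
        then have "(c, a) \<in> A\<^sup>*" using reach_up[OF ac(2)] by blast
        then show False using a N.no_cycle by blast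
      qed
    qed
    show "Y \<subseteq> W" using N.leaves_subset N'.leaves_subset by auto
    show "\<rho> \<in> W" using \<rho>(1) by simp
    show "indeg B \<rho> = 0" using \<rho>(1,2) indeg_A by simp
    show "2 \<le> outdeg B \<rho>" using \<rho>(1,3) outdeg_A[of \<rho>] x_only[of \<rho>] \<rho>x by metis
    show "u = \<rho>" if "u \<in> W" "indeg B u = 0" for u
    proof (cases "u \<in> VN")
      case True
      then show ?thesis using \<rho>(4)[of u] that indeg_A by simp
    next
      case False
      then show ?thesis using that \<rho>'(4)[of u] indeg_A' x_mem xr by auto
    qed
    show "(v \<in> Y) = (outdeg B v = 0 \<and> indeg B v = 1)" if v: "v \<in> W" for v
    proof (cases "v = x")
      case True
      then show ?thesis using xX' \<rho>'(3) xr outdeg_A'[OF x_mem(2)] by simp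
    next
      case vx: False
      show ?thesis
      proof (cases "v \<in> VN")
        case True
        then have "v \<notin> VN'" using vx x_only by blast
        then show ?thesis using True vx \<rho>(5) indeg_A outdeg_A N'.leaves_subset by auto
      next
        case False
        then show ?thesis using v \<rho>'(5) indeg_A' outdeg_A' N.leaves_subset by auto
      qed
    qed
    show "indeg B v = 1 \<and> 2 \<le> outdeg B v \<or> indeg B v = 2 \<and> 1 \<le> outdeg B v"
      if v: "v \<in> W" "v \<notin> Y" "v \<noteq> \<rho>" for v
    proof (cases "v = x")
      case True
      then show ?thesis using \<rho>'(3) xr xl indeg_A[OF x_mem(1)] outdeg_A'[OF x_mem(2)] by simp
    next
      case vx: False
      show ?thesis
      proof (cases "v \<in> VN")
        case True
        then have "v \<notin> VN'" "v \<notin> X" using vx v x_only by auto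
        then show ?thesis using True vx \<rho>(6) v indeg_A outdeg_A by simp
      next
        case False
        then show ?thesis using v vx xr \<rho>'(6) indeg_A' outdeg_A' by simp
      qed
    qed
  qed
qed

text \<open>\<open>x\<close> is a cut vertex: no edge avoiding \<open>x\<close> joins the two sides.
  A set that stays connected without \<open>x\<close> lies on one side.\<close>

lemma biconnected_glued:
  assumes "biconnected_set W B S"
  shows "biconnected_set VN A S \<or> biconnected_set VN' A' S"
proof -
  have S: "S \<subseteq> W" "finite S" "card S \<ge> 2" "connected_on S (undirected B)"
    "\<And>w. w \<in> S \<Longrightarrow> connected_on (S - {w}) (undirected B)" using assms by (auto simp: biconnected_set_def)
  have "connected_on (S - {x}) (undirected B)" using S by (cases "x \<in> S") auto
  have "S \<subseteq> VN \<or> S \<subseteq> VN'"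
  proof (rule ccontr)
    assume "\<not> ?thesis"
    then obtain a b where ab: "a \<in> S" "a \<notin> VN'" "b \<in> S" "b \<notin> VN" by blast
    then have n: "a \<in> VN" "a \<in> S - {x}" "b \<in> S - {x}" using S x_mem by auto
    have "\<exists>p q. (p, q) \<in> undirected B \<inter> (S - {x}) \<times> (S - {x}) \<and> p \<in> VN \<and> q \<notin> VN"
    proof -
      have "(a, b) \<in> (undirected B \<inter> (S - {x}) \<times> (S - {x}))\<^sup>*"
        using \<open>connected_on (S - {x}) (undirected B)\<close> n by (simp add: connected_on_def)
      then show ?thesis using n(1) ab(4) by (induction rule: rtrancl_induct) blast+
    qed
    then obtain p q where pq: "(p, q) \<in> undirected B" "p \<noteq> x" "p \<in> VN" "q \<notin> VN" by auto
    then have "p \<notin> VN'" using x_only by blast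
    then show False using pq N.arcs N'.arcs by (auto simp: undirected_def)
  qed
  moreover have "connected_on T (undirected A)" if "connected_on T (undirected B)" "T \<subseteq> VN" for T
  proof -
    have "(a, b) \<notin> A'" if "a \<in> VN" "b \<in> VN" for a b
      using that N'.arcs x_only N'.no_loop by blast
    then have "undirected B \<inter> (T \<times> T) = undirected A \<inter> (T \<times> T)" using \<open>T \<subseteq> VN\<close> by (auto simp: undirected_def)
    then show ?thesis using that by (simp add: connected_on_def)
  qed
  moreover have "connected_on T (undirected A')" if "connected_on T (undirected B)" "T \<subseteq> VN'" for T
  proof -
    have "(a, b) \<notin> A" if "a \<in> VN'" "b \<in> VN'" for a b
      using that N.arcs x_only N.no_loop by blast
    then have "undirected B \<inter> (T \<times> T) = undirected A' \<inter> (T \<times> T)" using \<open>T \<subseteq> VN'\<close> by (auto simp: undirected_def)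
    then show ?thesis using that by (simp add: connected_on_def)
  qed
  ultimately show ?thesis using S unfolding biconnected_set_def by (meson Diff_subset order_trans)
qed

lemma hybrid_glued:
  assumes "hybrid_vertex W B Y v"
  shows "v \<in> VN \<Longrightarrow> hybrid_vertex VN A X v" and "v \<in> VN' \<Longrightarrow> hybrid_vertex VN' A' X' v"
proof -
  have v: "v \<in> W" "v \<notin> Y" "indeg B v = 2" using assms by (auto simp: hybrid_vertex_def)
  have "v \<noteq> x" using v N.leaf_indeg[OF x] indeg_A[OF x_mem(1)] by auto
  then show "v \<in> VN \<Longrightarrow> hybrid_vertex VN A X v" and "v \<in> VN' \<Longrightarrow> hybrid_vertex VN' A' X' v"
    using v indeg_A[of v] indeg_A'[of v] x_only[of v] by (auto simp: hybrid_vertex_def)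
qed

lemma glued_level1: "level1 W B Y"
proof (rule level1I)
  fix S h1 h2 assume S: "biconnected_set W B S" and m: "h1 \<in> S" "h2 \<in> S"
    and h: "hybrid_vertex W B Y h1" "hybrid_vertex W B Y h2"
  from biconnected_glued[OF S] show "h1 = h2"
  proof
    assume b: "biconnected_set VN A S"
    then have "h1 \<in> VN" "h2 \<in> VN" using m by (auto simp: biconnected_set_def)
    then show ?thesis using N.one_hybrid[OF b m] hybrid_glued(1) h by blast
  next
    assume b: "biconnected_set VN' A' S"
    then have "h1 \<in> VN'" "h2 \<in> VN'" using m by (auto simp: biconnected_set_def)
    then show ?thesis using N'.one_hybrid[OF b m] hybrid_glued(2) h by blast
  qed
qed

sublocale glued: level1_network W B Y
  using glued_network glued_level1 by unfold_locales

text \<open>Upper vertices other than \<open>x\<close> have no ancestors in the lower network. The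
  position of the lca is recorded because the combined labeling distinguishes the two parts; the
  next two lemmas do the same.\<close>

lemma glued_lca_upper:
  assumes a: "a \<in> X" "a \<noteq> x" and b: "b \<in> X" "b \<noteq> x"
  shows "lca W B a b = lca VN A a b \<and> lca VN A a b \<notin> VN'"
proof -
  have m: "a \<in> VN" "b \<in> VN" using a b N.leaves_subset by auto
  obtain w where w: "is_lca VN A a b w" using N.is_lca_exists[OF m] by blast
  note w' = N.is_lcaD[OF w]
  have "w \<noteq> x" using N.leaf_reach[OF x] w'(2) a(2) by auto
  have "is_lca W B a b w"
  proof (rule is_lca_minimalI)
    fix z assume z: "(z, a) \<in> B\<^sup>*" "(z, b) \<in> B\<^sup>*" "(w, z) \<in> B\<^sup>*"
    have za: "(z, a) \<in> A\<^sup>*" "z \<in> VN" "z \<noteq> x" "(z, b) \<in> A\<^sup>*" using reach_up z m a b by blast+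
    show "z = w" using w'(4)[OF za(1,4)] reach_up[OF z(3) za(2,3)] by blast
  qed (use w' reach_A in auto)
  then show ?thesis using w N.lca_eqI glued.lca_eqI x_only w'(1) \<open>w \<noteq> x\<close> by metis
qed

text \<open>Seen from above, a lower leaf behaves like \<open>x\<close>, the only entrance to the
  lower network. Both orders of the arguments are covered, since \<open>lca\<close> is used with
  either.\<close>

lemma glued_lca_mixed:
  assumes a: "a \<in> X" "a \<noteq> x" and b: "b \<in> X'"
  shows "lca W B a b = lca VN A a x \<and> lca W B b a = lca VN A x a \<and> lca VN A a x \<notin> VN' \<and> lca VN A x a \<notin> VN'"
proof -
  have m: "a \<in> VN" "b \<in> VN'" using a b N.leaves_subset N'.leaves_subset by auto
  obtain w where w: "is_lca VN A a x w" using N.is_lca_exists[OF m(1) x_mem(1)] by blast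
  note w' = N.is_lcaD[OF w]
  have ws: "is_lca VN A x a w" using w by (auto simp: is_lca_def)
  have "w \<noteq> x" using N.leaf_reach[OF x] w'(2) a(2) by auto
  have xb: "(x, b) \<in> B\<^sup>*" using x_root m reach_A' by blast
  have g: "is_lca W B a b w"
  proof (rule is_lca_minimalI)
    fix z assume z: "(z, a) \<in> B\<^sup>*" "(z, b) \<in> B\<^sup>*" "(w, z) \<in> B\<^sup>*"
    have za: "(z, a) \<in> A\<^sup>*" "z \<in> VN" "z \<noteq> x" using reach_up[OF z(1) m(1) a(2)] by blast+
    have "(z, x) \<in> A\<^sup>*" using reach_across[OF z(2) m(2) za(2)] .
    then show "z = w" using w'(4)[OF za(1)] reach_up[OF z(3) za(2,3)] by blast
  next
    show "(w, b) \<in> B\<^sup>*" using reach_A[OF w'(3)] xb by (rule rtrancl_trans)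
  qed (use w' reach_A in auto)
  have "is_lca W B b a w" using g by (auto simp: is_lca_def)
  then show ?thesis using w ws g N.lca_eqI glued.lca_eqI x_only w'(1) \<open>w \<noteq> x\<close> by metis
qed

lemma glued_lca_lower:
  assumes a: "a \<in> X'" and b: "b \<in> X'"
  shows "lca W B a b = lca VN' A' a b \<and> lca VN' A' a b \<in> VN'"
proof -
  have m: "a \<in> VN'" "b \<in> VN'" using a b N'.leaves_subset by auto
  obtain w where w: "is_lca VN' A' a b w" using N'.is_lca_exists[OF m] by blast
  note w' = N'.is_lcaD[OF w]
  have "is_lca W B a b w"
  proof (rule is_lca_minimalI)
    fix z assume z: "(z, a) \<in> B\<^sup>*" "(z, b) \<in> B\<^sup>*" "(w, z) \<in> B\<^sup>*"
    have wz: "(w, z) \<in> A'\<^sup>*" "z \<in> VN'" using reach_down[OF z(3) w'(1)] by blast+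
    show "z = w" using w'(4) reach_down[OF z(1) wz(2)] reach_down[OF z(2) wz(2)] wz by blast
  qed (use w' reach_A' in auto)
  then show ?thesis using w N'.lca_eqI glued.lca_eqI w'(1) by metis
qed

end

lemma explainableE:
  assumes "explainable_level1 V E"
  obtains VN :: "nat set" and A X t f where "level1_network VN A X" "labeling VN X t" "bij_betw f V X"
    "\<And>x y. x \<in> V \<Longrightarrow> y \<in> V \<Longrightarrow> x \<noteq> y \<Longrightarrow> (x, y) \<in> E \<longleftrightarrow> t (lca VN A (f x) (f y)) = L1"
proof -
  obtain VN :: "nat set" and A X t f where N: "is_network VN A X" "level1 VN A X" "labeling VN X t"
    "graph_iso f V E X (net_graph_edges VN A X t)"
    using assms unfolding explainable_level1_def by blast
  have bij: "bij_betw f V X" using N(4) by (simp add: graph_iso_def)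
  have "(x, y) \<in> E \<longleftrightarrow> t (lca VN A (f x) (f y)) = L1" if xy: "x \<in> V" "y \<in> V" "x \<noteq> y" for x y
  proof -
    have "f x \<noteq> f y" using inj_onD[OF bij_betw_imp_inj_on[OF bij], of x y] xy by auto
    moreover have "f x \<in> X" "f y \<in> X" using bij xy by (auto dest: bij_betwE)
    moreover have "(x, y) \<in> E \<longleftrightarrow> (f x, f y) \<in> net_graph_edges VN A X t" using N(4) xy by (simp add: graph_iso_def)
    ultimately show ?thesis by (simp add: net_graph_edges_def)
  qed
  moreover have "level1_network VN A X" using N by unfold_locales
  ultimately show thesis using that N(3) bij by blast
qed

lemma explainable_cong:
  assumes "\<And>x y. x \<in> V \<Longrightarrow> y \<in> V \<Longrightarrow> (x, y) \<in> E \<longleftrightarrow> (x, y) \<in> E'" "explainable_level1 V E"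
  shows "explainable_level1 V E'"
  using assms unfolding explainable_level1_def graph_iso_def by metis

lemma explainable_transport:
  assumes "bij_betw r V W" "\<And>x y. x \<in> V \<Longrightarrow> y \<in> V \<Longrightarrow> (x, y) \<in> E \<longleftrightarrow> (r x, r y) \<in> F" "explainable_level1 V E"
  shows "explainable_level1 W F"
proof -
  obtain VN :: "nat set" and A X t f where N: "is_network VN A X" "level1 VN A X" "labeling VN X t"
    "graph_iso f V E X (net_graph_edges VN A X t)"
    using assms(3) unfolding explainable_level1_def by blast
  let ?q = "the_inv_into V r"
  have q: "bij_betw ?q W V" by (rule bij_betw_the_inv_into[OF assms(1)])
  have qV: "?q w \<in> V" "r (?q w) = w" if "w \<in> W" for w
    using q that bij_betwE[OF q] f_the_inv_into_f_bij_betw[OF assms(1)] by auto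
  have "graph_iso (f \<circ> ?q) W F X (net_graph_edges VN A X t)" unfolding graph_iso_def
  proof (intro conjI ballI)
    show "bij_betw (f \<circ> ?q) W X" using q N(4) by (auto simp: graph_iso_def intro: bij_betw_trans)
    fix u v assume "u \<in> W" "v \<in> W"
    then have "((u, v) \<in> F) = ((?q u, ?q v) \<in> E)" using assms(2)[of "?q u" "?q v"] qV by simp
    then show "((u, v) \<in> F) = (((f \<circ> ?q) u, (f \<circ> ?q) v) \<in> net_graph_edges VN A X t)"
      using N(4) qV \<open>u \<in> W\<close> \<open>v \<in> W\<close> by (simp add: graph_iso_def)
  qed
  then show ?thesis using N unfolding explainable_level1_def by blast
qed

text \<open>After gluing below the leaf of \<open>m\<close>, a vertex outside \<open>M\<close> has
  the same lca with every element of \<open>M\<close> as it had with \<open>m\<close>; the module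
  condition makes this label correct. The case \<open>M = {m}\<close> is set apart because a
  one-leaf network need not have arcs, which gluing demands.\<close>

theorem explainable_substitute:
  assumes irr: "\<And>x. (x, x) \<notin> E" and MV: "M \<subseteq> V" "M \<noteq> V" and m: "m \<in> M"
    and module: "\<And>z y. z \<in> V - M \<Longrightarrow> y \<in> M \<Longrightarrow> ((z, y) \<in> E) = ((z, m) \<in> E) \<and> ((y, z) \<in> E) = ((m, z) \<in> E)"
    and ex1: "explainable_level1 (insert m (V - M)) E" and ex2: "explainable_level1 M E"
  shows "explainable_level1 V E"
proof (cases "M = {m}")
  case True
  then have "insert m (V - M) = V" using MV by auto
  then show ?thesis using ex1 by simp
next
  case False
  obtain VN :: "nat set" and A X t f where N: "level1_network VN A X" and t: "labeling VN X t"
    and f: "bij_betw f (insert m (V - M)) X"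
    and e: "\<And>x y. x \<in> insert m (V - M) \<Longrightarrow> y \<in> insert m (V - M) \<Longrightarrow> x \<noteq> y \<Longrightarrow>
      (x, y) \<in> E \<longleftrightarrow> t (lca VN A (f x) (f y)) = L1"
    by (rule explainableE[OF ex1]) blast
  obtain VN' :: "nat set" and A' X' t' f' where N': "level1_network VN' A' X'" and t': "labeling VN' X' t'"
    and f': "bij_betw f' M X'"
    and e': "\<And>x y. x \<in> M \<Longrightarrow> y \<in> M \<Longrightarrow> x \<noteq> y \<Longrightarrow> (x, y) \<in> E \<longleftrightarrow> t' (lca VN' A' (f' x) (f' y)) = L1"
    by (rule explainableE[OF ex2]) blast
  interpret N: level1_network VN A X by (rule N)
  interpret N': level1_network VN' A' X' by (rule N')
  have arcs_ne: "B \<noteq> {}" if U: "level1_network U B Z" and g: "bij_betw g S Z" and pq: "p \<in> S" "q \<in> S" "p \<noteq> q"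
    for U B and Z :: "nat set" and g and S :: "'a set" and p q
  proof
    assume "B = {}"
    then obtain x where "Z = {x}" using level1_network.no_arcs[OF U] by blast
    then have "g p = x" "g q = x" using pq bij_betwE[OF g] by auto
    then show False using inj_onD[OF bij_betw_imp_inj_on[OF g], of p q] pq by auto
  qed
  obtain z where z: "z \<in> V - M" using MV by blast
  obtain m' where m': "m' \<in> M" "m' \<noteq> m" using False m by blast
  have ne: "A \<noteq> {}" using arcs_ne[OF N f, of m z] z m by auto
  have ne': "A' \<noteq> {}" using arcs_ne[OF N' f', of m m'] m m' by auto
  define x where "x = f m"
  have x: "x \<in> X" "x \<in> VN" using bij_betwE[OF f] N.leaves_subset by (auto simp: x_def)
  obtain \<rho>' where \<rho>': "\<rho>' \<in> VN'" "\<forall>v\<in>VN'. (\<rho>', v) \<in> A'\<^sup>*" using N'.root_reaches by blast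
  obtain K where K: "\<forall>v\<in>VN. v < K" using N.finite_VN finite_nat_set_iff_bounded by blast
  \<comment> \<open>\<open>K\<close> exceeds all upper vertices, so the shifted lower vertices are
    new; only the lower root is placed on \<open>x\<close>.\<close>
  define h where "h = (\<lambda>v. if v = \<rho>' then x else K + v)"
  have hx: "h \<rho>' = x" by (simp add: h_def)
  have xK: "x < K" using K x by simp
  have injh: "inj h"
  proof (rule injI)
    fix a b assume "h a = h b"
    then show "a = b" using xK by (auto simp: h_def split: if_splits)
  qed
  interpret R: renaming VN' A' X' h using injh by unfold_locales
  have meet: "VN \<inter> h ` VN' = {x}"
  proof
    show "VN \<inter> h ` VN' \<subseteq> {x}" using K by (auto simp: h_def split: if_splits)
    show "{x} \<subseteq> VN \<inter> h ` VN'" using x \<rho>' hx by auto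
  qed
  interpret G: gluing VN A X "h ` VN'" R.Ah "h ` X'" x
  proof unfold_locales
    show "x \<in> X" by (rule x(1))
    show "VN \<inter> h ` VN' = {x}" by (rule meet)
    show "A \<noteq> {}" by (rule ne)
    show "R.Ah \<noteq> {}" using ne' by simp
    fix v assume "v \<in> h ` VN'"
    then obtain w where w: "w \<in> VN'" "v = h w" by blast
    then have "(h \<rho>', h w) \<in> R.Ah\<^sup>*" using \<rho>' by (simp add: rtrancl_image_iff'[OF injh])
    then show "(x, v) \<in> R.Ah\<^sup>*" using hx w by simp
  qed
  define g where "g = (\<lambda>y. if y \<in> M then h (f' y) else f y)"
  \<comment> \<open>The lower network has precedence at \<open>x\<close>: this vertex is no longer a
    leaf and takes the label of the lower root.\<close>
  define T where "T = (\<lambda>v. if v \<in> h ` VN' then t' (inv h v) else t v)"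
  have invh: "inv h (h v) = v" for v using injh by simp
  have fX: "f y \<in> X" "f y \<noteq> x" if "y \<in> V - M" for y
  proof -
    show "f y \<in> X" using bij_betwE[OF f] that by auto
    show "f y \<noteq> x" using inj_onD[OF bij_betw_imp_inj_on[OF f], of y m] that m by (auto simp: x_def)
  qed
  have f'X: "f' y \<in> X'" "f' y \<in> VN'" if "y \<in> M" for y
    using bij_betwE[OF f'] that N'.leaves_subset by auto
  have b1: "bij_betw f (V - M) (X - {x})"
  proof -
    have "insert m (V - M) - {m} = V - M" using m by auto
    moreover have "bij_betw f {m} {x}" by (simp add: bij_betw_def x_def)
    ultimately show ?thesis using bij_betw_DiffI[OF f, of "{m}" "{x}"] x(1) by simp
  qed
  have "bij_betw (h \<circ> f') M (h ` X')"
    by (rule bij_betw_trans[OF f' inj_on_imp_bij_betw[OF inj_on_subset[OF injh subset_UNIV]]])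
  then have b2: "bij_betw g M (h ` X')"
    by (rule bij_betw_cong[THEN iffD1, rotated]) (simp add: g_def)
  have b1': "bij_betw g (V - M) (X - {x})"
    using b1 by (rule bij_betw_cong[THEN iffD1, rotated]) (simp add: g_def)
  have "(X - {x}) \<inter> h ` X' = {}" using meet N.leaves_subset N'.leaves_subset by blast
  from bij_betw_combine[OF b1' b2 this] have bij: "bij_betw g V G.Y"
    using MV by (simp add: Un_absorb2)
  show ?thesis
  proof (rule explainable_if_network[OF G.glued_network G.glued_level1 _ _ bij])
    show "labeling G.W G.Y T"
      unfolding labeling_def
    proof
      fix v assume v: "v \<in> G.W"
      show "(T v = LOdot) = (v \<in> G.Y)"
      proof (cases "v \<in> h ` VN'")
        case True
        then obtain w where w: "w \<in> VN'" "v = h w" by blast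
        have "v \<in> G.Y \<longleftrightarrow> v \<in> h ` X'" using True G.x_only N.leaves_subset by auto
        then show ?thesis using w t' invh R.h_mem by (auto simp: T_def labeling_def)
      next
        case False
        then have "v \<in> VN" "v \<noteq> x" using v G.x_mem by auto
        moreover have "v \<notin> h ` X'" using False N'.leaves_subset by auto
        ultimately show ?thesis using False t by (auto simp: T_def labeling_def)
      qed
    qed
    show "inj (\<lambda>n::nat. n)" by simp
    fix a b assume ab: "a \<in> V" "b \<in> V" "a \<noteq> b"
    show "(a, b) \<in> E \<longleftrightarrow> T (lca G.W G.B (g a) (g b)) = L1"
    proof (cases "a \<in> M"; cases "b \<in> M")
      assume m1: "a \<in> M" "b \<in> M"
      have "lca (h ` VN') R.Ah (h (f' a)) (h (f' b)) = h (lca VN' A' (f' a) (f' b))"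
        using R.renamed_lca f'X m1 by blast
      then show ?thesis using m1 G.glued_lca_lower[of "g a" "g b"] f'X e'[OF m1 ab(3)] invh by (simp add: g_def T_def)
    next
      assume m1: "a \<in> M" "b \<notin> M"
      then have b: "b \<in> V - M" using ab by auto
      have "(a, b) \<in> E \<longleftrightarrow> (m, b) \<in> E" using module[OF b m1(1)] by simp
      also have "\<dots> \<longleftrightarrow> t (lca VN A x (f b)) = L1" using e[of m b] b m by (auto simp: x_def)
      finally show ?thesis using m1 G.glued_lca_mixed[OF fX[OF b], of "g a"] f'X by (simp add: g_def T_def)
    next
      assume m1: "a \<notin> M" "b \<in> M"
      then have a: "a \<in> V - M" using ab by auto
      have "(a, b) \<in> E \<longleftrightarrow> (a, m) \<in> E" using module[OF a m1(2)] by simp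
      also have "\<dots> \<longleftrightarrow> t (lca VN A (f a) x) = L1" using e[of a m] a m by (auto simp: x_def)
      finally show ?thesis using m1 G.glued_lca_mixed[OF fX[OF a], of "g b"] f'X by (simp add: g_def T_def)
    next
      assume m1: "a \<notin> M" "b \<notin> M"
      then have a: "a \<in> V - M" "b \<in> V - M" using ab by auto
      then show ?thesis
        using e[of a b] G.glued_lca_upper[OF fX[OF a(1)] fX[OF a(2)]] m1 ab by (simp add: g_def T_def)
    qed
  qed (rule irr)
qed

section \<open>Cycle networks\<close>

text \<open>Symbolic vertices turn degrees and reachability into case distinctions.
  \<open>Core\<close> is the single leaf below the hybrid and will carry the common vertex of the
  two chains; \<open>Lf s i\<close> hangs at the spine vertex \<open>Sp s i\<close>.\<close>

datatype cyc = Root | Hyb | Sp bool nat | Lf bool nat | Core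

text \<open>The codes 0, 1, 2 are used up by the single vertices. Spine vertices on the two sides
  start at 3 and 4, leaves at 5 and 6, each continuing in steps of 4, so the four residue classes
  stay apart.\<close>

fun cyc_code :: "cyc \<Rightarrow> nat" where
  "cyc_code Root = 0"
| "cyc_code Hyb = 1"
| "cyc_code Core = 2"
| "cyc_code (Sp s i) = 3 + 4 * i + (if s then 0 else 1)"
| "cyc_code (Lf s i) = 5 + 4 * i + (if s then 0 else 1)"

lemma inj_cyc_code: "inj cyc_code"
proof (rule injI)
  fix x y :: cyc
  show "cyc_code x = cyc_code y \<Longrightarrow> x = y"
    by (cases x; cases y; simp split: if_splits; presburger)
qed

text \<open>The sides of the cycle are indexed by booleans; side s carries n s spine vertices.\<close>

locale cycle_net =
  fixes n :: "bool \<Rightarrow> nat"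
  assumes n: "\<And>s. 0 < n s"
begin

definition CV :: "cyc set" where
  "CV = {Root, Hyb, Core} \<union> {Sp s i | s i. i < n s} \<union> {Lf s i | s i. i < n s}"

definition CX :: "cyc set" where
  "CX = {Core} \<union> {Lf s i | s i. i < n s}"

definition CA :: "(cyc \<times> cyc) set" where
  "CA = {(Root, Sp s 0) | s. True} \<union> {(Sp s i, Lf s i) | s i. i < n s} \<union> {(Sp s i, Sp s (Suc i)) | s i. Suc i < n s}
    \<union> {(Sp s (n s - 1), Hyb) | s. True} \<union> {(Hyb, Core)}"

text \<open>A rank that grows along arcs. The sum \<open>n True + n False\<close> is a bound valid
  for both sides, which puts \<open>Hyb\<close> beyond every spine vertex whichever side is
  longer.\<close>

fun height :: "cyc \<Rightarrow> nat" where
  "height Root = 0"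
| "height (Sp s i) = Suc i"
| "height (Lf s i) = Suc (Suc i)"
| "height Hyb = Suc (n True + n False)"
| "height Core = Suc (Suc (n True + n False))"

lemma arc_height: "(a, b) \<in> CA \<Longrightarrow> height a < height b"
proof -
  have "n s \<le> n True + n False" for s by (cases s) auto
  then show "(a, b) \<in> CA \<Longrightarrow> height a < height b" using n by (auto simp: CA_def less_Suc_eq_le)
qed

lemma reach_height: "(a, b) \<in> CA\<^sup>* \<Longrightarrow> height a \<le> height b"
  by (induction rule: rtrancl_induct) (auto dest: arc_height)

lemma preds:
  "{u. (u, Root) \<in> CA} = {}"
  "{u. (u, Hyb) \<in> CA} = {Sp True (n True - 1), Sp False (n False - 1)}"
  "{u. (u, Core) \<in> CA} = {Hyb}"
  "{u. (u, Sp s 0) \<in> CA} = {Root}"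
  "Suc i < n s \<Longrightarrow> {u. (u, Sp s (Suc i)) \<in> CA} = {Sp s i}"
  "i < n s \<Longrightarrow> {u. (u, Lf s i) \<in> CA} = {Sp s i}"
proof -
  show "{u. (u, Hyb) \<in> CA} = {Sp True (n True - 1), Sp False (n False - 1)}"
    by (auto simp: CA_def) (metis (full_types))+
qed (auto simp: CA_def)

lemma succs:
  "{w. (Root, w) \<in> CA} = {Sp True 0, Sp False 0}"
  "{w. (Hyb, w) \<in> CA} = {Core}"
  "{w. (Core, w) \<in> CA} = {}"
  "{w. (Lf s i, w) \<in> CA} = {}"
  "i < n s \<Longrightarrow> {w. (Sp s i, w) \<in> CA} = {Lf s i, if Suc i < n s then Sp s (Suc i) else Hyb}"
proof -
  show "{w. (Root, w) \<in> CA} = {Sp True 0, Sp False 0}"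
    by (auto simp: CA_def)
  assume "i < n s"
  then show "{w. (Sp s i, w) \<in> CA} = {Lf s i, if Suc i < n s then Sp s (Suc i) else Hyb}"
    by (auto simp: CA_def)
qed (auto simp: CA_def)

lemma degs:
  "indeg CA Root = 0" "indeg CA Hyb = 2" "indeg CA Core = 1" "i < n s \<Longrightarrow> indeg CA (Sp s i) = 1"
  "i < n s \<Longrightarrow> indeg CA (Lf s i) = 1" "outdeg CA Root = 2" "outdeg CA Hyb = 1" "outdeg CA Core = 0"
  "outdeg CA (Lf s i) = 0" "i < n s \<Longrightarrow> outdeg CA (Sp s i) = 2"
proof -
  show "i < n s \<Longrightarrow> indeg CA (Sp s i) = 1" by (cases i) (simp_all add: indeg_def preds)
qed (simp_all add: indeg_def outdeg_def preds succs)

lemma CV_cases: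
  assumes "v \<in> CV"
  obtains "v = Root" | "v = Hyb" | "v = Core" | s i where "v = Sp s i" "i < n s" | s i where "v = Lf s i" "i < n s"
  using assms by (auto simp: CV_def)

lemma CV_iff: "Root \<in> CV" "Hyb \<in> CV" "Core \<in> CV" "Sp s i \<in> CV \<longleftrightarrow> i < n s" "Lf s i \<in> CV \<longleftrightarrow> i < n s"
  by (auto simp: CV_def)

lemma CX_iff: "Root \<notin> CX" "Hyb \<notin> CX" "Core \<in> CX" "Sp s i \<notin> CX" "Lf s i \<in> CX \<longleftrightarrow> i < n s"
  by (auto simp: CX_def)

lemma cycle_network: "is_network CV CA CX"
proof (rule networkI[where \<rho> = Root])
  have "CV = {Root, Hyb, Core} \<union> (\<Union>s. (Sp s) ` {..<n s}) \<union> (\<Union>s. (Lf s) ` {..<n s})"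
    by (auto simp: CV_def)
  then show "finite CV" by simp
  show "CA \<subseteq> CV \<times> CV" using n by (auto simp: CA_def CV_iff)
  show "acyclic CA"
  proof (rule acyclicI_step)
    fix a c assume "(a, c) \<in> CA" "(c, a) \<in> CA\<^sup>*"
    then show False using arc_height[of a c] reach_height[of c a] by simp
  qed
  show "CX \<subseteq> CV" by (auto simp: CX_def CV_def)
  show "Root \<in> CV" by (simp add: CV_def)
  show "u = Root" if "u \<in> CV" "indeg CA u = 0" for u
    using that by (cases rule: CV_cases) (auto simp: degs)
  show "(v \<in> CX) = (outdeg CA v = 0 \<and> indeg CA v = 1)" if "v \<in> CV" for v
    using that by (cases rule: CV_cases) (auto simp: degs CX_iff)
  show "indeg CA v = 1 \<and> 2 \<le> outdeg CA v \<or> indeg CA v = 2 \<and> 1 \<le> outdeg CA v"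
    if "v \<in> CV" "v \<notin> CX" "v \<noteq> Root" for v
    using that by (cases rule: CV_cases) (auto simp: degs CX_iff)
qed (simp_all add: degs)

text \<open>\<open>Hyb\<close> is the only hybrid of the whole network.\<close>

lemma cycle_level1: "level1 CV CA CX"
proof (rule level1I)
  have "h = Hyb" if "hybrid_vertex CV CA CX h" for h
  proof -
    have "h \<in> CV" "h \<notin> CX" "indeg CA h = 2" using that by (auto simp: hybrid_vertex_def)
    then show ?thesis by (cases rule: CV_cases) (auto simp: degs)
  qed
  then show "h1 = h2" if "hybrid_vertex CV CA CX h1" "hybrid_vertex CV CA CX h2" for h1 h2 using that by metis
qed

sublocale level1_network CV CA CX
  using cycle_network cycle_level1 by unfold_locales

lemma reach_spine: "j < n s \<Longrightarrow> i \<le> j \<Longrightarrow> (Sp s i, Sp s j) \<in> CA\<^sup>*"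
proof (induction j)
  case (Suc j)
  show ?case
  proof (cases "i = Suc j")
    case False
    then have "(Sp s i, Sp s j) \<in> CA\<^sup>*" using Suc by simp
    moreover have "(Sp s j, Sp s (Suc j)) \<in> CA" using Suc by (auto simp: CA_def)
    ultimately show ?thesis by (rule rtrancl_into_rtrancl)
  qed simp
qed simp

lemma reach_leaf: "j < n s \<Longrightarrow> i \<le> j \<Longrightarrow> (Sp s i, Lf s j) \<in> CA\<^sup>*"
  using reach_spine[of j s i] by (auto simp: CA_def elim: rtrancl_into_rtrancl)

lemma reach_Core: "i < n s \<Longrightarrow> (Sp s i, Core) \<in> CA\<^sup>*"
proof -
  assume i: "i < n s"
  then have "(Sp s i, Sp s (n s - 1)) \<in> CA\<^sup>*" using reach_spine[of "n s - 1" s i] by simp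
  moreover have "(Sp s (n s - 1), Hyb) \<in> CA" "(Hyb, Core) \<in> CA" by (auto simp: CA_def)
  ultimately show ?thesis by (meson rtrancl.rtrancl_into_rtrancl)
qed

text \<open>The vertices of one side together with \<open>Hyb\<close> and \<open>Core\<close> are
  closed under arcs.\<close>

lemma reach_side: "(Sp s i, v) \<in> CA\<^sup>* \<Longrightarrow> v \<noteq> Lf (\<not> s) j"
proof -
  have "(u, v) \<in> CA\<^sup>* \<Longrightarrow> u \<in> {Hyb, Core} \<union> {Sp s i | i. True} \<union> {Lf s i | i. True} \<Longrightarrow>
    v \<in> {Hyb, Core} \<union> {Sp s i | i. True} \<union> {Lf s i | i. True}" for u
    by (induction rule: rtrancl_induct) (auto simp: CA_def)
  then show "(Sp s i, v) \<in> CA\<^sup>* \<Longrightarrow> v \<noteq> Lf (\<not> s) j" by auto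
qed

lemma is_lca_commute: "is_lca VN A x y w \<longleftrightarrow> is_lca VN A y x w"
  by (auto simp: is_lca_def)

lemma lca_commute: "lca VN A x y = lca VN A y x"
  by (simp add: lca_def is_lca_commute)

text \<open>The only parent of \<open>Lf s i\<close> is \<open>Sp s i\<close>. A child of
  \<open>Sp s i\<close> other than this leaf has too large a height to reach it, and the leaf itself
  reaches nothing else.\<close>

lemma lca_spine:
  assumes i: "i < n s" and y: "y = Core \<or> (\<exists>j. y = Lf s j \<and> i < j \<and> j < n s)"
  shows "lca CV CA (Lf s i) y = Sp s i"
proof (rule lca_eqI, rule is_lcaI)
  show "Sp s i \<in> CV" using i by (auto simp: CV_def)
  show "(Sp s i, Lf s i) \<in> CA\<^sup>*" using reach_leaf i by simp
  show "(Sp s i, y) \<in> CA\<^sup>*" using reach_leaf[of _ s i] reach_Core i y by auto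
  fix c assume c: "(Sp s i, c) \<in> CA" "(c, Lf s i) \<in> CA\<^sup>*" "(c, y) \<in> CA\<^sup>*"
  have "c \<in> {w. (Sp s i, w) \<in> CA}" using c by simp
  then have "c = Lf s i \<or> c = Sp s (Suc i) \<and> Suc i < n s \<or> c = Hyb" using succs(5)[OF i] by (auto split: if_splits)
  moreover have "c \<noteq> Sp s (Suc i)"
  proof
    assume c': "c = Sp s (Suc i)"
    have "(Sp s (Suc i), Lf s i) \<in> CA\<^sup>*" using c c' by simp
    then obtain u where "(Sp s (Suc i), u) \<in> CA\<^sup>*" "(u, Lf s i) \<in> CA" by (cases rule: rtranclE) auto
    moreover have "u = Sp s i" using preds(6)[OF i] calculation(2) by auto
    ultimately show False using reach_height[of "Sp s (Suc i)" "Sp s i"] by simp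
  qed
  moreover have "c \<noteq> Hyb"
  proof
    assume "c = Hyb"
    then have "(Hyb, Lf s i) \<in> CA\<^sup>*" using c by simp
    then obtain u where "(Hyb, u) \<in> CA\<^sup>*" "(u, Lf s i) \<in> CA" by (cases rule: rtranclE) auto
    moreover have "u = Sp s i" using preds(6)[OF i] calculation(2) by auto
    ultimately show False using reach_height[of Hyb "Sp s i"] i by (cases s) auto
  qed
  moreover have "c \<noteq> Lf s i"
  proof
    assume "c = Lf s i"
    then have "(Lf s i, y) \<in> CA\<^sup>*" using c by simp
    then show False using leaf_reach[of "Lf s i" y] i y by (auto simp: CX_iff)
  qed
  ultimately show False by blast
qed

lemma lca_cross:
  assumes i: "i < n s" "j < n (\<not> s)"
  shows "lca CV CA (Lf s i) (Lf (\<not> s) j) = Root"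
proof (rule lca_eqI, rule is_lcaI)
  show "Root \<in> CV" by (simp add: CV_def)
  have "(Root, Sp s 0) \<in> CA" "(Root, Sp (\<not> s) 0) \<in> CA" by (auto simp: CA_def)
  then show "(Root, Lf s i) \<in> CA\<^sup>*" "(Root, Lf (\<not> s) j) \<in> CA\<^sup>*"
    using reach_leaf[OF i(1), of 0] reach_leaf[OF i(2), of 0] by (auto intro: converse_rtrancl_into_rtrancl)
  fix c assume c: "(Root, c) \<in> CA" "(c, Lf s i) \<in> CA\<^sup>*" "(c, Lf (\<not> s) j) \<in> CA\<^sup>*"
  then obtain s' where "c = Sp s' 0" by (auto simp: CA_def)
  then show False using reach_side[of s' 0 _ i] reach_side[of s' 0 _ j] c by (cases "s' = s") auto
qed

end

section \<open>Polar-cats are explainable\<close>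

text \<open>For a symmetric property of pairs of leaves three cases suffice: a side leaf with
  \<open>Core\<close>, two leaves of one side in order, and leaves of opposite sides.\<close>

lemma cycle_leaf_cases:
  assumes "\<And>s t. P s t \<Longrightarrow> P t s" "\<And>s i. P (Lf s i) Core" "\<And>s i j. i < j \<Longrightarrow> P (Lf s i) (Lf s j)"
    "\<And>s i j. P (Lf s i) (Lf (\<not> s) j)" and ab: "a \<noteq> b" "a \<in> {Core} \<union> range (case_prod Lf)" "b \<in> {Core} \<union> range (case_prod Lf)"
  shows "P a b"
proof -
  have ll: "P (Lf s i) (Lf s' j)" if "Lf s i \<noteq> Lf s' j" for s i s' j
  proof (cases "s' = s")
    case True
    then have "i < j \<or> j < i" using that by auto
    then show ?thesis
    proof
      assume "i < j"
      then have "P (Lf s i) (Lf s j)" by (rule assms(3))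
      then show ?thesis using True by simp
    next
      assume "j < i"
      then have "P (Lf s j) (Lf s i)" by (rule assms(3))
      then have "P (Lf s i) (Lf s j)" by (rule assms(1))
      then show ?thesis using True by simp
    qed
  next
    case False
    then have "s' = (\<not> s)" by auto
    then show ?thesis using assms(4) by simp
  qed
  have "a = Core \<or> (\<exists>s i. a = Lf s i)" "b = Core \<or> (\<exists>s i. b = Lf s i)" using ab by auto
  then show ?thesis
    by (elim disjE exE) (use assms(1)[OF assms(2)] assms(2) ll ab(1) in simp_all)
qed

text \<open>Each chain is laid along one side of the cycle and \<open>v\<close> below the hybrid. On
  one side the upper leaf decides the lca, as the earlier entry decides adjacency in a chain; pairs
  from different sides meet in \<open>Root\<close>, which carries \<open>b\<close>.\<close>

theorem explainable_if_chains:
  assumes S: "simple_graph S E" and ch: "chain E v xs" "chain E v ys" and ne: "xs \<noteq> []" "ys \<noteq> []"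
    and SU: "S = insert v (fst ` set xs \<union> fst ` set ys)" and dj: "fst ` set xs \<inter> fst ` set ys = {}"
    and un: "uniform E (fst ` set xs) (fst ` set ys) b"
  shows "explainable_level1 S E"
proof -
  define z where "z = (\<lambda>s. if s then xs else ys)"
  define n where "n = (\<lambda>s. length (z s))"
  interpret cycle_net n by unfold_locales (use ne in \<open>auto simp: n_def z_def\<close>)
  have E: "sym E" "\<And>x. (x, x) \<notin> E" using S by (auto simp: simple_graph_def)
  have sE: "((p, q) \<in> E) = ((q, p) \<in> E)" for p q using E(1) by (auto dest: symD)
  have chz: "chain E v (z s)" for s using ch by (simp add: z_def)
  have dz: "distinct (map fst (z s))" "v \<notin> fst ` set (z s)" for s using chain_distinct[OF chz] by blast+
  have mem: "fst (z s ! i) \<in> fst ` set (z s)" if "i < n s" for s i using that by (simp add: n_def)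
  have nv: "fst (z s ! i) \<noteq> v" if "i < n s" for s i using mem[OF that] dz(2) by metis
  have djs: "fst ` set (z s) \<inter> fst ` set (z (\<not> s)) = {}" for s using dj by (cases s) (simp_all add: z_def Int_commute)
  have uns: "((p, q) \<in> E) = b" if "p \<in> fst ` set (z s)" "q \<in> fst ` set (z (\<not> s))" for p q s
  proof -
    have u: "((x, y) \<in> E) = b" "((y, x) \<in> E) = b" if "x \<in> fst ` set xs" "y \<in> fst ` set ys" for x y
      using un that sE[of x y] unfolding uniform_def by blast+
    show ?thesis using that u[of p q] u[of q p] by (cases s) (simp_all add: z_def)
  qed
  have djz: "fst (z s ! i) \<noteq> fst (z (\<not> s) ! j)" if "i < n s" "j < n (\<not> s)" for s i j
    using mem[OF that(1)] mem[OF that(2)] djs by (metis disjoint_iff)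
  have unz: "((fst (z s ! i), fst (z (\<not> s) ! j)) \<in> E) = b" if "i < n s" "j < n (\<not> s)" for s i j
    by (rule uns[OF mem[OF that(1)] mem[OF that(2)]])
  have eqz: "i = j" if "fst (z s ! i) = fst (z s ! j)" "i < n s" "j < n s" for s i j
    using that dz(1)[of s] nth_eq_iff_index_eq[of "map fst (z s)" i j] by (simp add: n_def)
  define g where "g = (\<lambda>c. case c of Lf s i \<Rightarrow> fst (z s ! i) | _ \<Rightarrow> v)"
  have g: "g Core = v" "g (Lf s i) = fst (z s ! i)" for s i by (simp_all add: g_def)
  have gll: "g (Lf s i) \<noteq> g (Lf s' j)" if "Lf s i \<noteq> Lf s' j" "i < n s" "j < n s'" for s s' i j
  proof (cases "s' = s")
    case True
    then show ?thesis using that eqz[of s i j] g by auto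
  next
    case False
    then have "s' = (\<not> s)" by auto
    then show ?thesis using that djz[of i s j] g by simp
  qed
  have inj: "inj_on g CX"
  proof (rule inj_onI, rule ccontr)
    fix p q assume pq: "p \<in> CX" "q \<in> CX" "g p = g q" "p \<noteq> q"
    have "p = Core \<or> (\<exists>s i. p = Lf s i \<and> i < n s)" "q = Core \<or> (\<exists>s i. q = Lf s i \<and> i < n s)"
      using pq by (auto simp: CX_def)
    then show False using pq(3,4) gll g(1) g(2)[symmetric] nv
      by (elim disjE exE conjE) (simp, metis, metis, metis)
  qed
  have im: "g ` CX = S"
  proof -
    have "g ` CX = insert v (\<Union>s. (\<lambda>i. fst (z s ! i)) ` {..<n s})"
    proof -
      have "CX = insert Core (\<Union>s. Lf s ` {..<n s})" by (auto simp: CX_def)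
      then show ?thesis by (simp add: image_UN image_image g)
    qed
    also have "\<dots> = insert v (\<Union>s. fst ` set (z s))"
    proof -
      have "(\<lambda>i. fst (z s ! i)) ` {..<n s} = fst ` set (z s)" for s
        by (force simp: n_def in_set_conv_nth image_iff)
      then show ?thesis by simp
    qed
    also have "(\<Union>s. fst ` set (z s)) = fst ` set xs \<union> fst ` set ys"
      by (simp add: UNIV_bool z_def Un_commute)
    finally show ?thesis using SU by simp
  qed
  have bij: "bij_betw g CX S" using inj im by (simp add: bij_betw_def)
  \<comment> \<open>\<open>Hyb\<close> has \<open>Core\<close> as its only child and is never the
    lca of two leaves, so \<open>L0\<close> is an arbitrary label for an inner vertex.\<close>
  define t where "t = (\<lambda>c. case c of Root \<Rightarrow> if b then L1 else L0 | Sp s i \<Rightarrow> if snd (z s ! i) then L1 else L0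
    | Hyb \<Rightarrow> L0 | _ \<Rightarrow> LOdot)"
  have t: "(t Root = L1) = b" "(t (Sp s i) = L1) = snd (z s ! i)" for s i by (simp_all add: t_def)
  have nl: "length (z s) = n s" for s by (simp add: n_def)
  let ?P = "\<lambda>p q. p \<in> CX \<longrightarrow> q \<in> CX \<longrightarrow> ((g p, g q) \<in> E) = (t (lca CV CA p q) = L1)"
  have P: "?P p q" if pq: "p \<in> CX" "q \<in> CX" "p \<noteq> q" for p q
  proof (rule cycle_leaf_cases[of ?P])
    show "?P q p" if "?P p q" for p q using that sE[of "g p" "g q"] lca_commute[of CV CA p q] by simp
    show "?P (Lf s i) Core" for s i
    proof (intro impI)
      assume "Lf s i \<in> CX"
      then have i: "i < n s" by (simp add: CX_iff)
      then show "((g (Lf s i), g Core) \<in> E) = (t (lca CV CA (Lf s i) Core) = L1)"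
        using lca_spine[OF i, of Core] chain_nth(1)[OF chz[of s], of i] g nl t by simp
    qed
    show "?P (Lf s i) (Lf s j)" if "i < j" for s i j
    proof (intro impI)
      assume "Lf s j \<in> CX"
      then have j: "j < n s" by (simp add: CX_iff)
      then have i: "i < n s" using that by simp
      show "((g (Lf s i), g (Lf s j)) \<in> E) = (t (lca CV CA (Lf s i) (Lf s j)) = L1)"
        using lca_spine[OF i, of "Lf s j"] chain_nth(2)[OF chz[of s], of i j] g nl t i j that by simp
    qed
    show "?P (Lf s i) (Lf (\<not> s) j)" for s i j
    proof (intro impI)
      assume "Lf s i \<in> CX" "Lf (\<not> s) j \<in> CX"
      then have ij: "i < n s" "j < n (\<not> s)" by (simp_all only: CX_iff)
      show "((g (Lf s i), g (Lf (\<not> s) j)) \<in> E) = (t (lca CV CA (Lf s i) (Lf (\<not> s) j)) = L1)"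
        using lca_cross[OF ij] unz[OF ij] g t by simp
    qed
    show "p \<in> {Core} \<union> range (case_prod Lf)" "q \<in> {Core} \<union> range (case_prod Lf)"
      using pq by (auto simp: CX_def)
  qed (use pq in auto)
  let ?f = "the_inv_into CX g"
  have fbij: "bij_betw ?f S CX" by (rule bij_betw_the_inv_into[OF bij])
  have gf: "g (?f x) = x" "?f x \<in> CX" if "x \<in> S" for x
    using that bij_betwE[OF fbij] f_the_inv_into_f_bij_betw[OF bij] by auto
  show ?thesis
  proof (rule explainable_if_network[OF cycle_network cycle_level1 _ inj_cyc_code fbij])
    show "labeling CV CX t" unfolding labeling_def
    proof
      fix c assume "c \<in> CV"
      then show "(t c = LOdot) = (c \<in> CX)" by (cases rule: CV_cases) (auto simp: t_def CX_iff)
    qed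
    fix x y assume xy: "x \<in> S" "y \<in> S" "x \<noteq> y"
    then have "?f x \<noteq> ?f y" using gf by metis
    then show "(x, y) \<in> E \<longleftrightarrow> t (lca CV CA (?f x) (?f y)) = L1"
      using P[of "?f x" "?f y"] gf xy by simp
  qed (rule E(2))
qed

section \<open>Reading chains off caterpillars\<close>

lemma chain_cong:
  assumes "\<And>x y. x \<in> insert v (fst ` set xs) \<Longrightarrow> y \<in> insert v (fst ` set xs) \<Longrightarrow> (x, y) \<in> E \<longleftrightarrow> (x, y) \<in> F"
    and "chain E v xs"
  shows "chain F v xs"
  using assms
proof (induction E v xs rule: chain.induct)
  case (2 E v x b xs)
  have "chain F v xs" using 2 by (intro "2.IH") auto
  then show ?case using 2(2,3) by (auto simp: uniform_def)
qed simp

text \<open>The inner vertices are given as an undirected path only. Once its arcs are known to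
  point away from the root, the chain is built upwards from the cherry: every inner vertex above the
  cherry contributes one leaf and its own label.\<close>

theorem caterpillar_explainable_chain:
  assumes "caterpillar_explainable_cherry V E v" and vV: "v \<in> V"
  shows "\<exists>xs. chain E v xs \<and> xs \<noteq> [] \<and> V = insert v (fst ` set xs)"
proof -
  obtain VN :: "nat set" and A X t f where cat: "caterpillar VN A X"
    and f: "graph_iso f V E X (net_graph_edges VN A X t)" and cherry: "in_cherry A X (f v)"
    using assms unfolding caterpillar_explainable_cherry_def by blast
  have tree: "is_network VN A X" "\<And>v. \<not> hybrid_vertex VN A X v" and out: "\<And>v. v \<in> VN - X \<Longrightarrow> outdeg A v = 2"
    using cat by (auto simp: caterpillar_def is_tree_def)
  interpret level1_network VN A X using tree(1) level1_if_no_hybrid[OF tree(2)] by unfold_locales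
  obtain us where us: "us \<noteq> []" "distinct us" "set us = VN - X" "indeg A (hd us) = 0"
    and adj0: "\<forall>a\<in>VN - X. \<forall>b\<in>VN - X. ((a, b) \<in> A \<or> (b, a) \<in> A) \<longleftrightarrow>
      (\<exists>i. Suc i < length us \<and> {a, b} = {us ! i, us ! Suc i})"
    using cat unfolding caterpillar_def by (elim conjE exE)
  note adj = adj0[rule_format]
  let ?n = "length us"
  have bij: "bij_betw f V X" using f by (simp add: graph_iso_def)
  have fX: "f x \<in> X" "f x \<in> VN" if "x \<in> V" for x using bij_betwE[OF bij] that leaves_subset by auto
  have feq: "f x = f y \<longleftrightarrow> x = y" if "x \<in> V" "y \<in> V" for x y
    using inj_onD[OF bij_betw_imp_inj_on[OF bij], of x y] that by auto
  have edge: "(x, y) \<in> E \<longleftrightarrow> t (lca VN A (f x) (f y)) = L1" if "x \<in> V" "y \<in> V" "x \<noteq> y" for x y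
    using f feq fX that by (simp add: graph_iso_def net_graph_edges_def)
  have par: "p = q" if "(p, x) \<in> A" "(q, x) \<in> A" for p q x
    using hybrid_if_two_parents[OF that] tree(2) by blast
  have inner: "us ! i \<in> VN - X" if "i < ?n" for i using that us(3) nth_mem by blast
  have root: "(p, us ! 0) \<notin> A" for p
    using us(1,4) finite_preds[of "us ! 0"] by (auto simp: hd_conv_nth indeg_def)
  have consecutive: "(us ! i, us ! Suc i) \<in> A \<or> (us ! Suc i, us ! i) \<in> A" if "Suc i < ?n" for i
  proof -
    have "us ! i \<in> VN - X" "us ! Suc i \<in> VN - X" using inner that by simp_all
    then show ?thesis using adj[of "us ! i" "us ! Suc i"] that by blast
  qed
  \<comment> \<open>Nothing enters the root, which orients the first arc; afterwards each vertex
    already has its parent, so the next arc must point away from the root.\<close>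
  have step: "Suc i < ?n \<Longrightarrow> (us ! i, us ! Suc i) \<in> A" for i
  proof (induction i)
    case 0
    then show ?case using consecutive[of 0] root by blast
  next
    case (Suc i)
    have "us ! Suc (Suc i) \<noteq> us ! i" using us(2) Suc.prems by (simp add: nth_eq_iff_index_eq)
    then show ?case
      using consecutive[OF Suc.prems] par[of "us ! i" "us ! Suc i" "us ! Suc (Suc i)"] Suc by auto
  qed
  \<comment> \<open>A non-leaf child is a neighbour on the path of inner vertices, and the preceding
    neighbour is a parent. So the second child of a spine vertex with a successor is a leaf.\<close>
  have nxt: "Suc i < ?n \<and> b = us ! Suc i" if i: "i < ?n" and b: "(us ! i, b) \<in> A" "b \<notin> X" for i b
  proof -
    have "b \<in> VN - X" using b arcs by auto
    then obtain k where k: "Suc k < ?n" "{us ! i, b} = {us ! k, us ! Suc k}" using adj[OF inner[OF i], of b] b by auto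
    then consider "us ! i = us ! k" "b = us ! Suc k" | "us ! i = us ! Suc k" "b = us ! k" by (auto simp: doubleton_eq_iff)
    then show ?thesis
    proof cases
      case 1
      then have "i = k" using us(2) i k by (simp add: nth_eq_iff_index_eq)
      then show ?thesis using 1 k by simp
    next
      case 2
      then have "(b, us ! i) \<in> A" using step[OF k(1)] by simp
      then show ?thesis using b(1) no_cycle by blast
    qed
  qed
  define C where "C = (\<lambda>w. {s \<in> V. (w, f s) \<in> A\<^sup>*})"
  \<comment> \<open>One step upwards: \<open>u\<close> has a child \<open>c\<close> whose chain is
    known and a leaf child \<open>f s\<close>. The lca of that leaf with anything below
    \<open>c\<close> is \<open>u\<close>, so \<open>s\<close> becomes the new head with the label of
    \<open>u\<close> as flag.\<close>
  have extend: "\<exists>xs'. chain E v xs' \<and> xs' \<noteq> [] \<and> insert v (fst ` set xs') = C u"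
    if u: "u \<in> VN - X" and K: "{w. (u, w) \<in> A} = {c, f s}" and c: "(c, f s) \<notin> A\<^sup>*" and s: "s \<in> V"
      and xs: "chain E v xs" "insert v (fst ` set xs) = C c" for u c s xs
  proof -
    have uc: "(u, c) \<in> A" "(u, f s) \<in> A" and kids: "\<And>w. (u, w) \<in> A \<Longrightarrow> w = c \<or> w = f s" using K by blast+
    have Cu: "C u = insert s (C c)"
    proof -
      have "(u, f y) \<in> A\<^sup>* \<longleftrightarrow> y = s \<or> (c, f y) \<in> A\<^sup>*" if y: "y \<in> V" for y
      proof
        assume r: "(u, f y) \<in> A\<^sup>*"
        have "u \<noteq> f y" using u fX y by auto
        obtain w where "(u, w) \<in> A" "(w, f y) \<in> A\<^sup>*"
          using r by (cases rule: converse_rtranclE) (use \<open>u \<noteq> f y\<close> in auto)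
        then show "y = s \<or> (c, f y) \<in> A\<^sup>*" using kids leaf_reach[OF fX(1)[OF s]] feq[OF y s] by blast
      next
        assume "y = s \<or> (c, f y) \<in> A\<^sup>*"
        then show "(u, f y) \<in> A\<^sup>*" using uc by (auto intro: converse_rtrancl_into_rtrancl)
      qed
      then show ?thesis using s by (auto simp: C_def)
    qed
    have sC: "s \<notin> C c" using c by (auto simp: C_def)
    have "((s, y) \<in> E) = (t u = L1)" if y: "y \<in> C c" for y
    proof -
      have yV: "y \<in> V" "(c, f y) \<in> A\<^sup>*" and ys: "y \<noteq> s" using y sC by (auto simp: C_def)
      have "is_lca VN A (f s) (f y) u"
      proof (rule is_lcaI)
        show "u \<in> VN" using u by auto
        show "(u, f s) \<in> A\<^sup>*" "(u, f y) \<in> A\<^sup>*" using uc yV by (auto intro: converse_rtrancl_into_rtrancl)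
        fix w assume w: "(u, w) \<in> A" "(w, f s) \<in> A\<^sup>*" "(w, f y) \<in> A\<^sup>*"
        then show False using kids[OF w(1)] c leaf_reach[OF fX(1)[OF s]] feq[OF yV(1) s] ys by auto
      qed
      then show ?thesis using edge[OF s yV(1)] ys lca_eqI by auto
    qed
    then have "chain E v ((s, t u = L1) # xs)" using xs sC by (auto simp: uniform_def)
    then show ?thesis using Cu xs(2) by (intro exI[of _ "(s, t u = L1) # xs"]) auto
  qed
  obtain p y where py: "y \<in> X" "y \<noteq> f v" "(p, f v) \<in> A" "(p, y) \<in> A"
    using cherry by (auto simp: in_cherry_def)
  have pX: "p \<in> VN - X" using py(3) arcs leaf_no_succ by auto
  then obtain i where i: "i < ?n" "p = us ! i" using us(3) by (metis in_set_conv_nth)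
  have K: "{w. (p, w) \<in> A} = {f v, y}"
  proof -
    have "card {w. (p, w) \<in> A} = 2" using out[OF pX] by (simp add: outdeg_def)
    then show ?thesis using py(2-4) by (intro card_seteq[symmetric]) (auto simp: finite_succs)
  qed
  \<comment> \<open>Both children of the cherry parent are leaves, so it has no successor on the
    path and is its last vertex.\<close>
  have il: "Suc i = ?n"
  proof (rule ccontr)
    assume "Suc i \<noteq> ?n"
    then have si: "Suc i < ?n" using i by simp
    then have "us ! Suc i \<in> {w. (p, w) \<in> A}" using step i by simp
    then have "us ! Suc i \<in> X" using K py(1) fX vV by auto
    then show False using inner[OF si] by simp
  qed
  have yf: "\<exists>s\<in>V. y = f s" if "y \<in> X" for y using bij that by (auto simp: bij_betw_def)
  \<comment> \<open>The index counts upwards from the bottom. For \<open>k = 0\<close> the leaf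
    \<open>f v\<close> plays the part of the lower child with the empty chain, and its cherry
    partner is the leaf that branches off.\<close>
  have all: "\<exists>xs. chain E v xs \<and> xs \<noteq> [] \<and> insert v (fst ` set xs) = C (us ! (?n - 1 - k))" if "k < ?n" for k
    using that
  proof (induction k)
    case 0
    obtain s where s: "s \<in> V" "y = f s" using yf py(1) by blast
    have Cv: "C (f v) = {v}" using leaf_reach[OF fX(1)[OF vV]] feq vV by (auto simp: C_def)
    have "(f v, f s) \<notin> A\<^sup>*" using leaf_reach[OF fX(1)[OF vV]] s py(2) by auto
    then have "\<exists>xs'. chain E v xs' \<and> xs' \<noteq> [] \<and> insert v (fst ` set xs') = C p"
      using extend[OF pX, of "f v" s "[]"] K s Cv by auto
    moreover have "us ! (?n - 1 - 0) = p" using il i by (metis diff_Suc_1 diff_zero)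
    ultimately show ?case by simp
  next
    case (Suc k)
    let ?i = "?n - 1 - Suc k"
    have si: "?n - 1 - k = Suc ?i" and i: "?i < ?n" "Suc ?i < ?n" using Suc.prems by auto
    obtain xs where xs: "chain E v xs" "insert v (fst ` set xs) = C (us ! Suc ?i)" using Suc si by auto
    have c2: "card {w. (us ! ?i, w) \<in> A} = 2" using out[OF inner[OF i(1)]] by (simp add: outdeg_def)
    then obtain a b where ab: "{w. (us ! ?i, w) \<in> A} = {a, b}" "a \<noteq> b" unfolding card_2_iff by blast
    have "us ! Suc ?i \<in> {w. (us ! ?i, w) \<in> A}" using step[OF i(2)] by simp
    then have "us ! Suc ?i = a \<or> us ! Suc ?i = b" unfolding ab(1) by simp
    then obtain l where l: "{w. (us ! ?i, w) \<in> A} = {us ! Suc ?i, l}" "l \<noteq> us ! Suc ?i"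
      using ab by (metis insert_commute)
    have ul: "(us ! ?i, l) \<in> A" using l by blast
    have lX: "l \<in> X" using nxt[OF i(1) ul] l(2) by blast
    then obtain s where s: "s \<in> V" "l = f s" using yf by blast
    have "(us ! Suc ?i, l) \<notin> A\<^sup>*"
    proof
      assume "(us ! Suc ?i, l) \<in> A\<^sup>*"
      then obtain w where w: "(us ! Suc ?i, w) \<in> A\<^sup>*" "(w, l) \<in> A" using l(2) by (cases rule: rtranclE) auto
      then have "w = us ! ?i" using par ul by blast
      then show False using w step[OF i(2)] no_cycle by blast
    qed
    then show ?case using extend[OF inner[OF i(1)], of "us ! Suc ?i" s xs] l s xs by simp
  qed
  obtain \<rho> where \<rho>: "\<rho> \<in> VN" "\<forall>v\<in>VN. (\<rho>, v) \<in> A\<^sup>*" using root_reaches by blast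
  have "(\<rho>, us ! 0) \<in> A\<^sup>*" using \<rho> inner[of 0] us(1) by auto
  then have "\<rho> = us ! 0" using root by (metis rtranclE)
  then have "C (us ! 0) = V" using \<rho> fX by (auto simp: C_def)
  moreover have "\<exists>xs. chain E v xs \<and> xs \<noteq> [] \<and> insert v (fst ` set xs) = C (us ! 0)"
    using all[of "?n - 1"] us(1) by simp
  ultimately show ?thesis by metis
qed

text \<open>Both caterpillars are chains ending in \<open>v\<close>, and the join or disjoint union
  of the parts without \<open>v\<close> provides the flag \<open>b\<close> between them.\<close>

theorem polar_cat_explainable:
  assumes S: "simple_graph S E" and pc: "polar_cat S E"
  shows "explainable_level1 S E"
proof -
  obtain v V1 V2 where ps: "pseudo_cograph_at S E v V1 V2" and cat: "cat_at S E v V1 V2"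
    using pc by (auto simp: polar_cat_def cat_at_def)
  have V: "V1 \<union> V2 = S" "V1 \<inter> V2 = {v}" using ps by (auto simp: pseudo_cograph_at_def)
  have ch: "\<exists>xs. chain E v xs \<and> xs \<noteq> [] \<and> U = insert v (fst ` set xs)"
    if U: "caterpillar_explainable_cherry U (induced E U) v" "v \<in> U" for U
  proof -
    obtain xs where xs: "chain (induced E U) v xs" "xs \<noteq> []" "U = insert v (fst ` set xs)"
      using caterpillar_explainable_chain[OF U] by blast
    have "chain E v xs" by (rule chain_cong[OF _ xs(1)]) (use xs(3) in \<open>auto simp: induced_def\<close>)
    then show ?thesis using xs by blast
  qed
  have ce: "caterpillar_explainable_cherry V1 (induced E V1) v" "caterpillar_explainable_cherry V2 (induced E V2) v"
    using cat by (simp_all add: cat_at_def)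
  obtain xs where xs: "chain E v xs" "xs \<noteq> []" "V1 = insert v (fst ` set xs)" using ch[OF ce(1)] V by blast
  obtain ys where ys: "chain E v ys" "ys \<noteq> []" "V2 = insert v (fst ` set ys)" using ch[OF ce(2)] V by blast
  have nv: "v \<notin> fst ` set xs" "v \<notin> fst ` set ys"
    using chain_distinct[OF xs(1)] chain_distinct[OF ys(1)] by simp_all
  have m: "V1 - {v} = fst ` set xs" "V2 - {v} = fst ` set ys" using xs ys nv by auto
  have dj: "fst ` set xs \<inter> fst ` set ys = {}" using V(2) m by blast
  have SU: "S = insert v (fst ` set xs \<union> fst ` set ys)" using V xs ys by auto
  have Sv: "S - {v} = fst ` set xs \<union> fst ` set ys" using SU nv by auto
  let ?P = "fst ` set xs" and ?Q = "fst ` set ys"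
  have "is_join (?P \<union> ?Q) (induced E (?P \<union> ?Q)) ?P (induced E ?P) ?Q (induced E ?Q) \<or>
    is_disjoint_union (?P \<union> ?Q) (induced E (?P \<union> ?Q)) ?P (induced E ?P) ?Q (induced E ?Q)"
    using ps unfolding pseudo_cograph_at_def m Sv by blast
  then obtain b where "uniform E ?P ?Q b"
  proof
    assume j: "is_join (?P \<union> ?Q) (induced E (?P \<union> ?Q)) ?P (induced E ?P) ?Q (induced E ?Q)"
    have "(x, y) \<in> E" if "x \<in> ?P" "y \<in> ?Q" for x y
    proof -
      have "(x, y) \<in> induced E (?P \<union> ?Q)" using j that unfolding is_join_def by blast
      then show ?thesis by (simp add: induced_def)
    qed
    then show thesis using that[of True] by (simp add: uniform_def)
  next
    assume j: "is_disjoint_union (?P \<union> ?Q) (induced E (?P \<union> ?Q)) ?P (induced E ?P) ?Q (induced E ?Q)"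
    have "(x, y) \<notin> E" if "x \<in> ?P" "y \<in> ?Q" for x y
    proof
      assume "(x, y) \<in> E"
      then have "(x, y) \<in> induced E (?P \<union> ?Q)" using that by (simp add: induced_def)
      then have "(x, y) \<in> induced E ?P \<union> induced E ?Q" using j unfolding is_disjoint_union_def by simp
      then show False using that dj by (auto simp: induced_def)
    qed
    then show thesis using that[of False] by (simp add: uniform_def)
  qed
  then show ?thesis using explainable_if_chains[OF S xs(1) ys(1) xs(2) ys(2) SU dj] by blast
qed

section \<open>Assembling networks along the modular decomposition\<close>

lemma explainable_singleton:
  assumes "simple_graph {a} E"
  shows "explainable_level1 {a} E"
proof (rule explainable_if_network)
  show "is_network {0::nat} {} {0}" by (simp add: is_network_def acyclic_def)
  show "level1 {0::nat} {} {0}" by (rule level1_if_no_hybrid) (simp add: hybrid_vertex_def indeg_def)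
  show "labeling {0::nat} {0} (\<lambda>_. LOdot)" by (simp add: labeling_def)
  show "inj (\<lambda>n::nat. n)" by simp
  show "bij_betw (\<lambda>_. 0::nat) {a} {0}" by (simp add: bij_betw_def)
qed (use assms in \<open>auto simp: simple_graph_def\<close>)

text \<open>Two vertices form a chain of length one; its caterpillar is a tree and hence
  level-1.\<close>

lemma explainable_pair:
  assumes E: "sym E" "\<forall>x. (x, x) \<notin> E" and ab: "a \<noteq> b"
  shows "explainable_level1 {a, b} E"
proof -
  have "chain E b [(a, (a, b) \<in> E)]" using ab by (simp add: uniform_def)
  from chain_caterpillar_explainable[OF E this]
  have c: "caterpillar_explainable_cherry {b, a} (induced E {b, a}) b" by simp
  have ba: "{b, a} = {a, b}" by auto
  have "explainable_level1 {a, b} (induced E {a, b})"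
    using c level1_if_no_hybrid unfolding ba caterpillar_explainable_cherry_def explainable_level1_def
      caterpillar_def is_tree_def by metis
  then show ?thesis by (rule explainable_cong[rotated]) (auto simp: induced_def)
qed

lemma induced_induced: "M \<subseteq> W \<Longrightarrow> induced (induced E W) M = induced E M"
  by (auto simp: induced_def)

lemma is_module_induced:
  assumes "is_module V E M"
  shows "is_module W (induced E W) (M \<inter> W)"
  unfolding is_module_iff
proof (intro conjI ballI allI impI)
  fix x y z assume a: "x \<in> M \<inter> W" "y \<in> M \<inter> W" "z \<notin> M \<inter> W"
  show "((x, z) \<in> induced E W) = ((y, z) \<in> induced E W)"
    using is_moduleD[OF assms, of x y z] a by (auto simp: induced_def)
qed simp

text \<open>Strongness is the delicate point. A module \<open>M'\<close> of \<open>V\<close>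
  overlapping \<open>M\<close> cannot overlap it inside \<open>P\<close>, so \<open>M'\<close> meets
  \<open>P\<close> within \<open>M\<close> and contains some \<open>a\<close> in \<open>Q\<close>.
  Every element of \<open>M'\<close> then sees \<open>M - M'\<close> as \<open>a\<close> does, with
  value \<open>b\<close>. So \<open>M\<close> splits uniformly into \<open>M \<inter> M'\<close> and
  \<open>M - M'\<close>, although it and its complement are connected.\<close>

lemma prime_module_of_split_part:
  assumes S: "simple_graph V E" and PQ: "P \<union> Q = V" "P \<inter> Q = {}" and un: "uniform E P Q b"
    and M: "prime_module P (induced E P) M"
  shows "prime_module V E M"
proof -
  have E: "sym E" "E \<subseteq> V \<times> V" using S by (auto simp: simple_graph_def)
  have s: "((p, q) \<in> E) = ((q, p) \<in> E)" for p q using E(1) by (auto dest: symD)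
  have PV: "P \<subseteq> V" using PQ by auto
  have st: "strong_module P (induced E P) M" using M by (simp add: prime_module_def)
  then have mod: "is_module P (induced E P) M" by (simp add: strong_module_def)
  then have MP: "M \<subseteq> P" by (simp add: is_module_def)
  have conn: "connected_graph M (induced E M)" "connected_graph M (complement M (induced E M))"
    using M by (simp_all add: prime_module_def induced_induced[OF MP])
  have SM: "simple_graph M (induced E M)" using induced_simple_graph[OF S] MP PV by blast
  then have free: "split_free M (induced E M)"
    using split_free_iff_connected[OF SM] conn unfolding connected_graph_def by blast
  have "is_module V E M"
  proof (rule is_moduleI[OF E(2)])
    show "M \<subseteq> V" using MP PV by blast
    fix z assume z: "z \<in> V - M"
    show "\<exists>b. \<forall>x\<in>M. ((x, z) \<in> E) = b"
    proof (cases "z \<in> Q")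
      case True
      then show ?thesis using un MP by (intro exI[of _ b]) (auto simp: uniform_def)
    next
      case False
      then have "z \<in> P" using z PQ by auto
      then have "((x, z) \<in> E) = ((y, z) \<in> E)" if "x \<in> M" "y \<in> M" for x y
        using is_moduleD[OF mod that, of z] z MP that by (auto simp: induced_def)
      then show ?thesis by (cases "M = {}") blast+
    qed
  qed
  moreover have "M \<inter> M' = M \<or> M \<inter> M' = M' \<or> M \<inter> M' = {}" if M': "is_module V E M'" for M'
  proof (rule ccontr)
    assume n: "\<not> ?thesis"
    have "is_module P (induced E P) (M' \<inter> P)" using is_module_induced[OF M'] .
    then have "M \<inter> (M' \<inter> P) = M \<or> M \<inter> (M' \<inter> P) = M' \<inter> P \<or> M \<inter> (M' \<inter> P) = {}"
      using st by (simp add: strong_module_def)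
    then have "M' \<inter> P \<subseteq> M" using n MP by blast
    then obtain a where a: "a \<in> M'" "a \<in> Q" using n M' PQ by (auto simp: is_module_def)
    have "((x, y) \<in> E) = b" if "x \<in> M \<inter> M'" "y \<in> M - M'" for x y
    proof -
      have "((x, y) \<in> E) = ((a, y) \<in> E)" using is_moduleD[OF M', of x a y] that a by simp
      also have "\<dots> = b" using un a that MP s[of a y] by (auto simp: uniform_def)
      finally show ?thesis .
    qed
    then have "uniform (induced E M) (M \<inter> M') (M - M') b" by (auto simp: uniform_def induced_def)
    then have "M \<inter> M' = {} \<or> M - M' = {}"
      using free[unfolded split_free_def, rule_format, of "M \<inter> M'" "M - M'" b] by blast
    then show False using n by blast
  qed
  ultimately show ?thesis using conn by (simp add: prime_module_def strong_module_def)
qed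

text \<open>A module of \<open>V\<close> contains \<open>W\<close>, lies in \<open>W\<close> or is
  disjoint from it, so an overlap with \<open>M\<close> would be visible inside
  \<open>W\<close>.\<close>

lemma prime_module_of_strong_module:
  assumes S: "simple_graph V E" and W: "strong_module V E W" and M: "prime_module W (induced E W) M"
  shows "prime_module V E M"
proof -
  have E: "E \<subseteq> V \<times> V" using S by (simp add: simple_graph_def)
  have W': "is_module V E W" using W by (simp add: strong_module_def)
  then have WV: "W \<subseteq> V" by (simp add: is_module_def)
  have st: "strong_module W (induced E W) M" using M by (simp add: prime_module_def)
  then have mod: "is_module W (induced E W) M" by (simp add: strong_module_def)
  then have MW: "M \<subseteq> W" by (simp add: is_module_def)
  have "is_module V E M"
    unfolding is_module_iff
  proof (intro conjI ballI allI impI)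
    fix x y z assume a: "x \<in> M" "y \<in> M" "z \<notin> M"
    show "((x, z) \<in> E) = ((y, z) \<in> E)"
    proof (cases "z \<in> W")
      case True
      then show ?thesis using is_moduleD[OF mod a] a MW by (auto simp: induced_def)
    next
      case False
      then show ?thesis using is_moduleD[OF W', of x y z] a MW by blast
    qed
  qed (use MW WV in blast)
  moreover have "M \<inter> M' = M \<or> M \<inter> M' = M' \<or> M \<inter> M' = {}" if M': "is_module V E M'" for M'
  proof -
    have "W \<inter> M' = W \<or> W \<inter> M' = M' \<or> W \<inter> M' = {}" using W M' by (simp add: strong_module_def)
    moreover have "is_module W (induced E W) (M' \<inter> W)" using is_module_induced[OF M'] .
    then have "M \<inter> (M' \<inter> W) = M \<or> M \<inter> (M' \<inter> W) = M' \<inter> W \<or> M \<inter> (M' \<inter> W) = {}"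
      using st by (simp add: strong_module_def)
    ultimately show ?thesis using MW by blast
  qed
  ultimately show ?thesis using M by (simp add: prime_module_def strong_module_def induced_induced[OF MW])
qed

lemma polarcat_prime_induced:
  assumes "polarcat_prime V E" "\<And>M. prime_module W (induced E W) M \<Longrightarrow> prime_module V E M"
  shows "polarcat_prime W (induced E W)"
  unfolding polarcat_prime_def
proof (intro allI impI, elim conjE)
  fix M assume M: "prime_module W (induced E W) M" "2 \<le> card M"
  then have "M \<subseteq> W" by (simp add: prime_module_def strong_module_def is_module_def)
  then have "induced (induced E W) M = induced E M" by (rule induced_induced)
  then show "polar_cat (max_strong_modules M (induced (induced E W) M))
          (quotient_edges (induced (induced E W) M) (max_strong_modules M (induced (induced E W) M)))"
    using assms M unfolding polarcat_prime_def by simp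
qed

lemma (in nontrivial_graph) explainable_from_quotient:
  assumes Q: "explainable_level1 PP QE" and parts: "\<And>M. M \<in> PP \<Longrightarrow> explainable_level1 M E"
  shows "explainable_level1 V E"
proof -
  define r where "r = (\<lambda>m :: 'a set. SOME x. x \<in> m)"
  have r: "r m \<in> m" if "m \<in> PP" for m
    using PP_nonempty[OF that] unfolding r_def by (simp add: some_in_eq)
  have inj: "inj_on r PP"
  proof (rule inj_onI)
    fix m1 m2 assume m: "m1 \<in> PP" "m2 \<in> PP" "r m1 = r m2"
    then show "m1 = m2" using PP_eq[OF m(1,2)] r[OF m(1)] r[OF m(2)] by simp
  qed
  have s: "((p, q) \<in> E) = ((q, p) \<in> E)" for p q using sym_E by (auto dest: symD)
  have "explainable_level1 (r ` PP) E"
  proof (rule explainable_transport[OF _ _ Q])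
    show "bij_betw r PP (r ` PP)" using inj by (rule inj_on_imp_bij_betw)
    fix m1 m2 assume m: "m1 \<in> PP" "m2 \<in> PP"
    show "((m1, m2) \<in> QE) = ((r m1, r m2) \<in> E)"
    proof (cases "m1 = m2")
      case True
      then show ?thesis using irrefl_E by (simp add: quotient_edges_def)
    next
      case False
      then show ?thesis using quotient_edge_iff[OF m False] r m by blast
    qed
  qed
  \<comment> \<open>\<open>SS\<close> holds the parts that are already expanded; every other part is
    still represented by one vertex. Each step substitutes one part for its representative.\<close>
  have "finite SS \<Longrightarrow> SS \<subseteq> PP \<Longrightarrow> explainable_level1 (\<Union>SS \<union> r ` (PP - SS)) E" for SS
  proof (induction SS rule: finite_induct)
    case empty
    then show ?case using \<open>explainable_level1 (r ` PP) E\<close> by simp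
  next
    case (insert M SS)
    let ?W = "\<Union>(insert M SS) \<union> r ` (PP - insert M SS)"
    have M: "M \<in> PP" and SS: "SS \<subseteq> PP" using insert.prems by auto
    have disj: "x \<notin> M" if "x \<in> \<Union>SS \<union> r ` (PP - insert M SS)" for x
    proof
      assume xM: "x \<in> M"
      from that obtain N where N: "N \<in> PP" "x \<in> N" "N \<noteq> M"
      proof
        assume "x \<in> \<Union>SS"
        then show thesis using that SS insert.hyps(2) by blast
      next
        assume "x \<in> r ` (PP - insert M SS)"
        then show thesis using that r by blast
      qed
      then show False using PP_eq M xM by blast
    qed
    have diff: "?W - M = \<Union>SS \<union> r ` (PP - insert M SS)" using disj by blast
    show ?case
    proof (rule explainable_substitute[where M = M and m = "r M"])
      show "(x, x) \<notin> E" for x by (rule irrefl_E)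
      show "M \<subseteq> ?W" by auto
      show "r M \<in> M" using r M .
      show "explainable_level1 M E" using parts M .
      have "insert (r M) (?W - M) = \<Union>SS \<union> r ` (PP - SS)"
        unfolding diff using M insert.hyps(2) by blast
      then show "explainable_level1 (insert (r M) (?W - M)) E" using insert.IH[OF SS] by simp
      show "M \<noteq> ?W"
      proof -
        have "PP \<noteq> {M}" using card_PP by auto
        then obtain N where N: "N \<in> PP" "N \<noteq> M" using M by blast
        have "\<exists>x. x \<in> ?W - M" unfolding diff
        proof (cases "N \<in> SS")
          case True
          then show "\<exists>x. x \<in> \<Union>SS \<union> r ` (PP - insert M SS)" using PP_nonempty[OF N(1)] by blast
        next
          case False
          then show "\<exists>x. x \<in> \<Union>SS \<union> r ` (PP - insert M SS)" using N by blast
        qed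
        then show "M \<noteq> ?W" by blast
      qed
      fix z y assume z: "z \<in> ?W - M" and y: "y \<in> M"
      show "((z, y) \<in> E) = ((z, r M) \<in> E) \<and> ((y, z) \<in> E) = ((r M, z) \<in> E)"
        using is_moduleD[OF PP_module[OF M] y r[OF M], of z] z s by blast
    qed
  qed
  from this[OF finite_PP order_refl] show ?thesis using PP_cover by simp
qed

text \<open>The empty graph has to be excluded: every network has a leaf, while the condition on
  prime modules holds vacuously there.\<close>

theorem polarcat_prime_imp_explainable:
  assumes "simple_graph V E" "V \<noteq> {}" "polarcat_prime V E"
  shows "explainable_level1 V E"
  using assms
proof (induction "card V" arbitrary: V E rule: less_induct)
  case less
  note S = less.prems(1)
  have E: "sym E" "\<forall>x. (x, x) \<notin> E" "finite V" "E \<subseteq> V \<times> V" using S by (auto simp: simple_graph_def)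
  have s: "((p, q) \<in> E) = ((q, p) \<in> E)" for p q using E(1) by (auto dest: symD)
  \<comment> \<open>A proper nonempty piece whose prime modules are prime in the whole graph falls
    under the induction hypothesis. This serves both for the sides of a uniform split and for the
    maximal strong modules.\<close>
  have part: "explainable_level1 W E"
    if W: "W \<subset> V" "W \<noteq> {}" and pm: "\<And>M. prime_module W (induced E W) M \<Longrightarrow> prime_module V E M" for W
  proof -
    have "card W < card V" using W E(3) by (simp add: psubset_card_mono)
    moreover have "simple_graph W (induced E W)" using induced_simple_graph[OF S] W by blast
    moreover have "polarcat_prime W (induced E W)" using polarcat_prime_induced[OF less.prems(3) pm] .
    ultimately have "explainable_level1 W (induced E W)" using less.hyps W by blast
    then show ?thesis by (rule explainable_cong[rotated]) (simp add: induced_def)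
  qed
  consider a where "V = {a}" | "\<not> split_free V E" | "split_free V E" "card V \<ge> 2"
  proof -
    have "card V \<noteq> 0" using less.prems(2) E(3) by simp
    then have "card V = 1 \<or> card V \<ge> 2" by linarith
    then show thesis using that by (auto simp: card_1_singleton_iff)
  qed
  then show ?case
  proof cases
    case 1
    then show ?thesis using explainable_singleton S by simp
  next
    case 2
    then obtain P Q b where PQ: "P \<union> Q = V" "P \<inter> Q = {}" "uniform E P Q b" "P \<noteq> {}" "Q \<noteq> {}"
      unfolding split_free_def by blast
    have un: "((x, y) \<in> E) = b" "((y, x) \<in> E) = b" if "x \<in> P" "y \<in> Q" for x y
      using PQ(3) that s[of x y] by (auto simp: uniform_def)
    have QP: "Q \<union> P = V" "Q \<inter> P = {}" "uniform E Q P b" using PQ un by (auto simp: uniform_def)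
    have eP: "explainable_level1 P E"
      by (rule part) (use PQ prime_module_of_split_part[OF S PQ(1-3)] in blast)+
    have eQ: "explainable_level1 Q E"
      by (rule part) (use PQ prime_module_of_split_part[OF S QP] in blast)+
    obtain p q where pq: "p \<in> P" "q \<in> Q" using PQ by blast
    have ne: "p \<noteq> q" "q \<notin> P" using pq PQ by auto
    \<comment> \<open>The graph on \<open>p\<close> and \<open>q\<close> is enlarged twice: here
      \<open>P\<close> replaces \<open>p\<close>, afterwards \<open>Q\<close> replaces
      \<open>q\<close>.\<close>
    have e1: "explainable_level1 (insert q P) E"
    proof (rule explainable_substitute[where M = P and m = p])
      show "(x, x) \<notin> E" for x using E by blast
      have "insert p (insert q P - P) = {p, q}" using pq PQ by blast
      then show "explainable_level1 (insert p (insert q P - P)) E" using explainable_pair[OF E(1,2) ne(1)] by simp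
      fix z y assume "z \<in> insert q P - P" "y \<in> P"
      then show "((z, y) \<in> E) = ((z, p) \<in> E) \<and> ((y, z) \<in> E) = ((p, z) \<in> E)"
        using un[of y z] un[of p z] pq by auto
    qed (use eP pq ne in auto)
    show ?thesis
    proof (rule explainable_substitute[where M = Q and m = q])
      show "(x, x) \<notin> E" for x using E by blast
      have "insert q (V - Q) = insert q P" using PQ by blast
      then show "explainable_level1 (insert q (V - Q)) E" using e1 by simp
      show "Q \<subseteq> V" "Q \<noteq> V" using PQ by blast+
      fix z y assume "z \<in> V - Q" "y \<in> Q"
      then show "((z, y) \<in> E) = ((z, q) \<in> E) \<and> ((y, z) \<in> E) = ((q, z) \<in> E)"
        using un[of z y] un[of z q] pq PQ(1) by auto
    qed (use eQ pq in auto)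
  next
    case 3
    interpret nontrivial_graph V E using S 3 by unfold_locales
    \<comment> \<open>In this case \<open>V\<close> is itself a prime module, so the hypothesis
      applies to the quotient of the whole graph.\<close>
    have V: "induced E V = E" using E(4) by (auto simp: induced_def)
    have "is_module V E V" using E(4) by (auto simp: is_module_iff)
    moreover have "V \<inter> M' = M'" if "is_module V E M'" for M' using that by (auto simp: is_module_def)
    ultimately have "strong_module V E V" by (auto simp: strong_module_def)
    then have "prime_module V E V"
      using split_free_iff_connected[OF S less.prems(2)] 3 V by (simp add: prime_module_def)
    then have "polar_cat PP QE" using less.prems(3) 3 V unfolding polarcat_prime_def by fastforce
    then have "explainable_level1 PP QE" using polar_cat_explainable quotient_simple by blast
    moreover have "explainable_level1 M E" if M: "M \<in> PP" for M
    proof (rule part)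
      show "M \<subset> V" "M \<noteq> {}" using PP_subset PP_proper PP_nonempty M by blast+
      show "prime_module V E M'" if "prime_module M (induced E M) M'" for M'
        using prime_module_of_strong_module[OF S PP_strong[OF M] that] .
    qed
    ultimately show ?thesis by (rule explainable_from_quotient)
  qed
qed

theorem mainTheorem1:
  fixes V :: "'a set" and E :: "('a \<times> 'a) set"
  assumes "simple_graph V E" and "V \<noteq> {}"
  shows "explainable_level1 V E \<longleftrightarrow> polarcat_prime V E"
  using explainable_imp_polarcat_prime polarcat_prime_imp_explainable assms by blast

end
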